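(* Let $d\ge2$ be a fixed integer and let $\delta>0$, $b\ne0$, $c\ne0$, $B>0$ be given. There is a constant $A_0$ depending only on $d,\delta,b,c,B$ such that for every $A\ge A_0$ the following holds for all integers $n\ge2$. Let $w_1,\dots,w_n$ be real numbers with $\sum_{i=1}^n w_i=0$, $\sum_{i=1}^n w_i^2=1$, and $|w_i-w_j|\le\frac{1}{A\sqrt{\log n}}$ for all distinct $i,j$. Let $I\subset[n]$ with $|I|\ge\delta n$, and let $(v_1,\dots,v_n)$ and $(v_1',\dots,v_n')$ be real sequences with $$v_i=\frac{P_d(i)}{n^d}\quad\text{and}\quad v_i'=\frac{P_{d-1}(i)}{n^{d-1}}\quad\text{for all } i\in I$$ (arbitrary for $i\notin I$), where $P_d$ and $P_{d-1}$ are real polynomials of degrees $d$ and $d-1$ with leading coefficients $b$ and $c$, respectively, whose remaining coefficients may depend on $n$, such that $|v_i|,|v_i'|\le B$ for all $i\in I$. Let $\pi$ be a uniformly random permutation of $[n]$. (a) There is a constant $K$ depending only on $A,B,d,\delta,b,c$ such that for all $L_1,L_2\in\mathbb{R}$, $$\mathbb{P}\Big(\Big|\sum_{i=1}^n w_iv_{\pi(i)}-L_1\Big|\le\frac1n\ \wedge\ \Big|\sum_{i=1}^n w_iv'_{\pi(i)}-L_2\Big|\le\frac1n\Big)\le\frac{K}{n^2}.$$ (b) If in addition $|v_i|,|v_i'|\le\widetilde B$ for all $i\in[n]$, for some constant $\widetilde B>0$, then there are constants $K',\kappa>0$ depending only on $A,B,\widetilde B,d,\delta,b,c$ such that for all $L_1,L_2\in\mathbb{R}$,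 $$\mathbb{P}\Big(\Big|\sum_{i=1}^n w_iv_{\pi(i)}-L_1\Big|\le\frac1n\ \wedge\ \Big|\sum_{i=1}^n w_iv'_{\pi(i)}-L_2\Big|\le\frac1n\Big)\le\frac{K'}{n^2}e^{-\kappa(L_1^2+L_2^2)}.$$
   Context: $[n]=\{1,\dots,n\}$. The same permutation $\pi$ appears in both sums. *)

theory Defs
  imports "HOL-Probability.Probability" "HOL-Combinatorics.Permutations"
    "HOL-Computational_Algebra.Polynomial"
begin

definition spread_weights :: "real \<Rightarrow> nat \<Rightarrow> (nat \<Rightarrow> real) \<Rightarrow> bool" where
  "spread_weights A n w \<longleftrightarrow>
     (\<Sum>i\<in>{1..n}. w i) = 0 \<and>
     (\<Sum>i\<in>{1..n}. (w i)\<^sup>2) = 1 \<and>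
     (\<forall>i\<in>{1..n}. \<forall>j\<in>{1..n}. i \<noteq> j \<longrightarrow> \<bar>w i - w j\<bar> \<le> 1 / (A * sqrt (ln (real n))))"

text \<open>The polynomial is chosen separately for each \<open>n\<close>; only its degree \<open>k\<close> and its leading
  coefficient \<open>a\<close> are prescribed. The values of \<open>v\<close> outside \<open>I\<close> are unconstrained.\<close>

definition bounded_poly_values ::
    "nat \<Rightarrow> real \<Rightarrow> real \<Rightarrow> nat \<Rightarrow> nat set \<Rightarrow> (nat \<Rightarrow> real) \<Rightarrow> bool" where
  "bounded_poly_values k a B n I v \<longleftrightarrow>
     (\<exists>P :: real poly. degree P = k \<and> lead_coeff P = a \<and>
        (\<forall>i\<in>I. v i = poly P (real i) / real n ^ k)) \<and>
     (\<forall>i\<in>I. \<bar>v i\<bar> \<le> B)"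

definition admissible ::
    "nat \<Rightarrow> real \<Rightarrow> real \<Rightarrow> real \<Rightarrow> real \<Rightarrow> real \<Rightarrow> nat \<Rightarrow>
     (nat \<Rightarrow> real) \<Rightarrow> nat set \<Rightarrow> (nat \<Rightarrow> real) \<Rightarrow> (nat \<Rightarrow> real) \<Rightarrow> bool" where
  "admissible d \<delta> b c B A n w I v v' \<longleftrightarrow>
     spread_weights A n w \<and>
     I \<subseteq> {1..n} \<and> real (card I) \<ge> \<delta> * real n \<and>
     bounded_poly_values d b B n I v \<and>
     bounded_poly_values (d - 1) c B n I v'"

definition uniform_perm :: "nat \<Rightarrow> (nat \<Rightarrow> nat) pmf" where
  "uniform_perm n = pmf_of_set {\<pi>. \<pi> permutes {1..n}}"

definition joint_small_ball_prob ::
    "nat \<Rightarrow> (nat \<Rightarrow> real) \<Rightarrow> (nat \<Rightarrow> real) \<Rightarrow> (nat \<Rightarrow> real) \<Rightarrow> real \<Rightarrow> real \<Rightarrow> real" where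
  "joint_small_ball_prob n w v v' L1 L2 =
     measure_pmf.prob (uniform_perm n)
       {\<pi>. \<bar>(\<Sum>i\<in>{1..n}. w i * v (\<pi> i)) - L1\<bar> \<le> 1 / real n \<and>
            \<bar>(\<Sum>i\<in>{1..n}. w i * v' (\<pi> i)) - L2\<bar> \<le> 1 / real n}"

end

theory Submission
  imports Defs
begin

text \<open>Write \<open>V \<pi>\<close> for the pair of the two random sums. Swapping the values of \<open>\<pi>\<close> at disjoint pairs of
  positions preserves the uniform distribution, so conditionally on \<open>\<pi>\<close> the vector \<open>V \<pi>\<close> is a
  Rademacher sum, and a Fejer kernel bounds its small-ball probability at scale \<open>1/n\<close> by a sum over
  integer frequencies \<open>(s, t)\<close>, \<open>\<bar>s\<bar>, \<bar>t\<bar> < n\<close>, of products of cosines. Only \<open>\<delta> n / 4\<close> pairs are used, so when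
  \<open>\<pi>\<close> is revealed pair by pair a positive proportion of \<open>I\<close> always remains, and each factor gains
  \<open>1 - c min(1, \<Delta>\<^sup>2 (s\<^sup>2 + t\<^sup>2))\<close>, where \<open>\<Delta>\<close> is half the gap of the two weights. This gain is a variance bound
  for \<open>exp (i q)\<close> with \<open>q\<close> polynomial, proved on short blocks where \<open>q\<close> varies by at most \<open>1\<close>. As
  \<open>\<Delta> \<le> 1 / (A sqrt (ln n))\<close> and the sum of the \<open>\<Delta>\<^sup>2\<close> is bounded below, the product is at most
  \<open>exp (- c (s\<^sup>2 + t\<^sup>2)) + n powr (- c A\<^sup>2)\<close>, and the second term is harmless once \<open>A\<close> is large.
  For the Gaussian factor two disjoint families of pairs are used: one carries an exponential tilt,
  controlled by the sub-Gaussian moment generating function of \<open>V\<close>, the other the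
  anti-concentration.\<close>

section \<open>Sums over random bijections\<close>

text \<open>The lower coefficients of the two polynomials may vary with \<open>n\<close> without any
  control. Uniformity comes from boundedness on \<open>I\<close>: a polynomial of fixed degree that
  is bounded on a set of positive density has bounded coefficients after rescaling to the unit
  interval. The leading coefficients, prescribed in two consecutive degrees, then keep the
  derivative of every combination of the two from being small throughout. The size of
  \<open>A\<close> is dictated by the frequency count. The Fejer sum has n^4 terms and normalisation
  1 / n^4, and only about n^2 of its terms lie in the Gaussian core, so an additive error of 1 / n^2
  at each frequency is just affordable. All \<open>n \<ge> 2\<close> are allowed, yet many steps
  need \<open>n\<close> large. The weight conditions alone force A^2 ln n \<le> n, so each such
  requirement turns into one on \<open>A\<close>. Absolute values of cosines are awkward to average
  while a tilt is present. Cauchy-Schwarz separates the two factors and leaves squared cosines, for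
  which cos^2 = 1 - sin^2 gives an exact average.\<close>

definition bij_ext :: "'a set \<Rightarrow> 'b set \<Rightarrow> ('a \<Rightarrow> 'b) \<Rightarrow> ('a \<Rightarrow> 'b) set" where
  "bij_ext X Y g = {f. bij_betw f X Y \<and> (\<forall>x. x \<notin> X \<longrightarrow> f x = g x)}"

lemma bij_ext_empty: "bij_ext {} Y g = (if Y = {} then {g} else {})"
  by (auto simp: bij_ext_def bij_betw_def)

text \<open>Revealing one value leaves an object of the same kind, a bijection from \<open>X\<close>
  onto \<open>Y - {a}\<close>. Domain and range must therefore vary separately in inductions, and
  storing revealed values in \<open>g\<close> keeps all stages inside one function type.\<close>

lemma bij_ext_insert:
  assumes "x \<notin> X"
  shows "bij_ext (insert x X) Y g = (\<Union>a\<in>Y. bij_ext X (Y - {a}) (g(x := a)))"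
proof (intro equalityI subsetI)
  fix f assume f: "f \<in> bij_ext (insert x X) Y g"
  then have b: "bij_betw f (insert x X) Y" and e: "\<And>y. y \<notin> insert x X \<Longrightarrow> f y = g y"
    by (auto simp: bij_ext_def)
  have "f x \<in> Y" using b by (auto simp: bij_betw_def)
  moreover have "bij_betw f X (Y - {f x})"
    using bij_betw_DiffI[OF b bij_betw_singletonI[of f x "f x"]] b assms
    by (auto simp: bij_betw_def)
  ultimately show "f \<in> (\<Union>a\<in>Y. bij_ext X (Y - {a}) (g(x := a)))"
    using e by (auto simp: bij_ext_def)
next
  fix f assume "f \<in> (\<Union>a\<in>Y. bij_ext X (Y - {a}) (g(x := a)))"
  then obtain a where a: "a \<in> Y" and b: "bij_betw f X (Y - {a})"
    and e: "\<And>y. y \<notin> X \<Longrightarrow> f y = (g(x := a)) y"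
    by (auto simp: bij_ext_def)
  have "f x = a" using e[OF assms] by simp
  then have "bij_betw f (insert x X) Y"
    using b a assms by (auto simp: bij_betw_def)
  then show "f \<in> bij_ext (insert x X) Y g"
    using e by (auto simp: bij_ext_def)
qed

lemma finite_bij_ext: "finite X \<Longrightarrow> finite Y \<Longrightarrow> finite (bij_ext X Y g)"
  by (induction X arbitrary: Y g rule: finite_induct) (auto simp: bij_ext_empty bij_ext_insert)

lemma sum_bij_ext_insert:
  fixes F :: "('a \<Rightarrow> 'b) \<Rightarrow> real"
  assumes "finite X" "finite Y" "x \<notin> X"
  shows "sum F (bij_ext (insert x X) Y g) = (\<Sum>a\<in>Y. sum F (bij_ext X (Y - {a}) (g(x := a))))"
  unfolding bij_ext_insert[OF assms(3)]
proof (rule sum.UNION_disjoint)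
  show "\<forall>i\<in>Y. \<forall>j\<in>Y. i \<noteq> j \<longrightarrow>
      bij_ext X (Y - {i}) (g(x := i)) \<inter> bij_ext X (Y - {j}) (g(x := j)) = {}"
    using assms(3) by (fastforce simp: bij_ext_def)
qed (use assms in \<open>auto intro: finite_bij_ext\<close>)

lemma card_bij_ext:
  assumes "finite X" "finite Y" "card X = card Y"
  shows "real (card (bij_ext X Y g)) = fact (card X)"
  using assms
proof (induction X arbitrary: Y g rule: finite_induct)
  case empty
  then show ?case by (simp add: bij_ext_empty)
next
  case (insert x X)
  have "real (card (bij_ext (insert x X) Y g)) = (\<Sum>f\<in>bij_ext (insert x X) Y g. 1)"
    by simp
  also have "\<dots> = (\<Sum>a\<in>Y. real (card (bij_ext X (Y - {a}) (g(x := a)))))"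
    by (subst sum_bij_ext_insert) (use insert in auto)
  also have "\<dots> = (\<Sum>a\<in>Y. fact (card X))"
    by (intro sum.cong refl insert.IH) (use insert in auto)
  also have "\<dots> = fact (card (insert x X))"
    using insert.hyps insert.prems(2)[symmetric] by simp
  finally show ?case .
qed

lemma permutes_eq_bij_ext: "{\<pi>. \<pi> permutes X} = bij_ext X X id"
  by (auto simp: bij_ext_def permutes_imp_bij permutes_not_in intro: bij_imp_permutes)

text \<open>The two values at a pair form a uniform ordered pair of distinct elements of the values
  still available. Each revealed pair removes two of them, so only sets \<open>Z\<close> missing at
  most \<open>2 * length ps\<close> values ever occur, and an average bound on those sets multiplies
  up although the factors are dependent.\<close>

lemma sum_bij_ext_prod_le:
  fixes G :: "'a \<times> 'a \<Rightarrow> 'b \<Rightarrow> 'b \<Rightarrow> real"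
  assumes "finite X" "finite Y" "card X = card Y"
    and "distinct (map fst ps @ map snd ps)" "set (map fst ps @ map snd ps) \<subseteq> X"
    and "\<And>p a b. 0 \<le> G p a b" and "\<And>p. 0 \<le> \<rho> p"
    and "\<And>p Z. p \<in> set ps \<Longrightarrow> Z \<subseteq> Y \<Longrightarrow> card Y \<le> card Z + 2 * length ps \<Longrightarrow>
       (\<Sum>a\<in>Z. \<Sum>b\<in>Z - {a}. G p a b) \<le> \<rho> p * (real (card Z) * (real (card Z) - 1))"
  shows "(\<Sum>f\<in>bij_ext X Y g. \<Prod>p\<leftarrow>ps. G p (f (fst p)) (f (snd p)))
    \<le> fact (card X) * (\<Prod>p\<leftarrow>ps. \<rho> p)"
  using assms(1-5,8)
proof (induction ps arbitrary: X Y g)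
  case Nil
  then show ?case by (simp add: card_bij_ext)
next
  case (Cons p ps)
  obtain i j where p: "p = (i, j)" by fastforce
  define X' where "X' = X - {i, j}"
  have ij: "i \<noteq> j" "i \<in> X" "j \<in> X" using Cons.prems(4,5) p by auto
  have X: "X = insert i (insert j X')" "i \<notin> insert j X'" "j \<notin> X'" "finite X'"
    using ij Cons.prems(1) by (auto simp: X'_def)
  have cX: "card X = card X' + 2" using X by simp
  define P where "P = (\<Prod>p\<leftarrow>ps. \<rho> p)"
  have P0: "P \<ge> 0" unfolding P_def by (intro prod_list_nonneg) (auto simp: assms(7))
  have sub: "set (map fst ps @ map snd ps) \<subseteq> X'"
    using Cons.prems(4,5) p by (auto simp: X'_def)
  have inner: "(\<Sum>f\<in>bij_ext X' (Y - {a} - {b}) (g(i := a, j := b)).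
        \<Prod>p\<leftarrow>p # ps. G p (f (fst p)) (f (snd p))) \<le> G p a b * (fact (card X') * P)"
    if ab: "a \<in> Y" "b \<in> Y - {a}" for a b
  proof -
    have cY: "card (Y - {a} - {b}) + 2 = card Y"
    proof -
      have "card Y \<ge> 2" using Cons.prems(3) cX by simp
      then show ?thesis using ab Cons.prems(2) by (simp add: card_Diff_singleton_if)
    qed
    have "(\<Sum>f\<in>bij_ext X' (Y - {a} - {b}) (g(i := a, j := b)).
        \<Prod>p\<leftarrow>p # ps. G p (f (fst p)) (f (snd p)))
      = (\<Sum>f\<in>bij_ext X' (Y - {a} - {b}) (g(i := a, j := b)).
          G p a b * (\<Prod>p\<leftarrow>ps. G p (f (fst p)) (f (snd p))))"
      by (intro sum.cong refl) (use X ij p in \<open>auto simp: bij_ext_def\<close>)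
    also have "\<dots> = G p a b * (\<Sum>f\<in>bij_ext X' (Y - {a} - {b}) (g(i := a, j := b)).
          \<Prod>p\<leftarrow>ps. G p (f (fst p)) (f (snd p)))"
      by (simp add: sum_distrib_left)
    also have "\<dots> \<le> G p a b * (fact (card X') * P)"
      unfolding P_def
    proof (intro mult_left_mono Cons.IH)
      show "card X' = card (Y - {a} - {b})" using cY cX Cons.prems(3) by simp
      fix q Z assume "q \<in> set ps" "Z \<subseteq> Y - {a} - {b}"
        "card (Y - {a} - {b}) \<le> card Z + 2 * length ps"
      then show "(\<Sum>a\<in>Z. \<Sum>b\<in>Z - {a}. G q a b)
          \<le> \<rho> q * (real (card Z) * (real (card Z) - 1))"
        using cY by (intro Cons.prems(6)) auto
    qed (use Cons.prems sub X assms(6) in auto)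
    finally show ?thesis .
  qed
  have "(\<Sum>f\<in>bij_ext X Y g. \<Prod>p\<leftarrow>p # ps. G p (f (fst p)) (f (snd p)))
    = (\<Sum>a\<in>Y. \<Sum>b\<in>Y - {a}. \<Sum>f\<in>bij_ext X' (Y - {a} - {b}) (g(i := a, j := b)).
        \<Prod>p\<leftarrow>p # ps. G p (f (fst p)) (f (snd p)))"
    unfolding X(1) using X Cons.prems(2) by (simp add: sum_bij_ext_insert del: list.map prod_list.Cons)
  also have "\<dots> \<le> (\<Sum>a\<in>Y. \<Sum>b\<in>Y - {a}. G p a b * (fact (card X') * P))"
    by (intro sum_mono inner)
  also have "\<dots> = (\<Sum>a\<in>Y. \<Sum>b\<in>Y - {a}. G p a b) * (fact (card X') * P)"
    by (simp add: sum_distrib_right)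
  also have "\<dots> \<le> (\<rho> p * (real (card Y) * (real (card Y) - 1))) * (fact (card X') * P)"
    using P0 by (intro mult_right_mono Cons.prems(6)) auto
  also have "\<dots> = fact (card X) * (\<Prod>p\<leftarrow>p # ps. \<rho> p)"
  proof -
    have c: "card Y = card X' + 2" using Cons.prems(3) cX by simp
    show ?thesis unfolding c cX P_def by (simp add: algebra_simps)
  qed
  finally show ?case .
qed

section \<open>Sub-Gaussian exponential moments\<close>

lemma exp_le_add_exp_square: "exp x \<le> x + exp (x\<^sup>2)" for x :: real
proof (cases "\<bar>x\<bar> \<le> 1")
  case True
  have "exp x \<le> 1 + x + x\<^sup>2"
  proof (cases "x \<ge> 0")
    case True
    then show ?thesis using exp_bound[of x] \<open>\<bar>x\<bar> \<le> 1\<close> by auto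
  next
    case False
    define y where "y = - x"
    have y: "0 \<le> y" "y \<le> 1" using False \<open>\<bar>x\<bar> \<le> 1\<close> by (auto simp: y_def)
    \<comment> \<open>For a negative argument the claim is a lower bound on \<open>exp y\<close>;
      the product of its quadratic Taylor polynomial with 1 - y + y^2 exceeds 1 by y^2 (1 + y + y^2)
      / 2.\<close>
    have "1 \<le> (1 + y + y\<^sup>2/2) * (1 - y + y\<^sup>2)"
    proof -
      have "(1 + y + y\<^sup>2/2) * (1 - y + y\<^sup>2) = 1 + y\<^sup>2 * (1/2 + y/2 + y\<^sup>2/2)"
        by (simp add: power2_eq_square field_simps)
      then show ?thesis using y by simp
    qed
    also have "\<dots> \<le> exp y * (1 - y + y\<^sup>2)"
      using exp_lower_Taylor_quadratic[of y] y
      by (intro mult_right_mono) (auto simp: power2_eq_square)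
    finally have "exp (- y) \<le> 1 - y + y\<^sup>2" by (simp add: exp_minus field_simps)
    then show ?thesis by (simp add: y_def)
  qed
  moreover have "1 + x\<^sup>2 \<le> exp (x\<^sup>2)" by (rule exp_ge_add_one_self)
  ultimately show ?thesis by linarith
next
  case False
  show ?thesis
  proof (cases "x > 0")
    case True
    then have "x \<le> x\<^sup>2" using False by (simp add: power2_eq_square)
    then have "exp x \<le> exp (x\<^sup>2)" by simp
    then show ?thesis using True by linarith
  next
    case neg: False
    have "1 * -x \<le> -x * -x" using False neg by (intro mult_right_mono) auto
    then have "- x \<le> x\<^sup>2" by (simp add: power2_eq_square)
    moreover have "1 + x\<^sup>2 \<le> exp (x\<^sup>2)" by (rule exp_ge_add_one_self)
    moreover have "exp x \<le> 1" using neg by simp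
    ultimately show ?thesis by linarith
  qed
qed

text \<open>Keeping the linear term in exp x \<le> x + exp (x^2) lets it cancel in the sum, and as
  that inequality holds for every real x, no smallness of \<open>f\<close> is required.\<close>

lemma sum_exp_centered_le:
  fixes f :: "'a \<Rightarrow> real"
  assumes "finite Y" "(\<Sum>a\<in>Y. f a) = 0" "\<And>a. a \<in> Y \<Longrightarrow> (f a)\<^sup>2 \<le> K"
  shows "(\<Sum>a\<in>Y. exp (f a)) \<le> real (card Y) * exp K"
proof -
  have "(\<Sum>a\<in>Y. exp (f a)) \<le> (\<Sum>a\<in>Y. f a + exp K)"
    by (intro sum_mono order.trans[OF exp_le_add_exp_square]) (simp add: assms(3))
  then show ?thesis using assms(2) by (simp add: sum.distrib)
qed

text \<open>Revealing the values one at a time turns the exponent into a martingale whose increment at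
  \<open>x\<close> is the deviation of \<open>w x\<close> from the mean of the remaining weights times the deviation of the
  revealed value from the mean of the remaining values. The squared weight deviations telescope to
  the variance of \<open>w\<close>, up to a factor \<open>(N + 1) / N \<le> 2\<close> with
  \<open>N\<close> remaining weights.\<close>

lemma sum_bij_ext_exp_le:
  fixes w :: "'a \<Rightarrow> real" and u :: "'b \<Rightarrow> real"
  assumes "finite X" "finite Y" "card X = card Y" "\<And>a. a \<in> Y \<Longrightarrow> \<bar>u a\<bar> \<le> F" "X \<noteq> {}"
  shows "(\<Sum>f\<in>bij_ext X Y g. exp (\<Sum>x\<in>X. w x * u (f x)))
    \<le> fact (card X) * exp (sum w X * sum u Y / card X
        + 8 * F\<^sup>2 * ((\<Sum>x\<in>X. (w x)\<^sup>2) - (sum w X)\<^sup>2 / card X))"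
  using assms(1,5,2,3,4)
proof (induction X arbitrary: Y g rule: finite_ne_induct)
  case (singleton x)
  then obtain y where Y: "Y = {y}" by (metis card_1_singleton_iff card.empty card.insert empty_iff finite.emptyI One_nat_def)
  show ?case
    using sum_bij_ext_insert[of "{}" Y x "\<lambda>f. exp (\<Sum>x\<in>{x}. w x * u (f x))" g]
    by (simp add: Y bij_ext_empty)
next
  case (insert x X)
  define N where "N = real (card X)"
  define W where "W = sum w X"
  define V where "V = (\<Sum>x\<in>X. (w x)\<^sup>2) - W\<^sup>2 / N"
  define U where "U = sum u Y"
  have N: "N \<ge> 1" using insert.hyps by (simp add: N_def Suc_le_eq card_gt_0_iff)
  have cY: "card Y = card X + 1" using insert by simp
  define r where "r = w x - W / N"
  have F0: "F \<ge> 0"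
  proof -
    obtain a where "a \<in> Y" using cY by fastforce
    then show ?thesis using insert.prems(3)[of a] by linarith
  qed
  have step: "(\<Sum>f\<in>bij_ext X (Y - {a}) (g(x := a)). exp (\<Sum>y\<in>insert x X. w y * u (f y)))
      \<le> fact (card X) * exp ((w x + W) * U / (N + 1) + 8 * F\<^sup>2 * V) * exp (r * (u a - U / (N + 1)))"
    if a: "a \<in> Y" for a
  proof -
    have "(\<Sum>f\<in>bij_ext X (Y - {a}) (g(x := a)). exp (\<Sum>y\<in>insert x X. w y * u (f y)))
      = (\<Sum>f\<in>bij_ext X (Y - {a}) (g(x := a)). exp (w x * u a) * exp (\<Sum>y\<in>X. w y * u (f y)))"
      using insert.hyps by (intro sum.cong refl) (auto simp: bij_ext_def exp_add)
    also have "\<dots> = exp (w x * u a) * (\<Sum>f\<in>bij_ext X (Y - {a}) (g(x := a)). exp (\<Sum>y\<in>X. w y * u (f y)))"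
      by (simp add: sum_distrib_left)
    also have "\<dots> \<le> exp (w x * u a) * (fact (card X) * exp (W * (U - u a) / N + 8 * F\<^sup>2 * V))"
    proof (intro mult_left_mono)
      have "sum u (Y - {a}) = U - u a" using a insert.prems(1) by (simp add: U_def sum_diff1)
      then show "(\<Sum>f\<in>bij_ext X (Y - {a}) (g(x := a)). exp (\<Sum>y\<in>X. w y * u (f y)))
          \<le> fact (card X) * exp (W * (U - u a) / N + 8 * F\<^sup>2 * V)"
        using insert.IH[of "Y - {a}" "g(x := a)"] insert.prems cY a
        by (simp add: W_def N_def V_def fun_upd_def)
    qed auto
    also have "\<dots> = fact (card X) * exp (w x * u a + W * (U - u a) / N + 8 * F\<^sup>2 * V)"
      by (simp add: exp_add)
    \<comment> \<open>This isolates the only summand that depends on \<open>a\<close>, written so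
      that it is centred over \<open>Y\<close>.\<close>
    also have "w x * u a + W * (U - u a) / N + 8 * F\<^sup>2 * V
       = (w x + W) * U / (N + 1) + 8 * F\<^sup>2 * V + r * (u a - U / (N + 1))"
      using N by (simp add: r_def divide_simps) algebra
    finally show ?thesis by (simp only: exp_add mult.assoc)
  qed
  have "(\<Sum>f\<in>bij_ext (insert x X) Y g. exp (\<Sum>y\<in>insert x X. w y * u (f y)))
    = (\<Sum>a\<in>Y. \<Sum>f\<in>bij_ext X (Y - {a}) (g(x := a)). exp (\<Sum>y\<in>insert x X. w y * u (f y)))"
    by (rule sum_bij_ext_insert) (use insert in auto)
  also have "\<dots> \<le> (\<Sum>a\<in>Y. fact (card X) * exp ((w x + W) * U / (N + 1) + 8 * F\<^sup>2 * V)
       * exp (r * (u a - U / (N + 1))))"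
    by (intro sum_mono step)
  also have "\<dots> = fact (card X) * exp ((w x + W) * U / (N + 1) + 8 * F\<^sup>2 * V)
       * (\<Sum>a\<in>Y. exp (r * (u a - U / (N + 1))))"
    by (simp add: sum_distrib_left)
  also have "(\<Sum>a\<in>Y. exp (r * (u a - U / (N + 1)))) \<le> real (card Y) * exp (4 * F\<^sup>2 * r\<^sup>2)"
  proof (rule sum_exp_centered_le)
    show "(\<Sum>a\<in>Y. r * (u a - U / (N + 1))) = 0"
    proof -
      have "real (card Y) = N + 1" using cY by (simp add: N_def)
      then have "(\<Sum>a\<in>Y. u a - U / (N + 1)) = 0"
        using N by (simp add: sum_subtractf U_def)
      then show ?thesis by (simp flip: sum_distrib_left)
    qed
    fix a assume a: "a \<in> Y"
    have "\<bar>U\<bar> \<le> (\<Sum>a\<in>Y. F)"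
      unfolding U_def by (rule order.trans[OF sum_abs]) (intro sum_mono insert.prems(3))
    then have "\<bar>U / (N + 1)\<bar> \<le> F"
      using cY N by (simp add: N_def field_simps)
    then have "\<bar>u a - U / (N + 1)\<bar> \<le> 2 * F" using insert.prems(3)[OF a] by linarith
    then have "(u a - U / (N + 1))\<^sup>2 \<le> (2 * F)\<^sup>2" using F0 by (intro abs_le_square_iff[THEN iffD1]) auto
    then have "r\<^sup>2 * (u a - U / (N + 1))\<^sup>2 \<le> r\<^sup>2 * (2 * F)\<^sup>2" by (intro mult_left_mono) auto
    then show "(r * (u a - U / (N + 1)))\<^sup>2 \<le> 4 * F\<^sup>2 * r\<^sup>2"
      by (simp add: power_mult_distrib mult_ac)
  qed (use insert in auto)
  \<comment> \<open>The constant 8 arises here: a deviation of at most \<open>2 * F\<close>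
    contributes 4 F^2, and replacing \<open>r\<^sup>2\<close> by the increment of the weight
    variance costs a further factor 2.\<close>
  also have "exp (4 * F\<^sup>2 * r\<^sup>2) \<le> exp (8 * F\<^sup>2 * ((w x)\<^sup>2 + W\<^sup>2 / N - (w x + W)\<^sup>2 / (N + 1)))"
  proof -
    have "(w x)\<^sup>2 + W\<^sup>2 / N - (w x + W)\<^sup>2 / (N + 1) = N / (N + 1) * r\<^sup>2"
      using N unfolding r_def by (simp add: divide_simps power2_eq_square) algebra
    moreover have "N / (N + 1) * r\<^sup>2 \<ge> 1 / 2 * r\<^sup>2"
      using N by (intro mult_right_mono) (auto simp: field_simps)
    ultimately have "8 * F\<^sup>2 * (1 / 2 * r\<^sup>2) \<le> 8 * F\<^sup>2 * ((w x)\<^sup>2 + W\<^sup>2 / N - (w x + W)\<^sup>2 / (N + 1))"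
      by (intro mult_left_mono) auto
    then show ?thesis by simp
  qed
  finally have "(\<Sum>f\<in>bij_ext (insert x X) Y g. exp (\<Sum>y\<in>insert x X. w y * u (f y)))
    \<le> fact (card X) * exp ((w x + W) * U / (N + 1) + 8 * F\<^sup>2 * V) * (real (card Y) *
        exp (8 * F\<^sup>2 * ((w x)\<^sup>2 + W\<^sup>2 / N - (w x + W)\<^sup>2 / (N + 1))))"
    by (simp add: mult_left_mono)
  also have "\<dots> = fact (card (insert x X)) * exp ((w x + W) * U / (N + 1) + 8 * F\<^sup>2 *
     ((w x)\<^sup>2 + (\<Sum>x\<in>X. (w x)\<^sup>2) - (w x + W)\<^sup>2 / (N + 1)))"
    using insert.hyps cY
    by (simp add: exp_add[symmetric] V_def N_def algebra_simps)
  finally show ?case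
    using insert.hyps by (simp add: N_def W_def U_def add.commute)
qed

section \<open>Rademacher averages of swapped permutations\<close>

text \<open>The signed sum accumulates in \<open>m\<close>, so that one swap of two values
  corresponds to one unfolding of the recursion.\<close>

fun rademacher_mean :: "'a::real_vector list \<Rightarrow> ('a \<Rightarrow> real) \<Rightarrow> 'a \<Rightarrow> real" where
  "rademacher_mean [] H m = H m"
| "rademacher_mean (x # xs) H m =
     (rademacher_mean xs H (m + x) + rademacher_mean xs H (m - x)) / 2"

lemma rademacher_mean_mono:
  "(\<And>y. H y \<le> H' y) \<Longrightarrow> rademacher_mean xs H m \<le> rademacher_mean xs H' m"
  by (induction xs arbitrary: m) (auto intro!: add_mono divide_right_mono)

lemma rademacher_mean_add:
  "rademacher_mean xs (\<lambda>y. H y + H' y) m = rademacher_mean xs H m + rademacher_mean xs H' m"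
  by (induction xs arbitrary: m) (auto simp: field_simps)

lemma rademacher_mean_cmult:
  "rademacher_mean xs (\<lambda>y. k * H y) m = k * rademacher_mean xs H m"
  by (induction xs arbitrary: m) (auto simp: field_simps)

lemma rademacher_mean_shift:
  "rademacher_mean xs (\<lambda>y. H (y + z)) m = rademacher_mean xs H (m + z)"
proof (induction xs arbitrary: m)
  case (Cons x xs)
  have eq: "m + x + z = m + z + x" "m - x + z = m + z - x" by auto
  show ?case unfolding rademacher_mean.simps Cons eq ..
qed simp

lemma rademacher_mean_sum:
  "rademacher_mean xs (\<lambda>y. \<Sum>j\<in>J. H j y) m = (\<Sum>j\<in>J. rademacher_mean xs (H j) m)"
  by (induction xs arbitrary: m) (auto simp: sum.distrib simp flip: sum_divide_distrib)

text \<open>This is the characteristic function of a Rademacher sum in real form; the free phase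
  \<open>\<phi>\<close> carries centre and shift.\<close>

lemma rademacher_mean_cos:
  fixes m :: "'a::real_inner"
  shows "rademacher_mean xs (\<lambda>y. cos (\<theta> \<bullet> y + \<phi>)) m = cos (\<theta> \<bullet> m + \<phi>) * (\<Prod>x\<leftarrow>xs. cos (\<theta> \<bullet> x))"
proof (induction xs arbitrary: m)
  case (Cons x xs)
  have "cos (\<theta> \<bullet> (m + x) + \<phi>) + cos (\<theta> \<bullet> (m - x) + \<phi>) = 2 * cos (\<theta> \<bullet> m + \<phi>) * cos (\<theta> \<bullet> x)"
    by (simp add: inner_add_right inner_diff_right cos_add cos_diff sin_add sin_diff algebra_simps)
  then show ?case by (simp add: Cons) algebra
qed simp

lemma rademacher_mean_exp:
  fixes m :: "'a::real_inner"
  shows "rademacher_mean xs (\<lambda>y. exp (\<theta> \<bullet> y)) m = exp (\<theta> \<bullet> m) * (\<Prod>x\<leftarrow>xs. cosh (\<theta> \<bullet> x))"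
proof (induction xs arbitrary: m)
  case (Cons x xs)
  have "exp (\<theta> \<bullet> (m + x)) + exp (\<theta> \<bullet> (m - x)) = 2 * exp (\<theta> \<bullet> m) * cosh (\<theta> \<bullet> x)"
    by (simp add: inner_add_right inner_diff_right exp_add exp_diff exp_minus cosh_field_def field_simps)
  then show ?case by (simp add: Cons) algebra
qed simp

text \<open>The tilt sees only the signs of \<open>ys\<close>. For fixed signs of \<open>ys\<close>
  the bound \<open>q\<close> applies to the average over \<open>xs\<close>, whatever the shift, and
  the exponential is averaged afterwards.\<close>

lemma rademacher_mean_exp_mult_le:
  fixes xs ys :: "'a::real_inner list"
  assumes "\<And>z m. rademacher_mean xs (\<lambda>y. H (y + z)) m \<le> q"
  shows "rademacher_mean xs (\<lambda>y. rademacher_mean ys (\<lambda>x. exp (\<theta> \<bullet> x) * H (y + x)) z) m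
    \<le> q * exp (\<theta> \<bullet> z) * (\<Prod>x\<leftarrow>ys. cosh (\<theta> \<bullet> x))"
proof (induction ys arbitrary: z)
  case Nil
  then show ?case
    using mult_left_mono[OF assms[of z m], of "exp (\<theta> \<bullet> z)"]
    by (simp add: rademacher_mean_cmult mult.commute[of q])
next
  case (Cons x ys)
  let ?R = "\<lambda>z. rademacher_mean xs (\<lambda>y. rademacher_mean ys (\<lambda>x. exp (\<theta> \<bullet> x) * H (y + x)) z) m"
  have "rademacher_mean xs (\<lambda>y. rademacher_mean (x # ys) (\<lambda>x. exp (\<theta> \<bullet> x) * H (y + x)) z) m
     = (?R (z + x) + ?R (z - x)) / 2"
    using rademacher_mean_cmult[of xs "1/2"
      "\<lambda>y. rademacher_mean ys (\<lambda>x. exp (\<theta> \<bullet> x) * H (y + x)) (z + x)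
         + rademacher_mean ys (\<lambda>x. exp (\<theta> \<bullet> x) * H (y + x)) (z - x)" m]
    by (simp add: rademacher_mean_add)
  also have "\<dots> \<le> (q * exp (\<theta> \<bullet> (z + x)) * (\<Prod>x\<leftarrow>ys. cosh (\<theta> \<bullet> x))
      + q * exp (\<theta> \<bullet> (z - x)) * (\<Prod>x\<leftarrow>ys. cosh (\<theta> \<bullet> x))) / 2"
    by (intro divide_right_mono add_mono Cons) auto
  also have "\<dots> = q * exp (\<theta> \<bullet> z) * (\<Prod>x\<leftarrow>x # ys. cosh (\<theta> \<bullet> x))"
    by (simp add: inner_add_right inner_diff_right exp_add exp_diff exp_minus cosh_field_def field_simps)
  finally show ?case .
qed

section \<open>A Fejer majorant for the indicator of a small square\<close>

lemma cosh_le_exp_square: "cosh x \<le> exp (x\<^sup>2)" for x :: real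
  using exp_le_add_exp_square[of x] exp_le_add_exp_square[of "- x"]
  by (simp add: cosh_field_def)

lemma cos_ge_half: "\<bar>x\<bar> \<le> 1 \<Longrightarrow> 1 / 2 \<le> cos x" for x :: real
proof -
  assume "\<bar>x\<bar> \<le> 1"
  then have "x\<^sup>2 \<le> 1" by (simp add: abs_square_le_1)
  have "1 - cos x = 2 * (sin (x/2))\<^sup>2"
    using cos_double_sin[of "x/2"] by simp
  also have "(sin (x/2))\<^sup>2 \<le> (x/2)\<^sup>2"
    using abs_sin_x_le_abs_x[of "x/2"] by (simp only: abs_le_square_iff)
  finally show ?thesis using \<open>x\<^sup>2 \<le> 1\<close> by (simp add: power_divide)
qed

text \<open>The difference (s, t) occurs (n - \<bar>s\<bar>) (n - \<bar>t\<bar>) times, which are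
  the weights of the two-dimensional Fejer kernel. Summing over pairs of lattice points instead of
  weighted frequencies makes the positivity of the kernel visible.\<close>

definition fejer_sum :: "nat \<Rightarrow> (real \<Rightarrow> real \<Rightarrow> real) \<Rightarrow> real" where
  "fejer_sum n f = (\<Sum>(j, k)\<in>({..<n} \<times> {..<n}) \<times> ({..<n} \<times> {..<n}).
      f (real (fst j) - real (fst k)) (real (snd j) - real (snd k)))"

lemma sum_cos_diff_ge:
  fixes a :: "'i \<Rightarrow> real"
  shows "(\<Sum>j\<in>J. cos (a j - c))\<^sup>2 \<le> (\<Sum>(j, k)\<in>J \<times> J. cos (a j - a k))"
proof -
  have "(\<Sum>(j, k)\<in>J \<times> J. cos (a j - a k))
      = (\<Sum>j\<in>J. \<Sum>k\<in>J. cos ((a j - c) - (a k - c)))"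
    by (simp add: sum.cartesian_product)
  also have "\<dots> = (\<Sum>j\<in>J. cos (a j - c))\<^sup>2 + (\<Sum>j\<in>J. sin (a j - c))\<^sup>2"
    unfolding cos_diff[of "_ - c" "_ - c"] sum.distrib power2_eq_square sum_product ..
  finally show ?thesis by simp
qed

text \<open>Writing the double sum as a squared modulus lets the phase be centred at the midpoint of the
  frequency box, so that all angles are at most \<open>1\<close> on the small square.\<close>

lemma indicator_le_fejer_sum:
  assumes "n \<ge> 1"
  shows "of_bool (\<bar>x\<bar> \<le> 1 / real n \<and> \<bar>y\<bar> \<le> 1 / real n)
    \<le> 4 / real n ^ 4 * fejer_sum n (\<lambda>s t. cos (s * x + t * y))"
proof -
  define J where "J = {..<n} \<times> {..<n}"
  define a where "a = (\<lambda>j. real (fst j) * x + real (snd j) * y)"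
  have F: "fejer_sum n (\<lambda>s t. cos (s * x + t * y)) = (\<Sum>(j, k)\<in>J \<times> J. cos (a j - a k))"
    unfolding fejer_sum_def J_def a_def by (intro sum.cong refl) (auto simp: algebra_simps)
  define c where "c = real n / 2 * x + real n / 2 * y"
  have sq: "(\<Sum>j\<in>J. cos (a j - c))\<^sup>2 \<le> fejer_sum n (\<lambda>s t. cos (s * x + t * y))"
    unfolding F by (rule sum_cos_diff_ge)
  show ?thesis
  proof (cases "\<bar>x\<bar> \<le> 1 / real n \<and> \<bar>y\<bar> \<le> 1 / real n")
    case False
    moreover have "0 \<le> fejer_sum n (\<lambda>s t. cos (s * x + t * y))"
      using sq by (rule order.trans[OF zero_le_power2])
    ultimately show ?thesis by auto
  next
    case True
    have "1 / 2 \<le> cos (a j - c)" if "j \<in> J" for j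
    proof (rule cos_ge_half)
      have *: "\<bar>(real i - real n / 2) * z\<bar> \<le> 1 / 2" if "i < n" "\<bar>z\<bar> \<le> 1 / real n" for i z
      proof -
        have "\<bar>real i - real n / 2\<bar> \<le> real n / 2" using \<open>i < n\<close> by (simp add: abs_le_iff field_simps)
        then have "\<bar>real i - real n / 2\<bar> * \<bar>z\<bar> \<le> (real n / 2) * (1 / real n)"
          using that by (intro mult_mono) auto
        then show ?thesis using assms by (simp add: abs_mult)
      qed
      have "a j - c = (real (fst j) - real n / 2) * x + (real (snd j) - real n / 2) * y"
        by (simp add: a_def c_def algebra_simps)
      then show "\<bar>a j - c\<bar> \<le> 1"
        using *[of "fst j" x] *[of "snd j" y] that True by (auto simp: J_def)
    qed
    \<comment> \<open>There are n^2 cosines of size at least 1 / 2, so the square is at least n^4 /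
      4; this is the origin of the factor 4 / n^4.\<close>
    then have "(\<Sum>j\<in>J. 1 / 2) \<le> (\<Sum>j\<in>J. cos (a j - c))" by (intro sum_mono)
    then have "real n ^ 2 / 2 \<le> (\<Sum>j\<in>J. cos (a j - c))" by (simp add: J_def power2_eq_square)
    then have "(real n ^ 2 / 2)\<^sup>2 \<le> (\<Sum>j\<in>J. cos (a j - c))\<^sup>2" by (intro power_mono) auto
    then have "(real n ^ 2 / 2)\<^sup>2 \<le> fejer_sum n (\<lambda>s t. cos (s * x + t * y))" using sq by linarith
    then have "real n ^ 4 \<le> 4 * fejer_sum n (\<lambda>s t. cos (s * x + t * y))"
      by (simp add: power_divide)
    then show ?thesis using True assms by (simp add: field_simps)
  qed
qed

definition cos_prod_mean :: "nat \<Rightarrow> (real \<times> real) list \<Rightarrow> real" where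
  "cos_prod_mean n xs = 4 / real n ^ 4 * fejer_sum n (\<lambda>s t. \<Prod>x\<leftarrow>xs. \<bar>cos ((s, t) \<bullet> x)\<bar>)"

definition square_indicator :: "nat \<Rightarrow> real \<times> real \<Rightarrow> real" where
  "square_indicator n y = of_bool (\<bar>fst y\<bar> \<le> 1 / real n \<and> \<bar>snd y\<bar> \<le> 1 / real n)"

lemma fejer_sum_mono: "(\<And>s t. f s t \<le> g s t) \<Longrightarrow> fejer_sum n f \<le> fejer_sum n g"
  unfolding fejer_sum_def by (intro sum_mono) auto

text \<open>All dependence on centre and shift sits in a phase whose cosine is at most 1 in absolute
  value. The resulting uniformity allows the bound to be used conditionally on everything except the
  signs.\<close>

lemma rademacher_mean_square_indicator_le:
  assumes "n \<ge> 1"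
  shows "rademacher_mean xs (\<lambda>y. square_indicator n (y + z)) m \<le> cos_prod_mean n xs"
proof -
  have "rademacher_mean xs (\<lambda>y. square_indicator n (y + z)) m
    \<le> rademacher_mean xs (\<lambda>y. 4 / real n ^ 4 * fejer_sum n (\<lambda>s t. cos ((s, t) \<bullet> y + (s, t) \<bullet> z))) m"
  proof (intro rademacher_mean_mono)
    fix y
    show "square_indicator n (y + z)
      \<le> 4 / real n ^ 4 * fejer_sum n (\<lambda>s t. cos ((s, t) \<bullet> y + (s, t) \<bullet> z))"
      using indicator_le_fejer_sum[OF assms, of "fst (y + z)" "snd (y + z)"]
      by (simp add: square_indicator_def inner_prod_def algebra_simps)
  qed
  also have "\<dots> = 4 / real n ^ 4 *
     fejer_sum n (\<lambda>s t. cos ((s, t) \<bullet> m + (s, t) \<bullet> z) * (\<Prod>x\<leftarrow>xs. cos ((s, t) \<bullet> x)))"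
    unfolding rademacher_mean_cmult fejer_sum_def case_prod_unfold rademacher_mean_sum
      rademacher_mean_cos ..
  also have "\<dots> \<le> cos_prod_mean n xs"
    unfolding cos_prod_mean_def
  proof (intro mult_left_mono fejer_sum_mono)
    fix s t
    have "\<bar>\<Prod>x\<leftarrow>xs. cos ((s, t) \<bullet> x)\<bar> = (\<Prod>x\<leftarrow>xs. \<bar>cos ((s, t) \<bullet> x)\<bar>)"
      by (induction xs) (auto simp: abs_mult)
    moreover have "\<bar>cos ((s, t) \<bullet> m + (s, t) \<bullet> z) * (\<Prod>x\<leftarrow>xs. cos ((s, t) \<bullet> x))\<bar>
        \<le> 1 * \<bar>\<Prod>x\<leftarrow>xs. cos ((s, t) \<bullet> x)\<bar>"
      unfolding abs_mult by (intro mult_right_mono) auto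
    ultimately show "cos ((s, t) \<bullet> m + (s, t) \<bullet> z) * (\<Prod>x\<leftarrow>xs. cos ((s, t) \<bullet> x))
        \<le> (\<Prod>x\<leftarrow>xs. \<bar>cos ((s, t) \<bullet> x)\<bar>)" by linarith
  qed auto
  finally show ?thesis .
qed

section \<open>Randomisation by swaps\<close>

definition weighted_sum :: "nat \<Rightarrow> (nat \<Rightarrow> real) \<Rightarrow> (nat \<Rightarrow> 'a::real_vector) \<Rightarrow> (nat \<Rightarrow> nat) \<Rightarrow> 'a" where
  "weighted_sum n w u \<pi> = (\<Sum>i\<in>{1..n}. w i *\<^sub>R u (\<pi> i))"

text \<open>Half of the change caused by the swap: the sums before and after it are a common
  midpoint plus and minus this vector.\<close>

definition swap_step :: "(nat \<Rightarrow> real) \<Rightarrow> (nat \<Rightarrow> 'a::real_vector) \<Rightarrow> (nat \<Rightarrow> nat) \<Rightarrow> nat \<times> nat \<Rightarrow> 'a" where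
  "swap_step w u \<pi> p = ((w (fst p) - w (snd p)) / 2) *\<^sub>R (u (\<pi> (fst p)) - u (\<pi> (snd p)))"

lemma weighted_sum_transpose:
  assumes "i \<in> {1..n}" "j \<in> {1..n}" "i \<noteq> j"
  shows "weighted_sum n w u (\<pi> \<circ> Transposition.transpose i j)
    = weighted_sum n w u \<pi> - 2 *\<^sub>R swap_step w u \<pi> (i, j)"
proof -
  define R where "R = {1..n} - {i, j}"
  have X: "{1..n} = insert i (insert j R)" "i \<notin> insert j R" "j \<notin> R" "finite R"
    using assms by (auto simp: R_def)
  have s: "(\<Sum>k\<in>{1..n}. h k) = h i + (h j + (\<Sum>k\<in>R. h k))" for h :: "nat \<Rightarrow> 'a"
    unfolding X(1) using X by simp
  have "(\<Sum>k\<in>R. w k *\<^sub>R u ((\<pi> \<circ> Transposition.transpose i j) k)) = (\<Sum>k\<in>R. w k *\<^sub>R u (\<pi> k))"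
    using X by (intro sum.cong refl) (auto simp: Transposition.transpose_def)
  moreover have "2 *\<^sub>R swap_step w u \<pi> (i, j) = (w i - w j) *\<^sub>R (u (\<pi> i) - u (\<pi> j))"
    by (simp add: swap_step_def)
  ultimately show ?thesis
    unfolding weighted_sum_def s by (simp add: algebra_simps)
qed

text \<open>Composition with a transposition permutes the permutations, so a sum over them may be
  averaged over performing the swap or not; disjointness keeps the steps of the other pairs
  unchanged. The parameter \<open>c\<close> admits data invariant under the swaps, later the list of
  steps of the second family of pairs.\<close>

lemma sum_permutes_eq_rademacher_mean:
  fixes u :: "nat \<Rightarrow> 'a::real_vector" and c :: "(nat \<Rightarrow> nat) \<Rightarrow> 'c"
  assumes "distinct (map fst ps @ map snd ps)" "set (map fst ps @ map snd ps) \<subseteq> {1..n}"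
    and "\<And>i j \<pi>. (i, j) \<in> set ps \<Longrightarrow> c (\<pi> \<circ> Transposition.transpose i j) = c \<pi>"
  shows "(\<Sum>\<pi> | \<pi> permutes {1..n}. H (c \<pi>) (weighted_sum n w u \<pi>))
    = (\<Sum>\<pi> | \<pi> permutes {1..n}. rademacher_mean (map (swap_step w u \<pi>) ps) (H (c \<pi>))
        (weighted_sum n w u \<pi> - (\<Sum>p\<leftarrow>ps. swap_step w u \<pi> p)))"
  using assms
proof (induction ps)
  case Nil
  then show ?case by simp
next
  case (Cons p ps)
  obtain i j where p: "p = (i, j)" by fastforce
  have ij: "i \<in> {1..n}" "j \<in> {1..n}" "i \<noteq> j" using Cons.prems p by auto
  let ?t = "Transposition.transpose i j"
  define \<Phi> where "\<Phi> = (\<lambda>\<pi>. rademacher_mean (map (swap_step w u \<pi>) ps) (H (c \<pi>))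
        (weighted_sum n w u \<pi> - (\<Sum>p\<leftarrow>ps. swap_step w u \<pi> p)))"
  have "(\<Sum>\<pi> | \<pi> permutes {1..n}. H (c \<pi>) (weighted_sum n w u \<pi>)) = (\<Sum>\<pi> | \<pi> permutes {1..n}. \<Phi> \<pi>)"
    unfolding \<Phi>_def using Cons.prems by (intro Cons.IH) auto
  also have "\<dots> = (\<Sum>\<pi> | \<pi> permutes {1..n}. (\<Phi> \<pi> + \<Phi> (\<pi> \<circ> ?t)) / 2)"
  proof -
    have "(\<Sum>\<pi> | \<pi> permutes {1..n}. \<Phi> (\<pi> \<circ> ?t)) = (\<Sum>\<pi> | \<pi> permutes {1..n}. \<Phi> \<pi>)"
      by (rule sum_permutations_compose_right[symmetric]) (rule permutes_swap_id[OF ij(1,2)])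
    then show ?thesis by (simp add: sum.distrib flip: sum_divide_distrib)
  qed
  also have "\<dots> = (\<Sum>\<pi> | \<pi> permutes {1..n}. rademacher_mean (map (swap_step w u \<pi>) (p # ps)) (H (c \<pi>))
        (weighted_sum n w u \<pi> - (\<Sum>p\<leftarrow>p # ps. swap_step w u \<pi> p)))"
  proof (intro sum.cong refl)
    fix \<pi>
    have inv: "map (swap_step w u (\<pi> \<circ> ?t)) ps = map (swap_step w u \<pi>) ps"
    proof (rule map_cong[OF refl])
      fix q assume "q \<in> set ps"
      then have "fst q \<notin> {i, j}" "snd q \<notin> {i, j}"
        using Cons.prems(1) p by (auto simp: rev_image_eqI)
      then show "swap_step w u (\<pi> \<circ> ?t) q = swap_step w u \<pi> q"
        by (auto simp: swap_step_def Transposition.transpose_def)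
    qed
    have ct: "c (\<pi> \<circ> ?t) = c \<pi>" by (rule Cons.prems(3)) (simp add: p)
    \<comment> \<open>With the step of \<open>p\<close> also removed from the centre,
      \<open>m\<close> is the common midpoint for \<pi> and its swapped version, whose terms then
      sit at plus and minus one step from it.\<close>
    define m where "m = weighted_sum n w u \<pi> - (\<Sum>p\<leftarrow>p # ps. swap_step w u \<pi> p)"
    have "\<Phi> \<pi> = rademacher_mean (map (swap_step w u \<pi>) ps) (H (c \<pi>)) (m + swap_step w u \<pi> p)"
      unfolding \<Phi>_def m_def by simp
    moreover have "\<Phi> (\<pi> \<circ> ?t)
        = rademacher_mean (map (swap_step w u \<pi>) ps) (H (c \<pi>)) (m - swap_step w u \<pi> p)"
      unfolding \<Phi>_def m_def weighted_sum_transpose[OF ij] inv ct p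
      by (simp add: algebra_simps scaleR_2)
    ultimately show "(\<Phi> \<pi> + \<Phi> (\<pi> \<circ> ?t)) / 2
        = rademacher_mean (map (swap_step w u \<pi>) (p # ps)) (H (c \<pi>)) m" by simp
  qed
  finally show ?case .
qed

section \<open>Phase variance of polynomial sequences\<close>

text \<open>Divide by the linear factor at the last node: the quotient is at most 2 e / r at the
  other nodes, and multiplying back at most doubles its coefficients before the remainder
  \<open>e\<close> is added. Each degree therefore costs 4 / r + 1 \<le> 5 / r.\<close>

lemma abs_coeff_le_of_separated:
  fixes p :: "real poly"
  assumes "degree p \<le> k" "0 < r" "r \<le> 1"
    and "\<And>i. i \<le> k \<Longrightarrow> \<bar>y i\<bar> \<le> 1 \<and> \<bar>poly p (y i)\<bar> \<le> e"
    and "\<And>i j. i < j \<Longrightarrow> j \<le> k \<Longrightarrow> r \<le> \<bar>y j - y i\<bar>"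
  shows "\<bar>coeff p m\<bar> \<le> (5 / r) ^ k * e"
  using assms
proof (induction k arbitrary: p e m)
  case 0
  then obtain a where "p = [:a:]" by (metis degree_eq_zeroE le_zero_eq)
  then show ?case using 0(4)[of 0] by (cases m) auto
next
  case (Suc k)
  define c where "c = y (Suc k)"
  define q where "q = synthetic_div p c"
  have p: "p = [:- c, 1:] * q + [:poly p c:]" unfolding q_def by (rule synthetic_div_correct'[symmetric])
  have e0: "e \<ge> 0" using Suc.prems(4)[of 0] by linarith
  have c: "\<bar>c\<bar> \<le> 1" "\<bar>poly p c\<bar> \<le> e" using Suc.prems(4)[of "Suc k"] by (auto simp: c_def)
  have q: "\<bar>coeff q m\<bar> \<le> (5 / r) ^ k * (2 * e / r)" for m
  proof (rule Suc.IH)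
    show "degree q \<le> k" using Suc.prems(1) by (simp add: q_def degree_synthetic_div)
    fix i assume i: "i \<le> k"
    have sep: "r \<le> \<bar>y i - c\<bar>" using Suc.prems(5)[of i "Suc k"] i by (simp add: c_def)
    have "poly p (y i) = (y i - c) * poly q (y i) + poly p c"
      using arg_cong[OF p, of "\<lambda>p. poly p (y i)"] by (simp add: algebra_simps)
    then have "\<bar>y i - c\<bar> * \<bar>poly q (y i)\<bar> = \<bar>poly p (y i) - poly p c\<bar>"
      by (simp add: abs_mult[symmetric])
    also have "\<dots> \<le> 2 * e" using Suc.prems(4)[of i] i c by linarith
    finally have "\<bar>y i - c\<bar> * \<bar>poly q (y i)\<bar> \<le> 2 * e" .
    then have "r * \<bar>poly q (y i)\<bar> \<le> 2 * e"
      using mult_right_mono[OF sep, of "\<bar>poly q (y i)\<bar>"] by linarith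
    then show "\<bar>y i\<bar> \<le> 1 \<and> \<bar>poly q (y i)\<bar> \<le> 2 * e / r"
      using Suc.prems(4)[of i] i Suc.prems(2) by (simp add: field_simps)
  qed (use Suc.prems in auto)
  define D where "D = (5 / r) ^ k"
  have D: "D \<ge> 1" unfolding D_def using Suc.prems by (intro one_le_power) auto
  have cp: "coeff p m = (if m = 0 then 0 else coeff q (m - 1)) - c * coeff q m + (if m = 0 then poly p c else 0)"
    using arg_cong[OF p, of "\<lambda>p. coeff p m"] by (simp add: coeff_pCons split: nat.split)
  have "\<bar>c * coeff q m\<bar> \<le> 1 * (D * (2 * e / r))"
    unfolding abs_mult D_def using c q by (intro mult_mono) auto
  then have b: "\<bar>coeff p m\<bar> \<le> D * (2 * e / r) + D * (2 * e / r) + e"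
  proof -
    have "\<bar>if m = 0 then 0 else coeff q (m - 1)\<bar> \<le> D * (2 * e / r)"
      using q[of "m - 1"] D e0 Suc.prems(2) unfolding D_def by (cases "m = 0") (auto intro!: mult_nonneg_nonneg)
    moreover have "\<bar>if m = 0 then poly p c else 0\<bar> \<le> e" using c e0 by auto
    ultimately show ?thesis using cp \<open>\<bar>c * coeff q m\<bar> \<le> 1 * (D * (2 * e / r))\<close> by linarith
  qed
  have "e \<le> D * e / r"
  proof -
    have "e * r \<le> e * D" using D Suc.prems e0 by (intro mult_left_mono) auto
    then show ?thesis using Suc.prems by (simp add: field_simps)
  qed
  moreover have "D * (2 * e / r) + D * (2 * e / r) + D * e / r = (5 / r) ^ Suc k * e"
    by (simp add: D_def field_simps)
  ultimately show ?case using b by linarith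
qed

text \<open>Greedy choice from the top: selecting the maximum and discarding whatever is closer than
  \<open>r\<close> to it removes at most \<open>r\<close> elements.\<close>

lemma obtain_separated:
  fixes T :: "nat set"
  assumes "finite T" "k * r < card T"
  obtains y where "\<And>i. i \<le> k \<Longrightarrow> y i \<in> T" "\<And>i j. i < j \<Longrightarrow> j \<le> k \<Longrightarrow> y i + r \<le> y j"
proof -
  have "\<exists>y. (\<forall>i\<le>k. y i \<in> T) \<and> (\<forall>j\<le>k. \<forall>i<j. y i + r \<le> y j)"
    using assms
  proof (induction k arbitrary: T)
    case 0
    then obtain t where "t \<in> T" by (metis card.empty ex_in_conv mult_0 not_less_zero)
    then show ?case by (intro exI[of _ "\<lambda>_. t"]) auto
  next
    case (Suc k)
    define M where "M = Max T"
    have "T \<noteq> {}" using Suc.prems by auto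
    then have M: "M \<in> T" "\<And>t. t \<in> T \<Longrightarrow> t \<le> M" using Suc.prems by (auto simp: M_def)
    define T' where "T' = {t \<in> T. t + r \<le> M}"
    have "T \<subseteq> T' \<union> {M + 1 - r..M}" using M by (auto simp: T'_def)
    then have "card T \<le> card (T' \<union> {M + 1 - r..M})"
      using Suc.prems by (intro card_mono) (auto simp: T'_def)
    also have "\<dots> \<le> card T' + card {M + 1 - r..M}" by (rule card_Un_le)
    also have "card {M + 1 - r..M} \<le> r" by simp
    finally have "k * r < card T'" using Suc.prems by simp
    then obtain y where y: "\<And>i. i \<le> k \<Longrightarrow> y i \<in> T'" "\<And>i j. j \<le> k \<Longrightarrow> i < j \<Longrightarrow> y i + r \<le> y j"
    proof -
      have "finite T'" using Suc.prems(1) by (simp add: T'_def)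
      then show ?thesis using Suc.IH[of T'] \<open>k * r < card T'\<close> that by blast
    qed
    show ?case
      using y M by (intro exI[of _ "y(Suc k := M)"]) (auto simp: T'_def le_Suc_eq)
  qed
  then show ?thesis using that by blast
qed

text \<open>Integers cannot cluster: at most 2 r of them are closer than r to a given point. With r
  about a quarter of the cardinality N, half of the set is far away, and N * (N / 2) * (N / 8)^2
  gives the stated constant.\<close>

lemma sum_square_dist_ge:
  fixes J :: "nat set"
  assumes "finite J" "8 \<le> card J"
  shows "real (card J) ^ 4 / 128 \<le> (\<Sum>a\<in>J. \<Sum>b\<in>J. (real a - real b)\<^sup>2)"
proof -
  define N where "N = card J"
  define r where "r = N div 4"
  have N: "real N / 8 \<le> real r" "4 * r \<le> N" "1 \<le> r" using assms(2) unfolding N_def r_def by linarith+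
  have "real N / 2 * (real N / 8)\<^sup>2 \<le> (\<Sum>b\<in>J. (real a - real b)\<^sup>2)" if "a \<in> J" for a
  proof -
    define J' where "J' = {b \<in> J. real r \<le> \<bar>real a - real b\<bar>}"
    have "J \<subseteq> J' \<union> {a + 1 - r..<a + r}" unfolding J'_def by auto
    then have "card J \<le> card (J' \<union> {a + 1 - r..<a + r})"
      using assms by (intro card_mono) (auto simp: J'_def)
    also have "\<dots> \<le> card J' + card {a + 1 - r..<a + r}" by (rule card_Un_le)
    also have "card {a + 1 - r..<a + r} \<le> 2 * r" by simp
    finally have J': "real N / 2 \<le> real (card J')" using N(2) by (simp add: N_def)
    have "real N / 2 * (real N / 8)\<^sup>2 \<le> real (card J') * (real r)\<^sup>2"
      using J' N by (intro mult_mono power_mono) auto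
    also have "\<dots> = (\<Sum>b\<in>J'. (real r)\<^sup>2)" by simp
    also have "\<dots> \<le> (\<Sum>b\<in>J'. (real a - real b)\<^sup>2)"
    proof (intro sum_mono)
      fix b assume "b \<in> J'"
      then have "(real r)\<^sup>2 \<le> \<bar>real a - real b\<bar>\<^sup>2" by (intro power_mono) (auto simp: J'_def)
      then show "(real r)\<^sup>2 \<le> (real a - real b)\<^sup>2" by simp
    qed
    also have "\<dots> \<le> (\<Sum>b\<in>J. (real a - real b)\<^sup>2)"
      using assms by (intro sum_mono2) (auto simp: J'_def)
    finally show ?thesis .
  qed
  then have "(\<Sum>a\<in>J. real N / 2 * (real N / 8)\<^sup>2) \<le> (\<Sum>a\<in>J. \<Sum>b\<in>J. (real a - real b)\<^sup>2)"
    by (intro sum_mono)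
  then show ?thesis by (simp add: N_def power4_eq_xxxx power2_eq_square mult.assoc)
qed

text \<open>The double sum is a variance of the unit vectors \<open>cis (2 * f a)\<close>. This form
  makes the triangle inequality available for sums of squared sines.\<close>

lemma sum_sin_square_eq:
  fixes f :: "'a \<Rightarrow> real"
  shows "(\<Sum>a\<in>J. \<Sum>b\<in>J. (sin (f a - f b))\<^sup>2)
    = ((real (card J))\<^sup>2 - (cmod (\<Sum>a\<in>J. cis (2 * f a)))\<^sup>2) / 2"
proof -
  have "(cmod (\<Sum>a\<in>J. cis (2 * f a)))\<^sup>2 = (\<Sum>a\<in>J. cos (2 * f a))\<^sup>2 + (\<Sum>a\<in>J. sin (2 * f a))\<^sup>2"
    by (simp add: cmod_power2 Re_sum Im_sum)
  also have "\<dots> = (\<Sum>a\<in>J. \<Sum>b\<in>J. cos (2 * f a - 2 * f b))"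
    unfolding cos_diff sum.distrib power2_eq_square sum_product ..
  also have "\<dots> = (\<Sum>a\<in>J. \<Sum>b\<in>J. 1 - 2 * (sin (f a - f b))\<^sup>2)"
    by (intro sum.cong refl) (metis cos_double_sin right_diff_distrib)
  also have "\<dots> = (real (card J))\<^sup>2 - 2 * (\<Sum>a\<in>J. \<Sum>b\<in>J. (sin (f a - f b))\<^sup>2)"
    by (simp add: sum_subtractf power2_eq_square flip: sum_distrib_left)
  finally show ?thesis by simp
qed

text \<open>A discrete law of total variance. It allows one to look only at pairs so close that the
  argument of the sine does not wrap around.\<close>

lemma sum_sin_square_ge_blocks:
  fixes f :: "'a \<Rightarrow> real" and h :: real
  assumes "finite J" "finite T" "\<And>a. a \<in> J \<Longrightarrow> q a \<in> T" "h > 0"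
    and "\<And>Q. Q \<in> T \<Longrightarrow> real (card {a \<in> J. q a = Q}) \<le> h"
  shows "real (card J) / (2 * h) *
      (\<Sum>Q\<in>T. \<Sum>a\<in>{a \<in> J. q a = Q}. \<Sum>b\<in>{a \<in> J. q a = Q}. (sin (f a - f b))\<^sup>2)
    \<le> (\<Sum>a\<in>J. \<Sum>b\<in>J. (sin (f a - f b))\<^sup>2)"
proof -
  define Z where "Z = (\<lambda>S. cmod (\<Sum>a\<in>S. cis (2 * f a)))"
  define B where "B = (\<lambda>Q. {a \<in> J. q a = Q})"
  have Z_le: "Z S \<le> real (card S)" for S
    unfolding Z_def using norm_sum[of "\<lambda>a. cis (2 * f a)" S] by simp
  have Z_ge: "0 \<le> Z S" for S by (simp add: Z_def)
  define V where "V = (\<lambda>S. \<Sum>a\<in>S. \<Sum>b\<in>S. (sin (f a - f b))\<^sup>2)"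
  have V: "V S = (real (card S) - Z S) * (real (card S) + Z S) / 2" for S
    unfolding V_def sum_sin_square_eq Z_def by (simp add: power2_eq_square algebra_simps)
  have "q ` J \<subseteq> T" using assms(3) by blast
  note group = sum.group[OF assms(1,2) this]
  \<comment> \<open>By the triangle inequality the deficits \<open>card - Z\<close> of the blocks
    add up to at most the deficit of \<open>J\<close>. The variance is the deficit times (card + Z)
    / 2; this second factor is at most \<open>h\<close> on a block and at least half the cardinality
    on \<open>J\<close>, which gives the ratio in the claim.\<close>
  have "Z J \<le> (\<Sum>Q\<in>T. Z (B Q))"
    unfolding Z_def B_def group[symmetric, of "\<lambda>a. cis (2 * f a)"] by (rule norm_sum)
  moreover have "real (card J) = (\<Sum>Q\<in>T. real (card (B Q)))"
    unfolding B_def using group[of "\<lambda>_. 1 :: real"] by simp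
  ultimately have "(\<Sum>Q\<in>T. real (card (B Q)) - Z (B Q)) \<le> real (card J) - Z J"
    by (simp add: sum_subtractf)
  moreover have "(\<Sum>Q\<in>T. V (B Q) / h) \<le> (\<Sum>Q\<in>T. real (card (B Q)) - Z (B Q))"
  proof (intro sum_mono)
    fix Q assume Q: "Q \<in> T"
    have "V (B Q) \<le> (real (card (B Q)) - Z (B Q)) * (2 * h) / 2"
      unfolding V using Z_le[of "B Q"] assms(5)[OF Q]
      by (intro divide_right_mono mult_left_mono) (auto simp: B_def)
    then show "V (B Q) / h \<le> real (card (B Q)) - Z (B Q)"
      using assms(4) by (simp add: field_simps)
  qed
  ultimately have le: "(\<Sum>Q\<in>T. V (B Q) / h) \<le> real (card J) - Z J" by linarith
  have "real (card J) / (2 * h) * (\<Sum>Q\<in>T. V (B Q)) = (\<Sum>Q\<in>T. V (B Q) / h) * real (card J) / 2"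
    using assms(4) by (simp add: mult_ac flip: sum_divide_distrib)
  also have "\<dots> \<le> (real (card J) - Z J) * (real (card J) + Z J) / 2"
    using le Z_ge[of J] Z_le[of J] by (intro divide_right_mono mult_mono) auto
  finally show ?thesis unfolding V[symmetric] by (simp add: V_def B_def)
qed

lemma sin_square_ge: "\<bar>x\<bar> \<le> 1 \<Longrightarrow> x\<^sup>2 / 4 \<le> (sin x)\<^sup>2" for x :: real
proof -
  have *: "y / 2 \<le> sin y" if "0 \<le> y" "y \<le> 1" for y :: real
  proof -
    have "y ^ 3 \<le> y" using power_decreasing[of 1 3 y] that by simp
    moreover have "\<bar>sin y - y\<bar> \<le> y ^ 3 / 6"
      using Maclaurin_sin_bound[of y 3] that by (simp add: numeral_3_eq_3 sin_coeff_def)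
    ultimately show ?thesis using that by linarith
  qed
  assume "\<bar>x\<bar> \<le> 1"
  then have "\<bar>x\<bar> / 2 \<le> sin \<bar>x\<bar>" by (intro *) auto
  then have "(\<bar>x\<bar> / 2)\<^sup>2 \<le> (sin \<bar>x\<bar>)\<^sup>2" by (intro power_mono) auto
  then show ?thesis by (simp add: power_divide abs_if split: if_splits)
qed

section \<open>Polynomials bounded on dense index sets\<close>

lemma abs_poly_le_of_coeffs:
  fixes p :: "real poly"
  assumes "degree p \<le> k" "\<And>m. \<bar>coeff p m\<bar> \<le> C" "0 \<le> y" "y \<le> 1"
  shows "\<bar>poly p y\<bar> \<le> real (k + 1) * C"
proof -
  have C: "C \<ge> 0" using assms(2)[of 0] by linarith
  have "\<bar>poly p y\<bar> \<le> (\<Sum>i\<le>degree p. \<bar>coeff p i * y ^ i\<bar>)"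
    unfolding poly_altdef by (rule sum_abs)
  also have "\<dots> \<le> (\<Sum>i\<le>degree p. C * 1)"
    unfolding abs_mult using assms C by (intro sum_mono mult_mono) (auto simp: power_le_one)
  also have "\<dots> \<le> real (k + 1) * C"
    using assms(1) C by (simp add: mult_right_mono)
  finally show ?thesis .
qed

text \<open>Substituting x = n y and dividing by n^k leaves the leading coefficient unchanged. A
  dense \<open>J\<close> contains k + 1 points whose rescaled distances are at least \<delta> / (4
  k), so bounded values bound all coefficients, independently of \<open>n\<close>.\<close>

lemma bounded_poly_values_rescale:
  assumes P: "bounded_poly_values k a B n J v" and J: "J \<subseteq> {1..n}" "\<delta> * real n \<le> real (card J)"
    and \<delta>: "0 < \<delta>" "\<delta> \<le> 1" and k: "k \<ge> 1" and n: "2 * real k / \<delta> \<le> real n"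
  obtains G where "degree G \<le> k" "coeff G k = a" "\<And>i. i \<in> J \<Longrightarrow> v i = poly G (real i / real n)"
    "\<And>m. \<bar>coeff G m\<bar> \<le> (20 * real k / \<delta>) ^ k * B"
proof -
  obtain P where P: "degree P = k" "lead_coeff P = a" "\<And>i. i \<in> J \<Longrightarrow> v i = poly P (real i) / real n ^ k"
    and v: "\<And>i. i \<in> J \<Longrightarrow> \<bar>v i\<bar> \<le> B"
    using P unfolding bounded_poly_values_def by blast
  have n0: "real n > 0"
  proof -
    have "0 < 2 * real k / \<delta>" using k \<delta> by simp
    then show ?thesis using n by linarith
  qed
  define G where "G = smult (1 / real n ^ k) (pcompose P [:0, real n:])"
  have deg: "degree G \<le> k" unfolding G_def using P(1) n0 by (simp add: degree_pcompose)
  have lead: "coeff G k = a" unfolding G_def using P n0 by (simp add: coeff_pcompose_linear)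
  have val: "v i = poly G (real i / real n)" if "i \<in> J" for i
    using P(3)[OF that] n0 by (simp add: G_def poly_pcompose)
  \<comment> \<open>With this spacing k gaps use up at most half of the guaranteed size of
    \<open>J\<close>; the lower bound on \<open>n\<close> makes the quantity under the floor at
    least 1, so rounding loses at most a factor 2.\<close>
  define r where "r = nat \<lfloor>\<delta> * real n / (2 * real k)\<rfloor>"
  have fJ: "finite J" using J finite_subset by blast
  have r_le: "real r \<le> \<delta> * real n / (2 * real k)" unfolding r_def using \<delta> by simp
  have one: "1 \<le> \<delta> * real n / (2 * real k)" using n \<delta> k by (simp add: field_simps)
  have r_ge: "\<delta> * real n / (4 * real k) \<le> real r"
  proof -
    have "1 \<le> nat \<lfloor>\<delta> * real n / (2 * real k)\<rfloor>" using one by linarith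
    then have "1 \<le> real r" unfolding r_def by linarith
    moreover have "\<delta> * real n / (2 * real k) - 1 \<le> real r" unfolding r_def using one by linarith
    moreover have "\<delta> * real n / (4 * real k) = \<delta> * real n / (2 * real k) / 2" by simp
    ultimately show ?thesis by linarith
  qed
  have "real k * real r \<le> real k * (\<delta> * real n / (2 * real k))" using r_le by (intro mult_left_mono) auto
  also have "\<dots> = \<delta> * real n / 2" using k by simp
  also have "\<dots> < \<delta> * real n" using \<delta> n0 by simp
  finally have "real (k * r) < real (card J)" using J(2) by simp
  then have "k * r < card J" by (simp only: of_nat_less_iff)
  then obtain y where y: "\<And>i. i \<le> k \<Longrightarrow> y i \<in> J" "\<And>i j. i < j \<Longrightarrow> j \<le> k \<Longrightarrow> y i + r \<le> y j"
    using obtain_separated[OF fJ] by blast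
  have coef: "\<bar>coeff G m\<bar> \<le> (5 / (\<delta> / (4 * real k))) ^ k * B" for m
  proof (rule abs_coeff_le_of_separated[OF deg, where y = "\<lambda>i. real (y i) / real n"])
    show "0 < \<delta> / (4 * real k)" using \<delta> k by simp
    show "\<delta> / (4 * real k) \<le> 1" using \<delta> k by (simp add: field_simps)
    fix i assume "i \<le> k"
    then have "y i \<in> J" by (rule y)
    then show "\<bar>real (y i) / real n\<bar> \<le> 1 \<and> \<bar>poly G (real (y i) / real n)\<bar> \<le> B"
      using J(1) v[of "y i"] val[of "y i"] n0 by (auto simp: field_simps)
  next
    fix i j assume "i < j" "j \<le> k"
    then have "real (y i) + real r \<le> real (y j)" using y(2) by (metis of_nat_add of_nat_le_iff)
    then have "real r / real n \<le> (real (y j) - real (y i)) / real n"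
      using n0 by (intro divide_right_mono) auto
    moreover have "\<delta> / (4 * real k) \<le> real r / real n" using r_ge n0 by (simp add: field_simps)
    ultimately show "\<delta> / (4 * real k) \<le> \<bar>real (y j) / real n - real (y i) / real n\<bar>"
      by (simp add: diff_divide_distrib)
  qed
  show ?thesis using that[OF deg lead val] coef by simp
qed

text \<open>Constants do not affect phase differences, so the derivative is the relevant object. Its
  coefficient in degree d - 1 involves only \<open>s\<close>, through \<open>b\<close>; the one in
  degree d - 2 contains \<open>t * c\<close>, perturbed by \<open>s\<close> times a bounded
  coefficient. If \<open>s\<close> is too small for the first to help, this perturbation is
  negligible in the second.\<close>

lemma pderiv_combination_coeff_ge:
  fixes b c C :: real
  assumes "d \<ge> 2" "b \<noteq> 0" "c \<noteq> 0" "C > 0"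
  obtains c0 where "c0 > 0"
    "\<And>s t G G'. degree G' \<le> d - 1 \<Longrightarrow> coeff G d = b \<Longrightarrow> coeff G' (d - 1) = c \<Longrightarrow> \<bar>coeff G (d - 1)\<bar> \<le> C \<Longrightarrow>
      \<exists>m. c0 * max \<bar>s\<bar> \<bar>t\<bar> \<le> \<bar>coeff (pderiv (smult s G + smult t G')) m\<bar>"
proof -
  \<comment> \<open>Below the ratio \<open>e0\<close> of \<bar>s\<bar> to \<bar>t\<bar>, the
    perturbation is at most half of \<bar>t * c\<bar>.\<close>
  define e0 where "e0 = \<bar>c\<bar> / (2 * C)"
  define c0 where "c0 = min \<bar>b\<bar> (min (e0 * \<bar>b\<bar>) (\<bar>c\<bar> / 2))"
  have e0: "e0 > 0" using assms by (simp add: e0_def)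
  have c0: "c0 > 0" "c0 \<le> \<bar>b\<bar>" "c0 \<le> e0 * \<bar>b\<bar>" "c0 \<le> \<bar>c\<bar> / 2"
    using assms e0 by (auto simp: c0_def)
  show ?thesis
  proof (rule that[OF c0(1)])
    fix s t :: real and G G' :: "real poly"
    assume G': "degree G' \<le> d - 1" "coeff G d = b" "coeff G' (d - 1) = c" "\<bar>coeff G (d - 1)\<bar> \<le> C"
    define D where "D = pderiv (smult s G + smult t G')"
    define \<beta> where "\<beta> = coeff G (d - 1)"
    have D1: "\<bar>s\<bar> * \<bar>b\<bar> \<le> \<bar>coeff D (d - 1)\<bar>"
    proof -
      have "coeff G' d = 0" using G'(1) assms(1) by (intro coeff_eq_0) auto
      then have "\<bar>coeff D (d - 1)\<bar> = real d * (\<bar>s\<bar> * \<bar>b\<bar>)"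
        using assms(1) G' by (simp add: D_def coeff_pderiv abs_mult)
      moreover have "1 * (\<bar>s\<bar> * \<bar>b\<bar>) \<le> real d * (\<bar>s\<bar> * \<bar>b\<bar>)" using assms(1) by (intro mult_right_mono) auto
      ultimately show ?thesis by simp
    qed
    have D2: "\<bar>s * \<beta> + t * c\<bar> \<le> \<bar>coeff D (d - 2)\<bar>"
    proof -
      have "Suc (d - 2) = d - 1" using assms(1) by simp
      then have "\<bar>coeff D (d - 2)\<bar> = real (d - 1) * \<bar>s * \<beta> + t * c\<bar>"
        using G' by (simp add: D_def coeff_pderiv abs_mult \<beta>_def)
      moreover have "1 * \<bar>s * \<beta> + t * c\<bar> \<le> real (d - 1) * \<bar>s * \<beta> + t * c\<bar>"
        using assms(1) by (intro mult_right_mono) auto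
      ultimately show ?thesis by simp
    qed
    consider "\<bar>t\<bar> \<le> \<bar>s\<bar>" | "\<bar>s\<bar> < \<bar>t\<bar>" "e0 * \<bar>t\<bar> \<le> \<bar>s\<bar>" | "\<bar>s\<bar> < \<bar>t\<bar>" "\<bar>s\<bar> < e0 * \<bar>t\<bar>" by linarith
    then show "\<exists>m. c0 * max \<bar>s\<bar> \<bar>t\<bar> \<le> \<bar>coeff (pderiv (smult s G + smult t G')) m\<bar>"
      unfolding D_def[symmetric]
    proof cases
      case 1
      have "c0 * \<bar>s\<bar> \<le> \<bar>b\<bar> * \<bar>s\<bar>" using c0 by (intro mult_right_mono) auto
      then show "\<exists>m. c0 * max \<bar>s\<bar> \<bar>t\<bar> \<le> \<bar>coeff D m\<bar>"
        using 1 D1 by (intro exI[of _ "d - 1"]) (simp add: max_def mult.commute)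
    next
      case 2
      have "c0 * \<bar>t\<bar> \<le> e0 * \<bar>b\<bar> * \<bar>t\<bar>" using c0 by (intro mult_right_mono) auto
      also have "\<dots> = (e0 * \<bar>t\<bar>) * \<bar>b\<bar>" by simp
      also have "\<dots> \<le> \<bar>s\<bar> * \<bar>b\<bar>" using 2 by (intro mult_right_mono) auto
      finally show "\<exists>m. c0 * max \<bar>s\<bar> \<bar>t\<bar> \<le> \<bar>coeff D m\<bar>"
        using 2 D1 by (intro exI[of _ "d - 1"]) (simp add: max_def)
    next
      case 3
      have "\<bar>s * \<beta>\<bar> \<le> (e0 * \<bar>t\<bar>) * C"
        unfolding abs_mult using 3 G'(4) by (intro mult_mono) (auto simp: \<beta>_def)
      also have "\<dots> = \<bar>c\<bar> / 2 * \<bar>t\<bar>" using assms(4) by (simp add: e0_def)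
      finally have "\<bar>s * \<beta>\<bar> \<le> \<bar>c\<bar> / 2 * \<bar>t\<bar>" .
      then have "\<bar>c\<bar> / 2 * \<bar>t\<bar> \<le> \<bar>s * \<beta> + t * c\<bar>"
      proof -
        have "\<bar>t * c\<bar> = \<bar>c\<bar> / 2 * \<bar>t\<bar> + \<bar>c\<bar> / 2 * \<bar>t\<bar>" by (simp add: abs_mult)
        then show ?thesis using \<open>\<bar>s * \<beta>\<bar> \<le> \<bar>c\<bar> / 2 * \<bar>t\<bar>\<close> by linarith
      qed
      moreover have "c0 * \<bar>t\<bar> \<le> \<bar>c\<bar> / 2 * \<bar>t\<bar>" using c0 by (intro mult_right_mono) auto
      ultimately show "\<exists>m. c0 * max \<bar>s\<bar> \<bar>t\<bar> \<le> \<bar>coeff D m\<bar>"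
        using 3 D2 by (intro exI[of _ "d - 2"]) (simp add: max_def)
    qed
  qed
qed

text \<open>Too many bad blocks would include k + 1 of them with far apart indices, hence k + 1
  separated points where \<open>p\<close> is small, contradicting its large coefficient. Points of
  two blocks can be closer than the indices suggest by one block length; the assumption on r n / h
  limits this loss to half, whence 10 / r instead of 5 / r.\<close>

lemma card_blocks_small_le:
  fixes p :: "real poly"
  assumes "degree p \<le> k" "e \<ge> 0" "(10 / r) ^ k * e < \<bar>coeff p m\<bar>" "0 < r" "r \<le> 1" "h \<ge> 1"
    and "2 / r \<le> real n / real h" and "finite Bad"
    and "\<And>Q. Q \<in> Bad \<Longrightarrow> \<exists>x. real (Q * h) \<le> x \<and> x \<le> real (Suc Q * h) \<and> 0 \<le> x \<and> x \<le> real n \<and>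
       \<bar>poly p (x / real n)\<bar> \<le> e"
  shows "card Bad \<le> k * (nat \<lfloor>r * real n / real h\<rfloor> + 1)"
proof (rule ccontr)
  assume "\<not> ?thesis"
  then obtain y where y: "\<And>i. i \<le> k \<Longrightarrow> y i \<in> Bad"
    "\<And>i j. i < j \<Longrightarrow> j \<le> k \<Longrightarrow> y i + (nat \<lfloor>r * real n / real h\<rfloor> + 1) \<le> y j"
    using obtain_separated[OF assms(8), of k "nat \<lfloor>r * real n / real h\<rfloor> + 1"] by (auto simp: not_le)
  define x where "x = (\<lambda>Q. SOME x. real (Q * h) \<le> x \<and> x \<le> real (Suc Q * h) \<and> 0 \<le> x \<and> x \<le> real n \<and>
       \<bar>poly p (x / real n)\<bar> \<le> e)"
  have x: "real (Q * h) \<le> x Q \<and> x Q \<le> real (Suc Q * h) \<and> 0 \<le> x Q \<and> x Q \<le> real n \<and>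
       \<bar>poly p (x Q / real n)\<bar> \<le> e" if "Q \<in> Bad" for Q
    unfolding x_def by (rule someI_ex) (rule assms(9)[OF that])
  have h: "real h \<ge> 1" using assms(6) by simp
  have n0: "real n > 0"
  proof -
    have "0 < 2 / r" using assms by simp
    then have "0 < real n / real h" using assms(7) by linarith
    then show ?thesis using h by (simp add: zero_less_divide_iff)
  qed
  have "\<bar>coeff p m\<bar> \<le> (5 / (r / 2)) ^ k * e"
  proof (rule abs_coeff_le_of_separated[OF assms(1), where y = "\<lambda>i. x (y i) / real n"])
    fix i assume "i \<le> k"
    then show "\<bar>x (y i) / real n\<bar> \<le> 1 \<and> \<bar>poly p (x (y i) / real n)\<bar> \<le> e"
      using x[OF y(1)] n0 by (auto simp: field_simps)
  next
    fix i j assume ij: "i < j" "j \<le> k"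
    have "r * real n / real h \<le> real (nat \<lfloor>r * real n / real h\<rfloor> + 1)" by linarith
    also have "\<dots> \<le> real (y j) - real (y i)" using y(2)[OF ij] by linarith
    finally have "r * real n \<le> (real (y j) - real (y i)) * real h" using h by (simp add: field_simps)
    moreover have "x (y i) \<le> real (y i) * real h + real h" "real (y j) * real h \<le> x (y j)"
      using x[OF y(1), of i] x[OF y(1), of j] ij by (auto simp: algebra_simps)
    ultimately have "r * real n - real h \<le> x (y j) - x (y i)" by (simp add: algebra_simps)
    moreover have "real h \<le> r * real n / 2" using assms(4,7) h by (simp add: field_simps)
    ultimately have "r * real n / 2 \<le> x (y j) - x (y i)" by linarith
    then show "r / 2 \<le> \<bar>x (y j) / real n - x (y i) / real n\<bar>"
      using n0 by (simp add: field_simps abs_if)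
  qed (use assms in auto)
  then show False using assms(3) by simp
qed

text \<open>By the mean value theorem, phase differences inside the block are at least e / n times
  the distance and at most 1. The upper bound prevents wrapping, so each sine is at least half its
  argument in absolute value.\<close>

lemma block_sin_square_ge:
  fixes G :: "real poly" and S :: "nat set"
  assumes "finite S" "8 \<le> card S" "S \<subseteq> {1..n}" "S \<subseteq> {l..l + h}" "0 \<le> e"
    and "\<And>y. 0 \<le> y \<Longrightarrow> y \<le> 1 \<Longrightarrow> \<bar>poly (pderiv G) y\<bar> \<le> M" "M * real h / real n \<le> 1"
    and "\<And>x. real l \<le> x \<Longrightarrow> x \<le> real (l + h) \<Longrightarrow> 0 \<le> x \<Longrightarrow> x \<le> real n \<Longrightarrow> e \<le> \<bar>poly (pderiv G) (x / real n)\<bar>"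
  shows "(e / (2 * real n))\<^sup>2 * real (card S) ^ 4 / 128
    \<le> (\<Sum>a\<in>S. \<Sum>b\<in>S. (sin (poly G (real a / real n) - poly G (real b / real n)))\<^sup>2)"
proof -
  have n0: "real n > 0" using assms(2,3) by (cases n) auto
  have M0: "0 \<le> M" using assms(6)[of 0] by simp
  have ordered: "(e / (2 * real n))\<^sup>2 * (real a - real b)\<^sup>2
      \<le> (sin (poly G (real a / real n) - poly G (real b / real n)))\<^sup>2"
    if ab: "a \<in> S" "b \<in> S" "b < a" for a b
  proof -
    have "real b / real n < real a / real n" using ab n0 by (simp add: divide_strict_right_mono)
    from poly_MVT[OF this, of G] obtain z where z: "real b / real n < z" "z < real a / real n"
      and eq: "poly G (real a / real n) - poly G (real b / real n)
          = (real a / real n - real b / real n) * poly (pderiv G) z" by blast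
    have bounds: "1 \<le> b" "a \<le> n" "l \<le> b" "a \<le> l + h" using ab assms(3,4) by auto
    define x where "x = z * real n"
    have zx: "z = x / real n" using n0 by (simp add: x_def)
    have xb: "real b < x" "x < real a" using z n0 by (auto simp: x_def field_simps)
    have lower: "e \<le> \<bar>poly (pderiv G) z\<bar>" unfolding zx by (rule assms(8)) (use xb bounds in auto)
    have upper: "\<bar>poly (pderiv G) z\<bar> \<le> M"
    proof (rule assms(6))
      show "0 \<le> z" unfolding zx using xb n0 by simp
      show "z \<le> 1" unfolding zx using xb n0 bounds by simp
    qed
    let ?u = "poly G (real a / real n) - poly G (real b / real n)"
    have u: "\<bar>?u\<bar> = (real a - real b) / real n * \<bar>poly (pderiv G) z\<bar>"
      unfolding eq abs_mult using ab n0 by (simp add: diff_divide_distrib[symmetric])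
    have "\<bar>?u\<bar> \<le> real h / real n * M"
      unfolding u using bounds upper M0 n0 ab by (intro mult_mono divide_right_mono) auto
    then have "\<bar>?u\<bar> \<le> 1" using assms(7) by (simp add: mult.commute)
    then have "?u\<^sup>2 / 4 \<le> (sin ?u)\<^sup>2" by (rule sin_square_ge)
    moreover have "(e / real n * (real a - real b))\<^sup>2 \<le> \<bar>?u\<bar>\<^sup>2"
    proof (intro power_mono)
      have "(real a - real b) / real n * e \<le> \<bar>?u\<bar>"
        unfolding u using lower n0 ab by (intro mult_left_mono) auto
      then show "e / real n * (real a - real b) \<le> \<bar>?u\<bar>" by (simp add: mult.commute)
    qed (use assms(5) ab n0 in auto)
    ultimately show ?thesis by (simp add: power_mult_distrib power_divide)
  qed
  have pw: "(e / (2 * real n))\<^sup>2 * (real a - real b)\<^sup>2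
      \<le> (sin (poly G (real a / real n) - poly G (real b / real n)))\<^sup>2"
    if ab: "a \<in> S" "b \<in> S" for a b
  proof (cases a b rule: linorder_cases)
    case less
    have "(sin (poly G (real a / real n) - poly G (real b / real n)))\<^sup>2
      = (sin (poly G (real b / real n) - poly G (real a / real n)))\<^sup>2"
      by (metis minus_diff_eq power2_minus sin_minus)
    then show ?thesis using ordered[OF ab(2,1) less]
      by (simp add: power2_commute)
  qed (use ordered[OF ab] in auto)
  have "(e / (2 * real n))\<^sup>2 * real (card S) ^ 4 / 128
      = (e / (2 * real n))\<^sup>2 * (real (card S) ^ 4 / 128)" by simp
  also have "\<dots> \<le> (e / (2 * real n))\<^sup>2 * (\<Sum>a\<in>S. \<Sum>b\<in>S. (real a - real b)\<^sup>2)"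
    by (intro mult_left_mono sum_square_dist_ge assms) auto
  also have "\<dots> \<le> (\<Sum>a\<in>S. \<Sum>b\<in>S. (sin (poly G (real a / real n) - poly G (real b / real n)))\<^sup>2)"
    unfolding sum_distrib_left by (intro sum_mono pw)
  finally show ?thesis .
qed

text \<open>With R = max \<bar>s\<bar> \<bar>t\<bar> the phase has rescaled slope of order at most
  R, so blocks of length h about n / max 1 R avoid wrapping. A positive proportion of the blocks is
  both well filled and has slope of order at least R, and these alone produce a variance of order (R
  h)^2.\<close>

lemma sum_sin_square_poly_values_ge:
  fixes \<delta> b c B :: real
  assumes d: "d \<ge> 2" and \<delta>: "0 < \<delta>" "\<delta> \<le> 1" and bc: "b \<noteq> 0" "c \<noteq> 0" and B: "B > 0"
  obtains c1 \<tau> N where "0 < c1" "c1 \<le> 1" "0 < \<tau>"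
    "\<And>n J v v' s t. N \<le> real n \<Longrightarrow> J \<subseteq> {1..n} \<Longrightarrow> \<delta> * real n \<le> real (card J) \<Longrightarrow>
       bounded_poly_values d b B n J v \<Longrightarrow> bounded_poly_values (d - 1) c B n J v' \<Longrightarrow>
       \<bar>s\<bar> \<le> \<tau> * real n \<Longrightarrow> \<bar>t\<bar> \<le> \<tau> * real n \<Longrightarrow>
       c1 * (real n)\<^sup>2 * min 1 (s\<^sup>2 + t\<^sup>2)
         \<le> (\<Sum>a\<in>J. \<Sum>b\<in>J. (sin ((s * v a + t * v' a) - (s * v b + t * v' b)))\<^sup>2)"
proof -
  define C1 where "C1 = (20 * real d / \<delta>) ^ d * B"
  have base: "20 * real d / \<delta> \<ge> 1" using d \<delta> by (simp add: field_simps)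
  have C1: "C1 > 0" using d \<delta> B by (simp add: C1_def)
  obtain c0 where c0: "c0 > 0"
    "\<And>s t G G'. degree G' \<le> d - 1 \<Longrightarrow> coeff G d = b \<Longrightarrow> coeff G' (d - 1) = c \<Longrightarrow> \<bar>coeff G (d - 1)\<bar> \<le> C1 \<Longrightarrow>
      \<exists>m. c0 * max \<bar>s\<bar> \<bar>t\<bar> \<le> \<bar>coeff (pderiv (smult s G + smult t G')) m\<bar>"
    using pderiv_combination_coeff_ge[OF d bc C1] by metis
  define C2 where "C2 = 2 * (real d)\<^sup>2 * C1"
  have C2: "C2 > 0" using d C1 by (simp add: C2_def)
  \<comment> \<open>Small enough for the blocks with small derivative to number at most half of the
    guaranteed well filled ones.\<close>
  define r where "r = \<delta> / (8 * real d)"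
  have r: "0 < r" "r \<le> 1" using d \<delta> by (auto simp: r_def field_simps)
  define e0 where "e0 = c0 / (2 * (10 / r) ^ (d - 1))"
  have e0: "e0 > 0" "(10 / r) ^ (d - 1) * e0 = c0 / 2" using c0(1) r by (auto simp: e0_def)
  define M where "M = 2 / r"
  have M: "M > 0" using r by (simp add: M_def)
  \<comment> \<open>Blocks get length at least H / 2, so a block filled to proportion \<delta> / 4
    has at least 8 elements. The choice of \<open>\<tau>\<close> ensures this length for the largest
    admissible frequencies.\<close>
  define H where "H = 64 / \<delta>"
  have H: "H \<ge> 2" "H > 0" using \<delta> by (auto simp: H_def field_simps)
  define \<tau> where "\<tau> = 1 / (C2 * H)"
  have \<tau>: "\<tau> > 0" using C2 H by (simp add: \<tau>_def)
  \<comment> \<open>The first entry ensures the block length for small frequencies, the second is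
    needed for rescaling the polynomials.\<close>
  define N where "N = max (M * H) (2 * real d / \<delta>)"
  define \<kappa> where "\<kappa> = \<delta> ^ 6 * e0\<^sup>2 / (8 * 4 * 256 * 128)"
  have \<kappa>: "\<kappa> > 0" using \<delta> e0 by (simp add: \<kappa>_def)
  define c3 where "c3 = min (1 / (2 * M)) (1 / (2 * C2))"
  have c3: "c3 > 0" using M C2 by (simp add: c3_def)
  define c1 where "c1 = min 1 (\<kappa> * c3\<^sup>2 / 2)"
  have c1: "0 < c1" "c1 \<le> 1" "c1 \<le> \<kappa> * c3\<^sup>2 / 2" using \<kappa> c3 by (auto simp: c1_def)
  show ?thesis
  proof (rule that[OF c1(1,2) \<tau>, of N])
    fix n J v v' and s t :: real
    assume n: "N \<le> real n" and J: "J \<subseteq> {1..n}" "\<delta> * real n \<le> real (card J)"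
      and v: "bounded_poly_values d b B n J v" and v': "bounded_poly_values (d - 1) c B n J v'"
      and st: "\<bar>s\<bar> \<le> \<tau> * real n" "\<bar>t\<bar> \<le> \<tau> * real n"
    define R where "R = max \<bar>s\<bar> \<bar>t\<bar>"
    have fJ: "finite J" using J finite_subset by blast
    have nN: "M * H \<le> real n" "2 * real d / \<delta> \<le> real n" using n by (auto simp: N_def)
    have n0: "real n > 0" using nN(1) M H mult_pos_pos[of M H] by linarith
    have nd1: "2 * real (d - 1) / \<delta> \<le> real n"
    proof -
      have "2 * real (d - 1) / \<delta> \<le> 2 * real d / \<delta>" using \<delta> by (intro divide_right_mono) auto
      then show ?thesis using nN(2) by linarith
    qed
    obtain G1 where G1: "degree G1 \<le> d" "coeff G1 d = b" "\<And>i. i \<in> J \<Longrightarrow> v i = poly G1 (real i / real n)"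
      "\<And>m. \<bar>coeff G1 m\<bar> \<le> C1"
      by (rule bounded_poly_values_rescale[OF v J \<delta> _ nN(2), folded C1_def]) (use d in simp, rule that)
    obtain G2 where G2: "degree G2 \<le> d - 1" "coeff G2 (d - 1) = c"
      "\<And>i. i \<in> J \<Longrightarrow> v' i = poly G2 (real i / real n)"
      "\<And>m. \<bar>coeff G2 m\<bar> \<le> (20 * real (d - 1) / \<delta>) ^ (d - 1) * B"
      by (rule bounded_poly_values_rescale[OF v' J \<delta> _ nd1]) (use d in simp, rule that)
    have G2C: "\<bar>coeff G2 m\<bar> \<le> C1" for m
    proof -
      have "(20 * real (d - 1) / \<delta>) ^ (d - 1) \<le> (20 * real d / \<delta>) ^ (d - 1)"
        using \<delta> by (intro power_mono divide_right_mono) auto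
      also have "\<dots> \<le> (20 * real d / \<delta>) ^ d" using base by (intro power_increasing) auto
      finally have "(20 * real (d - 1) / \<delta>) ^ (d - 1) * B \<le> C1"
        unfolding C1_def using B by (intro mult_right_mono) auto
      then show ?thesis using G2(4)[of m] by linarith
    qed
    define G where "G = smult s G1 + smult t G2"
    have fG: "s * v a + t * v' a = poly G (real a / real n)" if "a \<in> J" for a
      using G1(3)[OF that] G2(3)[OF that] by (simp add: G_def)
    have degG: "degree G \<le> d"
      unfolding G_def using G1(1) G2(1)
      by (intro degree_add_le order.trans[OF degree_smult_le]) auto
    then have degG': "degree (pderiv G) \<le> d - 1" by (simp add: degree_pderiv)
    have R: "\<bar>s\<bar> \<le> R" "\<bar>t\<bar> \<le> R" "0 \<le> R" "R \<le> \<tau> * real n" using st by (auto simp: R_def)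
    have coefG: "\<bar>coeff G m\<bar> \<le> 2 * C1 * R" for m
    proof -
      have "\<bar>s\<bar> * \<bar>coeff G1 m\<bar> \<le> R * C1" "\<bar>t\<bar> * \<bar>coeff G2 m\<bar> \<le> R * C1"
        using R G1(4) G2C C1 by (auto intro!: mult_mono)
      then have "\<bar>s * coeff G1 m\<bar> \<le> R * C1" "\<bar>t * coeff G2 m\<bar> \<le> R * C1" by (auto simp: abs_mult)
      moreover have "R * C1 + R * C1 = 2 * C1 * R" by simp
      ultimately show ?thesis
        unfolding G_def coeff_add coeff_smult by linarith
    qed
    have coefG': "\<bar>coeff (pderiv G) m\<bar> \<le> real d * (2 * C1 * R)" for m
    proof (cases "Suc m \<le> d")
      case True
      then have "real (Suc m) * \<bar>coeff G (Suc m)\<bar> \<le> real d * (2 * C1 * R)"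
        using coefG[of "Suc m"] by (intro mult_mono) auto
      then show ?thesis by (simp add: coeff_pderiv abs_mult)
    next
      case False
      then have "coeff G (Suc m) = 0" using degG by (intro coeff_eq_0) auto
      then show ?thesis using C1 R by (simp add: coeff_pderiv)
    qed
    have der: "\<bar>poly (pderiv G) y\<bar> \<le> C2 * R" if "0 \<le> y" "y \<le> 1" for y
      using abs_poly_le_of_coeffs[OF degG' coefG' that] d by (simp add: C2_def power2_eq_square mult_ac)
    show "c1 * (real n)\<^sup>2 * min 1 (s\<^sup>2 + t\<^sup>2)
         \<le> (\<Sum>a\<in>J. \<Sum>b\<in>J. (sin ((s * v a + t * v' a) - (s * v b + t * v' b)))\<^sup>2)"
    proof (cases "R = 0")
      case True
      then have "s = 0" "t = 0" using R by auto
      then show ?thesis by simp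
    next
      case False
      then have R0: "R > 0" using R by simp
      \<comment> \<open>The bound \<open>C2 * R\<close> on the derivative limits the phase change
        per block of length n / Z to 1; \<open>M\<close> guarantees at least 2 / r blocks even for
        tiny R.\<close>
      define Z where "Z = max M (C2 * R)"
      have Z: "Z > 0" "M \<le> Z" "C2 * R \<le> Z" using M by (auto simp: Z_def)
      have "C2 * R * H \<le> real n"
        using R(4) C2 H by (simp add: \<tau>_def field_simps)
      then have "Z * H \<le> real n" using nN(1) by (simp add: Z_def max_def)
      then have nZ: "H \<le> real n / Z" using Z by (simp add: field_simps)
      define y where "y = real n / Z"
      have y: "H \<le> y" using nZ by (simp add: y_def)
      define h where "h = nat \<lfloor>y\<rfloor>"
      have hle: "real h \<le> real n / Z" unfolding h_def y_def using Z n0 by simp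
      have "y - 1 \<le> real h" unfolding h_def using y H by linarith
      then have hge: "y / 2 \<le> real h" using y H by linarith
      then have hH: "H / 2 \<le> real h" using y by linarith
      then have h1: "real h \<ge> 1" using H by linarith
      then have h1': "h \<ge> 1" by simp
      have Zh: "Z * real h \<le> real n" using hle Z by (simp add: field_simps)
      have nh: "M \<le> real n / real h"
      proof -
        have "M * real h \<le> Z * real h" using Z by (intro mult_right_mono) auto
        then have "M * real h \<le> real n" using Zh by linarith
        then show ?thesis using h1 by (simp add: field_simps)
      qed
      have CRh: "C2 * R * real h / real n \<le> 1"
      proof -
        have "C2 * R * real h \<le> Z * real h" using Z by (intro mult_right_mono) auto
        then show ?thesis using Zh n0 by (simp add: field_simps)
      qed
      have \<delta>h: "8 \<le> \<delta> * real h / 4" using hH \<delta> by (simp add: H_def field_simps)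
      define T where "T = {0..n div h}"
      define Bl where "Bl = (\<lambda>Q. {a \<in> J. a div h = Q})"
      have Bl_sub: "Bl Q \<subseteq> {Q * h..<Q * h + h}" for Q
      proof
        fix a assume "a \<in> Bl Q"
        then have "a div h = Q" by (simp add: Bl_def)
        moreover have "a mod h < h" using h1' by simp
        ultimately have "a = Q * h + a mod h" "a mod h < h" using div_mult_mod_eq[of a h] by auto
        then show "a \<in> {Q * h..<Q * h + h}" by (metis add_less_cancel_left atLeastLessThan_iff le_add1)
      qed
      have Bl_card: "real (card (Bl Q)) \<le> real h" for Q
        using card_mono[OF _ Bl_sub[of Q]] by simp
      have qT: "a div h \<in> T" if "a \<in> J" for a
        using that J(1) div_le_mono[of a n h] by (auto simp: T_def)
      have cT: "real (card T) \<le> 2 * real n / real h"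
      proof -
        have "real (n div h) \<le> real n / real h" 
        proof -
          have "real (n div h * h) \<le> real n" by (simp only: of_nat_le_iff div_times_less_eq_dividend)
          then show ?thesis using h1 by (simp add: field_simps)
        qed
        moreover have "1 \<le> real n / real h"
        proof -
          have "1 \<le> M" using r by (simp add: M_def field_simps)
          then show ?thesis using nh by linarith
        qed
        ultimately show ?thesis by (simp add: T_def)
      qed
      \<comment> \<open>Sparser blocks together hold at most half of the guaranteed \<delta> n
        elements of \<open>J\<close>, since there are at most 2 n / h blocks. The rest lies in
        \<open>T1\<close>, at most \<open>h\<close> to a block.\<close>
      define T1 where "T1 = {Q \<in> T. \<delta> * real h / 4 \<le> real (card (Bl Q))}"
      have cT1: "\<delta> * real n / (2 * real h) \<le> real (card T1)"
      proof -
        have "\<delta> * real n \<le> (\<Sum>Q\<in>T. real (card (Bl Q)))"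
        proof -
          have "(\<lambda>a. a div h) ` J \<subseteq> T" using qT by blast
          from sum.group[OF fJ _ this, of "\<lambda>_. 1 :: real"]
          show ?thesis using J(2) by (simp add: T_def Bl_def)
        qed
        also have "\<dots> \<le> (\<Sum>Q\<in>T. \<delta> * real h / 4 + (if Q \<in> T1 then real h else 0))"
        proof (intro sum_mono)
          fix Q assume "Q \<in> T"
          moreover have "0 \<le> \<delta> * real h / 4" using \<delta> by simp
          ultimately show "real (card (Bl Q)) \<le> \<delta> * real h / 4 + (if Q \<in> T1 then real h else 0)"
            using Bl_card[of Q] by (simp add: T1_def)
        qed
        also have "\<dots> = real (card T) * (\<delta> * real h / 4) + real (card T1) * real h"
          by (simp add: sum.distrib sum.If_cases T_def T1_def Int_def)
        also have "\<dots> \<le> (2 * real n / real h) * (\<delta> * real h / 4) + real (card T1) * real h"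
          using cT \<delta> by (intro add_mono mult_right_mono) auto
        finally have "\<delta> * real n / 2 \<le> real (card T1) * real h" using h1 by simp
        then show ?thesis using h1 by (simp add: field_simps)
      qed
      define Bad where "Bad = {Q \<in> T1. \<exists>x. real (Q * h) \<le> x \<and> x \<le> real (Suc Q * h) \<and> 0 \<le> x \<and>
          x \<le> real n \<and> \<bar>poly (pderiv G) (x / real n)\<bar> \<le> e0 * R}"
      obtain m where m: "c0 * R \<le> \<bar>coeff (pderiv G) m\<bar>"
        using c0(2)[OF G2(1) G1(2) G2(2) G1(4)] unfolding G_def R_def by blast
      have "card Bad \<le> (d - 1) * (nat \<lfloor>r * real n / real h\<rfloor> + 1)"
      proof (rule card_blocks_small_le[OF degG' _ _ r h1'])
        show "0 \<le> e0 * R" using e0 R by simp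
        have "(10 / r) ^ (d - 1) * (e0 * R) = c0 / 2 * R" using e0(2) by (simp flip: mult.assoc)
        also have "\<dots> < c0 * R" using c0(1) R0 by simp
        finally show "(10 / r) ^ (d - 1) * (e0 * R) < \<bar>coeff (pderiv G) m\<bar>" using m by linarith
        show "2 / r \<le> real n / real h" using nh by (simp add: M_def)
        show "finite Bad" by (simp add: Bad_def T1_def T_def)
      qed (simp add: Bad_def)
      then have "real (card Bad) \<le> real ((d - 1) * (nat \<lfloor>r * real n / real h\<rfloor> + 1))"
        by (simp only: of_nat_le_iff)
      also have "\<dots> \<le> real d * (2 * (r * real n / real h))"
      proof -
        have "1 \<le> r * real n / real h" using nh r h1 by (simp add: M_def field_simps)
        then have "real (nat \<lfloor>r * real n / real h\<rfloor> + 1) \<le> 2 * (r * real n / real h)" by linarith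
        then show ?thesis unfolding of_nat_mult by (intro mult_mono) auto
      qed
      also have "\<dots> = \<delta> * real n / (4 * real h)" using d by (simp add: r_def)
      finally have cBad: "real (card Bad) \<le> \<delta> * real n / (4 * real h)" .
      define Good where "Good = T1 - Bad"
      have cGood: "\<delta> * real n / (4 * real h) \<le> real (card Good)"
      proof -
        have "Bad \<subseteq> T1" "finite T1" by (auto simp: Bad_def T1_def T_def)
        then have "card Good = card T1 - card Bad" "card Bad \<le> card T1"
          unfolding Good_def by (auto intro: card_Diff_subset card_mono finite_subset)
        moreover have "\<delta> * real n / (2 * real h) = 2 * (\<delta> * real n / (4 * real h))" by simp
        ultimately show ?thesis using cT1 cBad by (simp only: of_nat_diff)
      qed
      let ?V = "\<lambda>Q. \<Sum>a\<in>Bl Q. \<Sum>b\<in>Bl Q. (sin ((s * v a + t * v' a) - (s * v b + t * v' b)))\<^sup>2"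
      define V0 where "V0 = (e0 * R / (2 * real n))\<^sup>2 * (\<delta> * real h / 4) ^ 4 / 128"
      have V: "V0 \<le> ?V Q" if Q: "Q \<in> Good" for Q
      proof -
        have cB: "\<delta> * real h / 4 \<le> real (card (Bl Q))" using Q by (simp add: Good_def T1_def)
        have "V0 \<le> (e0 * R / (2 * real n))\<^sup>2 * real (card (Bl Q)) ^ 4 / 128"
          unfolding V0_def using cB \<delta> h1
          by (intro divide_right_mono mult_left_mono power_mono) auto
        also have "\<dots> \<le> (\<Sum>a\<in>Bl Q. \<Sum>b\<in>Bl Q. (sin (poly G (real a / real n) - poly G (real b / real n)))\<^sup>2)"
        proof (rule block_sin_square_ge[where l = "Q * h" and h = h, OF _ _ _ _ _ der CRh])
          show "finite (Bl Q)" using fJ by (simp add: Bl_def)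
          have "8 \<le> real (card (Bl Q))" using cB \<delta>h by linarith
          then show "8 \<le> card (Bl Q)" by linarith
          show "Bl Q \<subseteq> {1..n}" using J by (auto simp: Bl_def)
          show "Bl Q \<subseteq> {Q * h..Q * h + h}" using Bl_sub[of Q] by auto
          show "0 \<le> e0 * R" using e0 R by simp
          fix x assume "real (Q * h) \<le> x" "x \<le> real (Q * h + h)" "0 \<le> x" "x \<le> real n"
          moreover have "Q \<in> T1" "Q \<notin> Bad" using Q by (auto simp: Good_def)
          moreover have "Suc Q * h = Q * h + h" by simp
          ultimately show "e0 * R \<le> \<bar>poly (pderiv G) (x / real n)\<bar>"
            unfolding Bad_def by (smt (verit, best) mem_Collect_eq)
        qed
        also have "\<dots> = ?V Q"
          by (intro sum.cong refl) (auto simp: fG Bl_def)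
        finally show ?thesis .
      qed
      have "real (card Good) * V0 = (\<Sum>Q\<in>Good. V0)" by simp
      also have "\<dots> \<le> (\<Sum>Q\<in>Good. ?V Q)" by (intro sum_mono V)
      also have "\<dots> \<le> (\<Sum>Q\<in>T. ?V Q)"
        by (intro sum_mono2) (auto simp: Good_def T1_def T_def intro!: sum_nonneg)
      finally have sumV: "real (card Good) * V0 \<le> (\<Sum>Q\<in>T. ?V Q)" .
      have V0: "V0 \<ge> 0" by (simp add: V0_def)
      \<comment> \<open>Here \<open>V0\<close> is of order R^2 h^4 / n^2. The number of good blocks
        and the factor from the block decomposition are each of order n / h.\<close>
      have "\<kappa> * (R * real h)\<^sup>2 = \<delta> * real n / (2 * real h) * (\<delta> * real n / (4 * real h) * V0)"
        using n0 h1 by (simp add: \<kappa>_def V0_def field_simps power2_eq_square power4_eq_xxxx eval_nat_numeral)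
      also have "\<dots> \<le> real (card J) / (2 * real h) * (real (card Good) * V0)"
        using J(2) cGood V0 h1 \<delta> n0
        by (intro mult_mono divide_right_mono mult_nonneg_nonneg) auto
      also have "\<dots> \<le> real (card J) / (2 * real h) * (\<Sum>Q\<in>T. ?V Q)"
        by (intro mult_left_mono sumV) auto
      also have "\<dots> \<le> (\<Sum>a\<in>J. \<Sum>b\<in>J. (sin ((s * v a + t * v' a) - (s * v b + t * v' b)))\<^sup>2)"
        unfolding Bl_def
        by (rule sum_sin_square_ge_blocks[OF fJ]) (use qT h1 Bl_card in \<open>auto simp: T_def Bl_def\<close>)
      finally have main: "\<kappa> * (R * real h)\<^sup>2
          \<le> (\<Sum>a\<in>J. \<Sum>b\<in>J. (sin ((s * v a + t * v' a) - (s * v b + t * v' b)))\<^sup>2)" .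
      \<comment> \<open>As h is at least n / (2 Z), the product R h grows like n R until
        \<open>C2 * R\<close> passes \<open>M\<close> and is of order n from there on.\<close>
      have "real n * (c3 * min 1 R) \<le> R * real h"
      proof -
        have "c3 * min 1 R \<le> R / (2 * Z)"
        proof (cases "M \<le> C2 * R")
          case True
          then have "R / (2 * Z) = 1 / (2 * C2)" using R0 by (simp add: Z_def)
          moreover have "c3 * min 1 R \<le> 1 / (2 * C2) * 1"
            using c3 C2 R by (intro mult_mono) (auto simp: c3_def)
          ultimately show ?thesis by simp
        next
          case False
          then have "Z = M" by (simp add: Z_def)
          moreover have "c3 * min 1 R \<le> 1 / (2 * M) * R"
            using c3 M R by (intro mult_mono) (auto simp: c3_def)
          ultimately show ?thesis by simp
        qed
        then have "real n * (c3 * min 1 R) \<le> real n * (R / (2 * Z))" by (intro mult_left_mono) auto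
        also have "\<dots> = R * (y / 2)" by (simp add: y_def mult_ac)
        also have "\<dots> \<le> R * real h" using hge R by (intro mult_left_mono) auto
        finally show ?thesis .
      qed
      then have "(real n * (c3 * min 1 R))\<^sup>2 \<le> (R * real h)\<^sup>2"
        using c3 R by (intro power_mono) auto
      then have "\<kappa> * (real n * (c3 * min 1 R))\<^sup>2 \<le> \<kappa> * (R * real h)\<^sup>2"
        using \<kappa> by (intro mult_left_mono) auto
      moreover have "c1 * (real n)\<^sup>2 * min 1 (s\<^sup>2 + t\<^sup>2) \<le> \<kappa> * (real n * (c3 * min 1 R))\<^sup>2"
      proof -
        have "s\<^sup>2 \<le> R\<^sup>2" "t\<^sup>2 \<le> R\<^sup>2" using R by (auto simp: abs_le_square_iff[symmetric])
        moreover have "(min 1 R)\<^sup>2 = min 1 (R\<^sup>2)"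
          using R by (auto simp: min_def power_le_one abs_square_le_1[symmetric] intro!: antisym)
        ultimately have "min 1 (s\<^sup>2 + t\<^sup>2) \<le> 2 * (min 1 R)\<^sup>2" by (simp add: min_def)
        then have "c1 * (real n)\<^sup>2 * min 1 (s\<^sup>2 + t\<^sup>2) \<le> (\<kappa> * c3\<^sup>2 / 2) * (real n)\<^sup>2 * (2 * (min 1 R)\<^sup>2)"
          using c1 by (intro mult_mono) auto
        then show ?thesis by (simp add: power_mult_distrib mult_ac)
      qed
      ultimately show ?thesis using main by linarith
    qed
  qed
qed

section \<open>Disjoint pairs with large weight gaps\<close>

text \<open>Greedy balancing: each new entry joins the side with the smaller sum.\<close>

lemma split_list_balanced:
  fixes f :: "'a \<Rightarrow> real"
  assumes "\<And>x. x \<in> set xs \<Longrightarrow> 0 \<le> f x \<and> f x \<le> M" "0 \<le> M"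
  shows "\<exists>ys zs. mset ys + mset zs = mset xs \<and> \<bar>(\<Sum>y\<leftarrow>ys. f y) - (\<Sum>z\<leftarrow>zs. f z)\<bar> \<le> M"
  using assms
proof (induction xs)
  case Nil
  then show ?case by (intro exI[of _ "[]"]) auto
next
  case (Cons x xs)
  then obtain ys zs where *: "mset ys + mset zs = mset xs" "\<bar>(\<Sum>y\<leftarrow>ys. f y) - (\<Sum>z\<leftarrow>zs. f z)\<bar> \<le> M"
    by auto
  have x: "0 \<le> f x" "f x \<le> M" using Cons.prems by auto
  show ?case
  proof (cases "(\<Sum>y\<leftarrow>ys. f y) \<le> (\<Sum>z\<leftarrow>zs. f z)")
    case True
    then show ?thesis using * x by (intro exI[of _ "x # ys"] exI[of _ zs]) auto
  next
    case False
    then show ?thesis using * x by (intro exI[of _ ys] exI[of _ "x # zs"]) auto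
  qed
qed

text \<open>Deleting a smallest entry never lowers the average.\<close>

lemma sublist_sum_ge_average:
  fixes f :: "'a \<Rightarrow> real"
  assumes "k \<le> length xs" "\<And>x. x \<in> set xs \<Longrightarrow> 0 \<le> f x"
  shows "\<exists>ys. mset ys \<subseteq># mset xs \<and> length ys = k \<and>
    real k * (\<Sum>x\<leftarrow>xs. f x) \<le> real (length xs) * (\<Sum>y\<leftarrow>ys. f y)"
  using assms
proof (induction "length xs - k" arbitrary: xs)
  case 0
  then show ?case by (intro exI[of _ xs]) auto
next
  case (Suc m)
  then have ne: "xs \<noteq> []" by auto
  define x where "x = arg_min_on f (set xs)"
  have x: "x \<in> set xs" "\<And>y. y \<in> set xs \<Longrightarrow> f x \<le> f y"
    unfolding x_def using arg_min_if_finite(1) arg_min_least ne by (metis List.finite_set set_empty2)+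
  define xs' where "xs' = remove1 x xs"
  have len: "length xs' = length xs - 1" "length xs \<ge> 1" using x ne by (auto simp: xs'_def length_remove1 Suc_le_eq)
  have "k \<le> length xs'" "m = length xs' - k" using Suc len by auto
  moreover have "\<And>y. y \<in> set xs' \<Longrightarrow> 0 \<le> f y" using Suc.prems(2) by (auto simp: xs'_def dest: notin_set_remove1)
  ultimately obtain ys where ys: "mset ys \<subseteq># mset xs'" "length ys = k"
    "real k * (\<Sum>x\<leftarrow>xs'. f x) \<le> real (length xs') * (\<Sum>y\<leftarrow>ys. f y)" using Suc.hyps(1)[of xs'] by blast
  have s: "(\<Sum>x\<leftarrow>xs. f x) = f x + (\<Sum>x\<leftarrow>xs'. f x)"
    unfolding xs'_def by (rule sum_list_map_remove1[OF x(1)])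
  have sub: "mset xs' \<subseteq># mset xs" by (simp add: xs'_def)
  have "(\<Sum>y\<leftarrow>ys. f x) \<le> (\<Sum>y\<leftarrow>ys. f y)"
  proof (rule sum_list_mono)
    fix y assume "y \<in> set ys"
    then have "y \<in> set xs" using set_mset_mono[OF ys(1)] set_mset_mono[OF sub] by auto
    then show "f x \<le> f y" by (rule x(2))
  qed
  then have "real k * f x \<le> (\<Sum>y\<leftarrow>ys. f y)" using ys(2) by (simp add: sum_list_triv)
  then have "real k * (\<Sum>x\<leftarrow>xs. f x) \<le> (1 + real (length xs')) * (\<Sum>y\<leftarrow>ys. f y)"
    using ys(3) s by (simp add: algebra_simps)
  moreover have "1 + real (length xs') = real (length xs)" using len by simp
  ultimately show ?case using ys sub by (intro exI[of _ ys]) (auto intro: subset_mset.order_trans)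
qed

definition disjoint_pairs :: "('a \<times> 'a) list \<Rightarrow> bool" where
  "disjoint_pairs ps \<longleftrightarrow> distinct (map fst ps @ map snd ps)"

text \<open>Pairing the largest weight with the smallest one recursively puts \<open>\<mu>\<close>, a median, between the
  two weights of every pair, so the squared gap dominates the sum of the squared distances to \<open>\<mu>\<close>.\<close>

lemma exists_matching:
  fixes w :: "'a \<Rightarrow> real"
  assumes "finite X"
  shows "\<exists>ps \<mu>. disjoint_pairs ps \<and> set (map fst ps @ map snd ps) \<subseteq> X \<and>
    (X \<noteq> {} \<longrightarrow> (\<exists>x\<in>X. w x \<le> \<mu>) \<and> (\<exists>x\<in>X. \<mu> \<le> w x)) \<and>
    (\<Sum>x\<in>X. (w x - \<mu>)\<^sup>2) \<le> (\<Sum>p\<leftarrow>ps. (w (fst p) - w (snd p))\<^sup>2)"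
  using assms
proof (induction X rule: finite_psubset_induct)
  case (psubset X)
  show ?case
  proof (cases "card X \<le> 1")
    case True
    then consider "card X = 0" | "card X = 1" by linarith
    then consider "X = {}" | x where "X = {x}"
      by cases (use psubset.hyps in \<open>auto elim!: card_1_singletonE simp flip: One_nat_def\<close>)
    then show ?thesis
    proof cases
      case 1
      then show ?thesis by (intro exI[of _ "[]"] exI[of _ 0]) (auto simp: disjoint_pairs_def)
    next
      case 2
      then show ?thesis by (intro exI[of _ "[]"] exI[of _ "w x"]) (auto simp: disjoint_pairs_def)
    qed
  next
    case False
    have ne: "X \<noteq> {}" using False by auto
    define i where "i = arg_min_on w X"
    have i: "i \<in> X" unfolding i_def by (rule arg_min_if_finite(1)[OF psubset.hyps ne])
    have i2: "w i \<le> w x" if "x \<in> X" for x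
      unfolding i_def by (rule arg_min_least[OF psubset.hyps ne that])
    have "card (X - {i}) \<noteq> 0" using False i psubset.hyps by (simp add: card_Diff_singleton)
    then have ne': "X - {i} \<noteq> {}" by (metis card.empty)
    define j where "j = arg_min_on (\<lambda>x. - w x) (X - {i})"
    have "finite (X - {i})" using psubset.hyps by simp
    note fin = this ne'
    have j: "j \<in> X - {i}" unfolding j_def by (rule arg_min_if_finite(1)[OF fin])
    have j2: "w x \<le> w j" if "x \<in> X - {i}" for x
      using arg_min_least[OF fin that, of "\<lambda>x. - w x"] unfolding j_def by simp
    have ij: "w i \<le> w j" using i2 j by auto
    define X' where "X' = X - {i} - {j}"
    have X: "X = insert i (insert j X')" "i \<notin> insert j X'" "j \<notin> X'" "finite X'"
      using i j psubset.hyps by (auto simp: X'_def)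
    have sub: "X' \<subset> X" using i by (auto simp: X'_def)
    obtain ps \<mu> where ps: "disjoint_pairs ps" "set (map fst ps @ map snd ps) \<subseteq> X'"
      "X' \<noteq> {} \<longrightarrow> (\<exists>x\<in>X'. w x \<le> \<mu>) \<and> (\<exists>x\<in>X'. \<mu> \<le> w x)"
      "(\<Sum>x\<in>X'. (w x - \<mu>)\<^sup>2) \<le> (\<Sum>p\<leftarrow>ps. (w (fst p) - w (snd p))\<^sup>2)"
      using psubset.IH[OF sub] by (elim exE conjE) (rule that)
    \<comment> \<open>For empty \<open>X'\<close> the induction hypothesis does not locate
      \<open>\<mu>\<close>, and \<open>w i\<close> serves as a default between the two
      extremes.\<close>
    define \<nu> where "\<nu> = (if X' = {} then w i else \<mu>)"
    have \<nu>: "w i \<le> \<nu>" "\<nu> \<le> w j"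
    proof -
      have "w i \<le> \<mu> \<and> \<mu> \<le> w j" if "X' \<noteq> {}"
      proof -
        obtain x y where "x \<in> X'" "w x \<le> \<mu>" "y \<in> X'" "\<mu> \<le> w y" using ps(3) \<open>X' \<noteq> {}\<close> by blast
        moreover have "w i \<le> w x" using i2[of x] \<open>x \<in> X'\<close> by (simp add: X'_def)
        moreover have "w y \<le> w j" using j2[of y] \<open>y \<in> X'\<close> by (simp add: X'_def)
        ultimately show ?thesis by linarith
      qed
      then show "w i \<le> \<nu>" "\<nu> \<le> w j" using ij by (auto simp: \<nu>_def)
    qed
    have "(\<Sum>x\<in>X'. (w x - \<nu>)\<^sup>2) \<le> (\<Sum>p\<leftarrow>ps. (w (fst p) - w (snd p))\<^sup>2)"
      using ps(4) by (cases "X' = {}") (auto simp: \<nu>_def)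
    moreover have "(w i - \<nu>)\<^sup>2 + (w j - \<nu>)\<^sup>2 \<le> (w i - w j)\<^sup>2"
    proof -
      have "0 \<le> 2 * ((\<nu> - w i) * (w j - \<nu>))" using \<nu> by simp
      then show ?thesis by (simp add: power2_eq_square algebra_simps)
    qed
    ultimately have "(\<Sum>x\<in>X. (w x - \<nu>)\<^sup>2) \<le> (\<Sum>p\<leftarrow>(i, j) # ps. (w (fst p) - w (snd p))\<^sup>2)"
      using X by simp
    moreover have "disjoint_pairs ((i, j) # ps)" "set (map fst ((i, j) # ps) @ map snd ((i, j) # ps)) \<subseteq> X"
      using ps(1,2) X by (auto simp: disjoint_pairs_def)
    moreover have "(\<exists>x\<in>X. w x \<le> \<nu>) \<and> (\<exists>x\<in>X. \<nu> \<le> w x)" using \<nu> i j by blast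
    ultimately show ?thesis by blast
  qed
qed

lemma disjoint_pairs_submset:
  assumes "disjoint_pairs ps" "mset qs \<subseteq># mset ps"
  shows "disjoint_pairs qs"
proof -
  have "mset (map fst qs @ map snd qs) \<subseteq># mset (map fst ps @ map snd ps)"
    using assms(2) by (simp add: image_mset_subseteq_mono subset_mset.add_mono)
  then obtain zs where "mset (map fst ps @ map snd ps) = mset ((map fst qs @ map snd qs) @ zs)"
    by (metis ex_mset mset_append subset_mset.le_iff_add)
  from mset_eq_imp_distinct_iff[OF this] show ?thesis
    using assms(1) unfolding disjoint_pairs_def by (metis distinct_append)
qed

lemma disjoint_pairs_length:
  assumes "disjoint_pairs ps" "set (map fst ps @ map snd ps) \<subseteq> X" "finite X"
  shows "2 * length ps \<le> card X"
proof -
  have "card (set (map fst ps @ map snd ps)) = 2 * length ps"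
    using distinct_card[OF assms(1)[unfolded disjoint_pairs_def]] by simp
  then show ?thesis using card_mono[OF assms(3,2)] by simp
qed

text \<open>The full matching carries squared gaps of total at least 1. Keeping the heaviest pairs
  up to about \<delta> n / 4 of them preserves a share \<delta> / 4, and a split balanced up to M
  \<le> \<delta> / 8 leaves each half at least (\<delta> / 4 - \<delta> / 8) / 2.\<close>

lemma exists_two_pair_families:
  fixes w :: "nat \<Rightarrow> real"
  assumes "(\<Sum>i\<in>{1..n}. w i) = 0" "(\<Sum>i\<in>{1..n}. (w i)\<^sup>2) = 1"
    and "\<And>i j. i \<in> {1..n} \<Longrightarrow> j \<in> {1..n} \<Longrightarrow> (w i - w j)\<^sup>2 \<le> M" "0 \<le> M" "M \<le> \<delta> / 8"
    and \<delta>: "0 < \<delta>" "\<delta> \<le> 1" and n: "8 / \<delta> \<le> real n"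
  obtains ps qs where "disjoint_pairs (ps @ qs)"
    "set (map fst (ps @ qs) @ map snd (ps @ qs)) \<subseteq> {1..n}"
    "4 * real (length (ps @ qs)) \<le> \<delta> * real n"
    "\<delta> / 16 \<le> (\<Sum>p\<leftarrow>ps. (w (fst p) - w (snd p))\<^sup>2)"
    "\<delta> / 16 \<le> (\<Sum>p\<leftarrow>qs. (w (fst p) - w (snd p))\<^sup>2)"
proof -
  define f where "f = (\<lambda>p. (w (fst p) - w (snd p))\<^sup>2)"
  obtain rs \<mu> where rs: "disjoint_pairs rs" "set (map fst rs @ map snd rs) \<subseteq> {1..n}"
    "(\<Sum>x\<in>{1..n}. (w x - \<mu>)\<^sup>2) \<le> (\<Sum>p\<leftarrow>rs. f p)"
    using exists_matching[of "{1..n}" w] unfolding f_def by blast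
  \<comment> \<open>As the weights have mean zero, moving the centre from 0 to \<open>\<mu>\<close>
    can only increase the sum of squares.\<close>
  have "(\<Sum>x\<in>{1..n}. (w x - \<mu>)\<^sup>2) = (\<Sum>x\<in>{1..n}. (w x)\<^sup>2) + real n * \<mu>\<^sup>2 - 2 * \<mu> * (\<Sum>x\<in>{1..n}. w x)"
    by (simp add: power2_diff sum.distrib sum_subtractf sum_distrib_left mult_ac)
  moreover have "0 \<le> real n * \<mu>\<^sup>2" by simp
  ultimately have ge1: "1 \<le> (\<Sum>p\<leftarrow>rs. f p)" using rs(3) unfolding assms(1,2) by linarith
  have len: "2 * length rs \<le> n" using disjoint_pairs_length[OF rs(1,2)] by simp
  define k where "k = min (length rs) (nat \<lfloor>\<delta> * real n / 4\<rfloor>)"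
  obtain ss where ss: "mset ss \<subseteq># mset rs" "length ss = k"
    "real k * (\<Sum>p\<leftarrow>rs. f p) \<le> real (length rs) * (\<Sum>p\<leftarrow>ss. f p)"
    using sublist_sum_ge_average[of k rs f] by (auto simp: k_def f_def)
  have n0: "real n > 0" using n \<delta> divide_pos_pos[of 8 \<delta>] by linarith
  have ss_ge: "\<delta> / 4 \<le> (\<Sum>p\<leftarrow>ss. f p)"
  proof (cases "k = length rs")
    case True
    have "length rs \<noteq> 0" using ge1 by (cases rs) auto
    then have "1 \<le> (\<Sum>p\<leftarrow>ss. f p)" using ss(3) ge1 True by simp
    then show ?thesis using \<delta> by simp
  next
    case False
    have "2 \<le> \<delta> * real n / 4" using n \<delta> by (simp add: field_simps)
    then have "\<delta> * real n / 8 \<le> real (nat \<lfloor>\<delta> * real n / 4\<rfloor>)" by linarith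
    then have "\<delta> * real n / 8 * 1 \<le> real k * (\<Sum>p\<leftarrow>rs. f p)"
      using False ge1 \<delta> n0 by (intro mult_mono) (auto simp: k_def min_def split: if_splits)
    also have "\<dots> \<le> real n / 2 * (\<Sum>p\<leftarrow>ss. f p)"
    proof -
      have "real (length rs) \<le> real n / 2" using len by linarith
      moreover have "0 \<le> (\<Sum>p\<leftarrow>ss. f p)" by (intro sum_list_nonneg) (auto simp: f_def)
      ultimately show ?thesis using ss(3) mult_right_mono by fastforce
    qed
    finally show ?thesis using n0 by (simp add: field_simps)
  qed
  have dss: "disjoint_pairs ss" by (rule disjoint_pairs_submset[OF rs(1) ss(1)])
  have set_ss: "set ss \<subseteq> set rs" using set_mset_mono[OF ss(1)] by simp
  have fM: "0 \<le> f p \<and> f p \<le> M" if "p \<in> set ss" for p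
  proof -
    have "fst p \<in> {1..n}" "snd p \<in> {1..n}" using that set_ss rs(2) by (auto simp: image_subset_iff)
    then show ?thesis unfolding f_def by (simp only: assms(3) zero_le_power2)
  qed
  from split_list_balanced[of ss f M, OF fM assms(4)] obtain ps qs where
    pq: "mset ps + mset qs = mset ss" "\<bar>(\<Sum>y\<leftarrow>ps. f y) - (\<Sum>z\<leftarrow>qs. f z)\<bar> \<le> M" by blast
  have "(\<Sum>p\<leftarrow>ss. f p) = (\<Sum>p\<leftarrow>ps. f p) + (\<Sum>p\<leftarrow>qs. f p)"
    by (metis (no_types, lifting) pq(1) mset_append mset_map sum_mset_sum_list sum_list_append map_append)
  then have ge: "\<delta> / 16 \<le> (\<Sum>p\<leftarrow>ps. f p)" "\<delta> / 16 \<le> (\<Sum>p\<leftarrow>qs. f p)"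
    using pq(2) ss_ge assms(5) by linarith+
  have msub: "mset (ps @ qs) \<subseteq># mset ss" using pq(1) by simp
  show ?thesis
  proof (rule that)
    show "disjoint_pairs (ps @ qs)" by (rule disjoint_pairs_submset[OF dss msub])
    have "set (ps @ qs) \<subseteq> set rs" using set_mset_mono[OF msub] set_ss by (simp add: subset_iff)
    then show "set (map fst (ps @ qs) @ map snd (ps @ qs)) \<subseteq> {1..n}"
      using rs(2) by (auto simp: image_subset_iff)
    have "length (ps @ qs) = k" using pq(1) ss(2) by (metis size_mset mset_append)
    moreover have "real k \<le> \<delta> * real n / 4"
    proof -
      have "real k \<le> real (nat \<lfloor>\<delta> * real n / 4\<rfloor>)" by (simp add: k_def)
      also have "\<dots> \<le> \<delta> * real n / 4" using \<delta> by (intro of_nat_floor) simp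
      finally show ?thesis .
    qed
    ultimately show "4 * real (length (ps @ qs)) \<le> \<delta> * real n" by simp
  qed (use ge in \<open>simp_all add: f_def\<close>)
qed

section \<open>Characteristic function bound\<close>

lemma prod_list_le_exp_sum_list:
  fixes f :: "'a \<Rightarrow> real"
  assumes "\<And>x. x \<in> set xs \<Longrightarrow> 0 \<le> f x \<and> f x \<le> exp (g x)"
  shows "(\<Prod>x\<leftarrow>xs. f x) \<le> exp (\<Sum>x\<leftarrow>xs. g x)"
  using assms
proof (induction xs)
  case (Cons x xs)
  have "f x * (\<Prod>x\<leftarrow>xs. f x) \<le> exp (g x) * exp (\<Sum>x\<leftarrow>xs. g x)"
    using Cons by (intro mult_mono prod_list_nonneg) auto
  then show ?case by (simp add: exp_add)
qed simp

text \<open>With mean zero each weight is an average of differences, so it obeys the same bound as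
  the gaps, and the normalisation of the squares then needs many indices. The second claim thus
  makes \<open>n\<close> large as soon as \<open>A\<close> is.\<close>

lemma spread_weights_properties:
  assumes "spread_weights A n w" "A > 0" "n \<ge> 2"
  shows "i \<in> {1..n} \<Longrightarrow> j \<in> {1..n} \<Longrightarrow> \<bar>w i - w j\<bar> \<le> 1 / (A * sqrt (ln (real n)))"
    and "A\<^sup>2 * ln (real n) \<le> real n" and "1 / 2 \<le> ln (real n)"
proof -
  define \<eta> where "\<eta> = 1 / (A * sqrt (ln (real n)))"
  have "ln 2 \<le> ln (real n)" using assms(3) by simp
  then show ln: "1 / 2 \<le> ln (real n)" using ln2_ge_two_thirds by linarith
  have \<eta>0: "\<eta> \<ge> 0" using assms(2) ln by (simp add: \<eta>_def)
  have \<eta>: "\<bar>w i - w j\<bar> \<le> \<eta>" if "i \<in> {1..n}" "j \<in> {1..n}" for i j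
    using assms(1) that \<eta>0 unfolding spread_weights_def \<eta>_def by (cases "i = j") auto
  then show "i \<in> {1..n} \<Longrightarrow> j \<in> {1..n} \<Longrightarrow> \<bar>w i - w j\<bar> \<le> 1 / (A * sqrt (ln (real n)))"
    unfolding \<eta>_def by blast
  have w0: "(\<Sum>i\<in>{1..n}. w i) = 0" and w1: "(\<Sum>i\<in>{1..n}. (w i)\<^sup>2) = 1"
    using assms(1) by (auto simp: spread_weights_def)
  have sq: "(w i)\<^sup>2 \<le> \<eta>\<^sup>2" if i: "i \<in> {1..n}" for i
  proof -
    have "real n * w i = (\<Sum>j\<in>{1..n}. w i - w j)" using w0 by (simp add: sum_subtractf)
    also have "\<bar>\<dots>\<bar> \<le> (\<Sum>j\<in>{1..n}. \<eta>)"
      by (rule order.trans[OF sum_abs]) (intro sum_mono \<eta> i)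
    finally have "real n * \<bar>w i\<bar> \<le> real n * \<eta>" by (simp add: abs_mult)
    then have "\<bar>w i\<bar> \<le> \<eta>" using assms(3) by simp
    then show ?thesis using \<eta>0 by (simp add: abs_le_square_iff[symmetric])
  qed
  have "1 \<le> (\<Sum>i\<in>{1..n}. \<eta>\<^sup>2)" unfolding w1[symmetric] by (intro sum_mono sq)
  then have "1 \<le> real n * \<eta>\<^sup>2" by simp
  also have "\<dots> = real n / (A\<^sup>2 * ln (real n))" using ln by (simp add: \<eta>_def power_divide power_mult_distrib)
  finally show "A\<^sup>2 * ln (real n) \<le> real n" using assms(2) ln by (simp add: field_simps)
qed

text \<open>The pairs consume at most \<delta> n / 2 values, so every set \<open>Z\<close> of
  remaining values meets \<open>I\<close> in at least \<delta> n / 2 elements and the phase bound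
  applies to \<open>Z \<inter> I\<close>. For a pair with half gap \<open>D p\<close> it is used at
  the frequency (s, t) scaled by \<open>D p\<close>.\<close>

lemma sum_prod_cos_square_le:
  fixes v v' w :: "nat \<Rightarrow> real"
  assumes phase: "\<And>J s t. J \<subseteq> I \<Longrightarrow> \<delta> / 2 * real n \<le> real (card J) \<Longrightarrow>
       \<bar>s\<bar> \<le> \<tau> * real n \<Longrightarrow> \<bar>t\<bar> \<le> \<tau> * real n \<Longrightarrow>
       c1 * (real n)\<^sup>2 * min 1 (s\<^sup>2 + t\<^sup>2)
         \<le> (\<Sum>a\<in>J. \<Sum>b\<in>J. (sin ((s * v a + t * v' a) - (s * v b + t * v' b)))\<^sup>2)"
    and c1: "0 < c1" "c1 \<le> 1"
    and I: "I \<subseteq> {1..n}" "\<delta> * real n \<le> real (card I)"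
    and ps: "disjoint_pairs ps" "set (map fst ps @ map snd ps) \<subseteq> {1..n}" "4 * real (length ps) \<le> \<delta> * real n"
    and small: "\<And>p. p \<in> set ps \<Longrightarrow> \<bar>s\<bar> * \<bar>w (fst p) - w (snd p)\<bar> / 2 \<le> \<tau> * real n \<and>
       \<bar>t\<bar> * \<bar>w (fst p) - w (snd p)\<bar> / 2 \<le> \<tau> * real n"
  shows "(\<Sum>\<pi> | \<pi> permutes {1..n}. \<Prod>p\<leftarrow>ps. (cos ((s, t) \<bullet> swap_step w (\<lambda>a. (v a, v' a)) \<pi> p))\<^sup>2)
    \<le> fact n * exp (- c1 * (\<Sum>p\<leftarrow>ps. min 1 (((w (fst p) - w (snd p)) / 2)\<^sup>2 * (s\<^sup>2 + t\<^sup>2))))"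
proof -
  define D where "D = (\<lambda>p. (w (fst p) - w (snd p)) / 2)"
  define q where "q = (\<lambda>p a. (s * D p) * v a + (t * D p) * v' a)"
  define G where "G = (\<lambda>p a b. (cos (q p a - q p b))\<^sup>2)"
  define m where "m = (\<lambda>p. c1 * min 1 ((D p)\<^sup>2 * (s\<^sup>2 + t\<^sup>2)))"
  have m: "0 \<le> m p" "m p \<le> 1" for p
  proof -
    show "0 \<le> m p" using c1 by (simp add: m_def)
    have "c1 * min 1 ((D p)\<^sup>2 * (s\<^sup>2 + t\<^sup>2)) \<le> 1 * 1" using c1 by (intro mult_mono) auto
    then show "m p \<le> 1" by (simp add: m_def)
  qed
  have "(\<Sum>\<pi> | \<pi> permutes {1..n}. \<Prod>p\<leftarrow>ps. (cos ((s, t) \<bullet> swap_step w (\<lambda>a. (v a, v' a)) \<pi> p))\<^sup>2)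
    = (\<Sum>\<pi>\<in>bij_ext {1..n} {1..n} id. \<Prod>p\<leftarrow>ps. G p (\<pi> (fst p)) (\<pi> (snd p)))"
    unfolding permutes_eq_bij_ext
  proof (intro sum.cong refl arg_cong[of _ _ prod_list] map_cong)
    fix \<pi> :: "nat \<Rightarrow> nat" and p
    have "(s, t) \<bullet> swap_step w (\<lambda>a. (v a, v' a)) \<pi> p = q p (\<pi> (fst p)) - q p (\<pi> (snd p))"
    proof -
      have "(w (fst p) - w (snd p)) / 2 = D p" by (simp add: D_def)
      then show ?thesis by (simp add: swap_step_def q_def algebra_simps)
    qed
    then show "(cos ((s, t) \<bullet> swap_step w (\<lambda>a. (v a, v' a)) \<pi> p))\<^sup>2 = G p (\<pi> (fst p)) (\<pi> (snd p))"
      by (simp add: G_def)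
  qed
  also have "\<dots> \<le> fact (card {1..n}) * (\<Prod>p\<leftarrow>ps. 1 - m p)"
  proof (rule sum_bij_ext_prod_le)
    fix p Z assume p: "p \<in> set ps" and Z: "Z \<subseteq> {1..n}" "card {1..n} \<le> card Z + 2 * length ps"
    have fZ: "finite Z" using Z finite_subset by blast
    have "2 * real (length ps) \<le> \<delta> / 2 * real n" using ps(3) by simp
    then have cZ: "real n - \<delta> / 2 * real n \<le> real (card Z)" using Z(2) by simp
    define J where "J = Z \<inter> I"
    have "real (card I) + real (card Z) \<le> real n + real (card J)"
    proof -
      have fI: "finite I" using I finite_subset by blast
      have "card (I \<union> Z) \<le> n" using card_mono[of "{1..n}" "I \<union> Z"] I Z by simp
      moreover have "card I + card Z = card (I \<union> Z) + card J"
        unfolding J_def using card_Un_Int[OF fI fZ] by (simp add: Int_commute)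
      ultimately show ?thesis by linarith
    qed
    then have cJ: "\<delta> / 2 * real n \<le> real (card J)" using I(2) cZ by linarith
    have "m p * (real n)\<^sup>2 = c1 * (real n)\<^sup>2 * min 1 ((s * D p)\<^sup>2 + (t * D p)\<^sup>2)"
      by (simp add: m_def power_mult_distrib algebra_simps)
    also have "\<dots> \<le> (\<Sum>a\<in>J. \<Sum>b\<in>J. (sin (q p a - q p b))\<^sup>2)"
      unfolding q_def using small[OF p] cJ
      by (intro phase) (auto simp: J_def D_def abs_mult)
    also have "\<dots> \<le> (\<Sum>a\<in>Z. \<Sum>b\<in>J. (sin (q p a - q p b))\<^sup>2)"
      using fZ by (intro sum_mono2) (auto simp: J_def intro: sum_nonneg)
    also have "\<dots> \<le> (\<Sum>a\<in>Z. \<Sum>b\<in>Z. (sin (q p a - q p b))\<^sup>2)"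
      using fZ by (intro sum_mono sum_mono2) (auto simp: J_def)
    \<comment> \<open>The diagonal contributes sin 0 = 0, so passing to distinct values costs
      nothing.\<close>
    also have "\<dots> = (\<Sum>a\<in>Z. \<Sum>b\<in>Z - {a}. (sin (q p a - q p b))\<^sup>2)"
    proof (rule sum.cong[OF refl])
      fix a assume "a \<in> Z"
      then show "(\<Sum>b\<in>Z. (sin (q p a - q p b))\<^sup>2) = (\<Sum>b\<in>Z - {a}. (sin (q p a - q p b))\<^sup>2)"
        using sum.remove[OF fZ, of a "\<lambda>b. (sin (q p a - q p b))\<^sup>2"] by simp
    qed
    finally have sin_ge: "m p * (real n)\<^sup>2 \<le> (\<Sum>a\<in>Z. \<Sum>b\<in>Z - {a}. (sin (q p a - q p b))\<^sup>2)" .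
    have "(\<Sum>a\<in>Z. \<Sum>b\<in>Z - {a}. G p a b)
        = (\<Sum>a\<in>Z. \<Sum>b\<in>Z - {a}. 1) - (\<Sum>a\<in>Z. \<Sum>b\<in>Z - {a}. (sin (q p a - q p b))\<^sup>2)"
      unfolding G_def cos_squared_eq by (simp only: sum_subtractf)
    also have "(\<Sum>a\<in>Z. \<Sum>b\<in>Z - {a}. 1 :: real) = real (card Z) * (real (card Z) - 1)"
    proof -
      have "(\<Sum>a\<in>Z. \<Sum>b\<in>Z - {a}. 1 :: real) = (\<Sum>a\<in>Z. real (card Z) - 1)"
      proof (intro sum.cong refl)
        fix a assume "a \<in> Z"
        then have "card Z \<ge> 1" using fZ by (metis One_nat_def Suc_leI card_gt_0_iff empty_iff)
        then show "(\<Sum>b\<in>Z - {a}. 1 :: real) = real (card Z) - 1"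
          using \<open>a \<in> Z\<close> fZ by (simp add: card_Diff_singleton of_nat_diff)
      qed
      then show ?thesis by simp
    qed
    finally have "(\<Sum>a\<in>Z. \<Sum>b\<in>Z - {a}. G p a b)
        \<le> real (card Z) * (real (card Z) - 1) - m p * (real n)\<^sup>2" using sin_ge by linarith
    moreover have "m p * (real (card Z) * (real (card Z) - 1)) \<le> m p * (real n)\<^sup>2"
    proof (intro mult_left_mono m)
      have "real (card Z) \<le> real n" using card_mono[OF _ Z(1)] by simp
      then have "real (card Z) * real (card Z) \<le> real n * real n" by (intro mult_mono) auto
      then show "real (card Z) * (real (card Z) - 1) \<le> (real n)\<^sup>2"
        by (simp add: power2_eq_square algebra_simps)
    qed
    ultimately show "(\<Sum>a\<in>Z. \<Sum>b\<in>Z - {a}. G p a b)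
        \<le> (1 - m p) * (real (card Z) * (real (card Z) - 1))" by (simp add: algebra_simps)
  qed (use ps m in \<open>auto simp: disjoint_pairs_def G_def\<close>)
  also have "\<dots> \<le> fact n * exp (\<Sum>p\<leftarrow>ps. - m p)"
  proof -
    have "(\<Prod>p\<leftarrow>ps. 1 - m p) \<le> exp (\<Sum>p\<leftarrow>ps. - m p)"
      using m exp_ge_add_one_self[of "- m _"] by (intro prod_list_le_exp_sum_list) auto
    then show ?thesis by (simp add: mult_left_mono)
  qed
  also have "(\<Sum>p\<leftarrow>ps. - m p) = - c1 * (\<Sum>p\<leftarrow>ps. min 1 ((D p)\<^sup>2 * (s\<^sup>2 + t\<^sup>2)))"
    by (induction ps) (auto simp: m_def algebra_simps)
  finally show ?thesis by (simp add: D_def)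
qed

text \<open>The bound is stated as a square because the later Cauchy-Schwarz step takes its root.
  Both families satisfy it, so either can supply the anti-concentration.\<close>

lemma exists_decoupling_pairs:
  fixes \<delta> b c B :: real
  assumes d: "d \<ge> 2" and \<delta>: "0 < \<delta>" "\<delta> \<le> 1" and bc: "b \<noteq> 0" "c \<noteq> 0" and B: "B > 0"
  obtains A0 c2 where "0 < A0" "0 < c2"
    "\<And>n w I v v'. n \<ge> 2 \<Longrightarrow> admissible d \<delta> b c B A0 n w I v v' \<Longrightarrow>
      \<exists>ps qs. disjoint_pairs (ps @ qs) \<and> set (map fst (ps @ qs) @ map snd (ps @ qs)) \<subseteq> {1..n} \<and>
        (\<forall>rs\<in>{ps, qs}. \<forall>s t. \<bar>s\<bar> \<le> real n \<longrightarrow> \<bar>t\<bar> \<le> real n \<longrightarrow>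
          (\<Sum>\<pi> | \<pi> permutes {1..n}. \<Prod>p\<leftarrow>rs. (cos ((s, t) \<bullet> swap_step w (\<lambda>a. (v a, v' a)) \<pi> p))\<^sup>2)
            \<le> fact n * (exp (- c2 * (s\<^sup>2 + t\<^sup>2)) + 1 / (real n)\<^sup>2)\<^sup>2)"
proof -
  have \<delta>2: "0 < \<delta> / 2" "\<delta> / 2 \<le> 1" using \<delta> by auto
  obtain c1 \<tau> N where c1: "0 < c1" "c1 \<le> 1" and \<tau>: "0 < \<tau>" and phase:
    "\<And>n J v v' s t. N \<le> real n \<Longrightarrow> J \<subseteq> {1..n} \<Longrightarrow> \<delta> / 2 * real n \<le> real (card J) \<Longrightarrow>
       bounded_poly_values d b B n J v \<Longrightarrow> bounded_poly_values (d - 1) c B n J v' \<Longrightarrow>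
       \<bar>s\<bar> \<le> \<tau> * real n \<Longrightarrow> \<bar>t\<bar> \<le> \<tau> * real n \<Longrightarrow>
       c1 * (real n)\<^sup>2 * min 1 (s\<^sup>2 + t\<^sup>2)
         \<le> (\<Sum>a\<in>J. \<Sum>b\<in>J. (sin ((s * v a + t * v' a) - (s * v b + t * v' b)))\<^sup>2)"
    using sum_sin_square_poly_values_ge[OF d \<delta>2 bc B] by blast
  define c2 where "c2 = c1 * \<delta> / 128"
  have c2: "c2 > 0" using c1 \<delta> by (simp add: c2_def)
  \<comment> \<open>In order, the summands beyond 1 keep the scaled frequencies below
    \<open>\<tau> * real n\<close>, make \<open>n\<close> at least \<open>N\<close>, give both 8 /
    \<delta> \<le> n and squared gaps of at most \<delta> / 8, and push the non-Gaussian term below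
    1 / n^2.\<close>
  define A where "A = 1 + 1 / \<tau> + 2 * \<bar>N\<bar> + 32 / \<delta> + 2 / c2"
  have pos: "0 < 1 / \<tau>" "0 \<le> 2 * \<bar>N\<bar>" "0 < 32 / \<delta>" "0 < 2 / c2" using \<tau> \<delta> c2 by auto
  have A: "1 \<le> A" "1 / \<tau> \<le> A" "2 * N \<le> A" "32 / \<delta> \<le> A" "2 / c2 \<le> A"
    using pos unfolding A_def by linarith+
  have AA: "A \<le> A\<^sup>2" using A(1) by (simp add: power2_eq_square)
  show ?thesis
  proof (rule that[of A c2])
    show "0 < A" using A(1) by simp
    show "0 < c2" by (rule c2)
    fix n w I v v'
    assume n2: "n \<ge> 2" and adm: "admissible d \<delta> b c B A n w I v v'"
    have sw: "spread_weights A n w" and I: "I \<subseteq> {1..n}" "\<delta> * real n \<le> real (card I)"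
      and v: "bounded_poly_values d b B n I v" "bounded_poly_values (d - 1) c B n I v'"
      using adm by (auto simp: admissible_def)
    define \<eta> where "\<eta> = 1 / (A * sqrt (ln (real n)))"
    note sp = spread_weights_properties[OF sw \<open>0 < A\<close> n2]
    have \<eta>: "\<bar>w i - w j\<bar> \<le> \<eta>" if "i \<in> {1..n}" "j \<in> {1..n}" for i j
      using sp(1)[OF that] by (simp add: \<eta>_def)
    have lnn: "1 / 2 \<le> ln (real n)" by (rule sp(3))
    have \<eta>2: "\<eta>\<^sup>2 * (A\<^sup>2 * ln (real n)) = 1"
      using lnn A(1) by (simp add: \<eta>_def power_divide power_mult_distrib)
    have \<eta>0: "\<eta> > 0" using lnn A(1) by (simp add: \<eta>_def)
    have \<eta>A: "\<eta>\<^sup>2 \<le> 2 / A\<^sup>2"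
    proof -
      have "\<eta>\<^sup>2 * (A\<^sup>2 * (1 / 2)) \<le> \<eta>\<^sup>2 * (A\<^sup>2 * ln (real n))" using lnn by (intro mult_left_mono) auto
      then have "\<eta>\<^sup>2 * (A\<^sup>2 * (1 / 2)) \<le> 1" using \<eta>2 by simp
      then show ?thesis using A(1) by (simp add: field_simps)
    qed
    have nA: "A / 2 \<le> real n"
    proof -
      have "A\<^sup>2 * (1 / 2) \<le> A\<^sup>2 * ln (real n)" using lnn by (intro mult_left_mono) auto
      then show ?thesis using sp(2) AA by linarith
    qed
    have nN: "N \<le> real n" using nA A(3) by linarith
    have n8: "8 / \<delta> \<le> real n"
    proof -
      have "8 / \<delta> \<le> 16 / \<delta>" "16 / \<delta> = 32 / \<delta> / 2" using \<delta> by (auto simp: field_simps)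
      then show ?thesis using nA A(4) by linarith
    qed
    have M: "\<eta>\<^sup>2 \<le> \<delta> / 8"
    proof -
      have "2 / A\<^sup>2 \<le> 2 / A" using AA A(1) by (intro divide_left_mono) auto
      also have "\<dots> \<le> 2 / (32 / \<delta>)" using A(1,4) pos by (intro divide_left_mono) auto
      also have "\<dots> \<le> \<delta> / 8" using \<delta> by simp
      finally show ?thesis using \<eta>A by linarith
    qed
    have diff_sq: "(w i - w j)\<^sup>2 \<le> \<eta>\<^sup>2" if "i \<in> {1..n}" "j \<in> {1..n}" for i j
      using \<eta>[OF that] \<eta>0 by (simp add: abs_le_square_iff[symmetric])
    have w01: "(\<Sum>i\<in>{1..n}. w i) = 0" "(\<Sum>i\<in>{1..n}. (w i)\<^sup>2) = 1"
      using sw by (auto simp: spread_weights_def)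
    obtain ps qs where pq: "disjoint_pairs (ps @ qs)"
      "set (map fst (ps @ qs) @ map snd (ps @ qs)) \<subseteq> {1..n}"
      "4 * real (length (ps @ qs)) \<le> \<delta> * real n"
      "\<delta> / 16 \<le> (\<Sum>p\<leftarrow>ps. (w (fst p) - w (snd p))\<^sup>2)"
      "\<delta> / 16 \<le> (\<Sum>p\<leftarrow>qs. (w (fst p) - w (snd p))\<^sup>2)"
      by (rule exists_two_pair_families[OF w01 diff_sq _ M \<delta> n8]) (use that in auto)
    have "(\<Sum>\<pi> | \<pi> permutes {1..n}. \<Prod>p\<leftarrow>rs. (cos ((s, t) \<bullet> swap_step w (\<lambda>a. (v a, v' a)) \<pi> p))\<^sup>2)
        \<le> fact n * (exp (- c2 * (s\<^sup>2 + t\<^sup>2)) + 1 / (real n)\<^sup>2)\<^sup>2"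
      if rs: "rs \<in> {ps, qs}" and st: "\<bar>s\<bar> \<le> real n" "\<bar>t\<bar> \<le> real n" for rs s t
    proof -
      have dr: "disjoint_pairs rs" "set (map fst rs @ map snd rs) \<subseteq> {1..n}"
        "4 * real (length rs) \<le> \<delta> * real n" "\<delta> / 16 \<le> (\<Sum>p\<leftarrow>rs. (w (fst p) - w (snd p))\<^sup>2)"
        using rs pq by (auto simp: disjoint_pairs_def)
      have in_n: "fst p \<in> {1..n}" "snd p \<in> {1..n}" if "p \<in> set rs" for p
        using dr(2) that by (auto simp: image_subset_iff)
      let ?D = "\<lambda>p. (w (fst p) - w (snd p)) / 2"
      have small: "\<bar>r\<bar> * \<bar>w (fst p) - w (snd p)\<bar> / 2 \<le> \<tau> * real n"
        if p: "p \<in> set rs" and r: "\<bar>r\<bar> \<le> real n" for p r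
      proof -
        have "2 / A\<^sup>2 \<le> 4 / A\<^sup>2" by (intro divide_right_mono) auto
        then have "\<eta>\<^sup>2 \<le> (2 / A)\<^sup>2" using \<eta>A by (simp add: power_divide)
        then have "\<eta> \<le> 2 / A" by (rule power2_le_imp_le) (use A(1) in auto)
        moreover have "1 / A \<le> \<tau>" using A(1,2) \<tau> by (simp add: field_simps)
        ultimately have "\<bar>w (fst p) - w (snd p)\<bar> \<le> 2 * \<tau>"
          using \<eta>[OF in_n[OF p]] by simp
        then have "\<bar>r\<bar> * \<bar>w (fst p) - w (snd p)\<bar> \<le> real n * (2 * \<tau>)"
          using r by (intro mult_mono) auto
        then show ?thesis by (simp add: mult_ac)
      qed
      \<comment> \<open>Truncation at the reciprocal of \<open>\<eta>\<^sup>2\<close> keeps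
        \<open>(?D p)\<^sup>2 * m\<close> at most 1 for all pairs at once. Each minimum is then
        bounded below by a term linear in the squared gap, and the gaps can be summed.\<close>
      define m where "m = min (A\<^sup>2 * ln (real n)) (s\<^sup>2 + t\<^sup>2)"
      have m0: "m \<ge> 0" using lnn by (simp add: m_def)
      have "(\<Sum>\<pi> | \<pi> permutes {1..n}. \<Prod>p\<leftarrow>rs. (cos ((s, t) \<bullet> swap_step w (\<lambda>a. (v a, v' a)) \<pi> p))\<^sup>2)
        \<le> fact n * exp (- c1 * (\<Sum>p\<leftarrow>rs. min 1 ((?D p)\<^sup>2 * (s\<^sup>2 + t\<^sup>2))))"
      proof (rule sum_prod_cos_square_le[OF _ c1 I dr(1-3)])
        fix J s t
        assume J: "J \<subseteq> I" "\<delta> / 2 * real n \<le> real (card J)" "\<bar>s\<bar> \<le> \<tau> * real n" "\<bar>t\<bar> \<le> \<tau> * real n"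
        have "bounded_poly_values d b B n J v" "bounded_poly_values (d - 1) c B n J v'"
          using v J(1) unfolding bounded_poly_values_def by blast+
        then show "c1 * (real n)\<^sup>2 * min 1 (s\<^sup>2 + t\<^sup>2)
            \<le> (\<Sum>a\<in>J. \<Sum>b\<in>J. (sin (s * v a + t * v' a - (s * v b + t * v' b)))\<^sup>2)"
          using phase[OF nN _ J(2) _ _ J(3,4)] J(1) I(1) by blast
      qed (use small st in blast)
      also have "exp (- c1 * (\<Sum>p\<leftarrow>rs. min 1 ((?D p)\<^sup>2 * (s\<^sup>2 + t\<^sup>2)))) \<le> exp (- 2 * c2 * m)"
      proof -
        have "\<delta> / 64 * m \<le> (\<Sum>p\<leftarrow>rs. (w (fst p) - w (snd p))\<^sup>2) / 4 * m"
          using dr(4) m0 by (intro mult_right_mono) auto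
        also have "\<dots> = (\<Sum>p\<leftarrow>rs. (?D p)\<^sup>2 * m)"
          by (induction rs) (auto simp: power_divide field_simps)
        also have "\<dots> \<le> (\<Sum>p\<leftarrow>rs. min 1 ((?D p)\<^sup>2 * (s\<^sup>2 + t\<^sup>2)))"
        proof (intro sum_list_mono)
          fix p assume p: "p \<in> set rs"
          have "(?D p)\<^sup>2 = (w (fst p) - w (snd p))\<^sup>2 / 4" by (simp add: power_divide)
          then have "(?D p)\<^sup>2 \<le> \<eta>\<^sup>2"
            using diff_sq[OF in_n[OF p]] zero_le_power2[of "w (fst p) - w (snd p)"] by linarith
          then have "(?D p)\<^sup>2 * m \<le> \<eta>\<^sup>2 * (A\<^sup>2 * ln (real n))"
            using m0 by (intro mult_mono) (auto simp: m_def)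
          moreover have "(?D p)\<^sup>2 * m \<le> (?D p)\<^sup>2 * (s\<^sup>2 + t\<^sup>2)"
            by (intro mult_left_mono) (auto simp: m_def)
          ultimately show "(?D p)\<^sup>2 * m \<le> min 1 ((?D p)\<^sup>2 * (s\<^sup>2 + t\<^sup>2))" using \<eta>2 by simp
        qed
        finally have "c1 * (\<delta> / 64 * m) \<le> c1 * (\<Sum>p\<leftarrow>rs. min 1 ((?D p)\<^sup>2 * (s\<^sup>2 + t\<^sup>2)))"
          using c1 by (intro mult_left_mono) auto
        then show ?thesis by (simp add: c2_def mult_ac)
      qed
      also have "exp (- 2 * c2 * m) = (exp (- c2 * m))\<^sup>2"
        by (simp add: power2_eq_square flip: exp_add)
      also have "\<dots> \<le> (exp (- c2 * (s\<^sup>2 + t\<^sup>2)) + 1 / (real n)\<^sup>2)\<^sup>2"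
      proof (intro power_mono)
        \<comment> \<open>Beyond the truncation the exponent is c2 A^2 ln n, which is at least 2 ln
          n.\<close>
        show "exp (- c2 * m) \<le> exp (- c2 * (s\<^sup>2 + t\<^sup>2)) + 1 / (real n)\<^sup>2"
        proof (cases "s\<^sup>2 + t\<^sup>2 \<le> A\<^sup>2 * ln (real n)")
          case False
          have "2 \<le> c2 * A" using A(5) c2 by (simp add: field_simps)
          also have "\<dots> \<le> c2 * A\<^sup>2" using AA c2 by (intro mult_left_mono) auto
          finally have "2 * ln (real n) \<le> c2 * A\<^sup>2 * ln (real n)" using lnn by (intro mult_right_mono) auto
          then have "exp (- c2 * m) \<le> exp (- 2 * ln (real n))"
            using False by (simp add: m_def mult.assoc)
          also have "\<dots> = 1 / (real n)\<^sup>2"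
            using n2 by (simp add: exp_minus exp_double field_simps)
          finally show ?thesis by (simp add: add_increasing)
        qed (simp add: m_def)
      qed auto
      finally show ?thesis by (simp add: mult_left_mono)
    qed
    then show "\<exists>ps qs. disjoint_pairs (ps @ qs) \<and> set (map fst (ps @ qs) @ map snd (ps @ qs)) \<subseteq> {1..n} \<and>
        (\<forall>rs\<in>{ps, qs}. \<forall>s t. \<bar>s\<bar> \<le> real n \<longrightarrow> \<bar>t\<bar> \<le> real n \<longrightarrow>
          (\<Sum>\<pi> | \<pi> permutes {1..n}. \<Prod>p\<leftarrow>rs. (cos ((s, t) \<bullet> swap_step w (\<lambda>a. (v a, v' a)) \<pi> p))\<^sup>2)
            \<le> fact n * (exp (- c2 * (s\<^sup>2 + t\<^sup>2)) + 1 / (real n)\<^sup>2)\<^sup>2)"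
      using pq(1,2) by blast
  qed
qed

section \<open>Small-ball probabilities\<close>

lemma sum_exp_neg_square_diff_le:
  assumes "c > 0" "a < n"
  shows "(\<Sum>b<n. exp (- c * (real a - real b)\<^sup>2)) \<le> 2 / (1 - exp (- c))"
proof -
  define q where "q = exp (- c)"
  have q: "0 < q" "q < 1" using assms by (auto simp: q_def)
  have geom: "(\<Sum>b\<in>S. q ^ f b) \<le> 1 / (1 - q)" if "inj_on f S" "finite S" for f :: "nat \<Rightarrow> nat" and S
  proof -
    have "(\<Sum>b\<in>S. q ^ f b) = (\<Sum>m\<in>f ` S. q ^ m)" using that by (simp add: sum.reindex)
    also have "\<dots> \<le> (\<Sum>m. q ^ m)"
      using q that by (intro sum_le_suminf summable_geometric) auto
    finally show ?thesis using q by (simp add: suminf_geometric)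
  qed
  have le: "exp (- c * (real a - real b)\<^sup>2) \<le> q ^ (if b \<le> a then a - b else b - a)" for b
  proof -
    define m where "m = (if b \<le> a then a - b else b - a)"
    have sq: "(real a - real b)\<^sup>2 = (real m)\<^sup>2" by (auto simp: m_def of_nat_diff power2_commute)
    have "real m \<le> (real m)\<^sup>2" by (cases m) (auto simp: power2_eq_square algebra_simps)
    then have "c * real m \<le> c * (real m)\<^sup>2" using assms by (intro mult_left_mono) auto
    then have "exp (- c * (real m)\<^sup>2) \<le> exp (- c * real m)" by simp
    also have "exp (- c * real m) = q ^ m" by (simp add: q_def mult.commute flip: exp_of_nat_mult)
    finally show ?thesis unfolding sq m_def[symmetric] .
  qed
  have "(\<Sum>b<n. exp (- c * (real a - real b)\<^sup>2)) \<le> (\<Sum>b<n. q ^ (if b \<le> a then a - b else b - a))"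
    by (intro sum_mono le)
  also have "\<dots> = (\<Sum>b\<in>{..a}. q ^ (a - b)) + (\<Sum>b\<in>{a<..<n}. q ^ (b - a))"
  proof -
    have split: "{..<n} = {..a} \<union> {a<..<n}" using assms(2) by auto
    show ?thesis unfolding split by (subst sum.union_disjoint) auto
  qed
  also have "\<dots> \<le> 1 / (1 - q) + 1 / (1 - q)"
    by (intro add_mono geom) (auto intro!: inj_onI)
  finally show ?thesis by (simp add: q_def)
qed

text \<open>For each of the n^2 points \<open>j\<close> the Gaussian part summed over
  \<open>k\<close> is bounded, by comparison with geometric series, and the n^2 errors 1 / n^2 add
  up to 1.\<close>

lemma fejer_sum_gaussian_le:
  assumes "c > 0" "n \<ge> 1"
  shows "fejer_sum n (\<lambda>s t. exp (- c * (s\<^sup>2 + t\<^sup>2)) + 1 / (real n)\<^sup>2)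
    \<le> (4 / (1 - exp (- c))\<^sup>2 + 1) * (real n)\<^sup>2"
proof -
  define e where "e = (\<lambda>x. exp (- c * x\<^sup>2))"
  define K where "K = 2 / (1 - exp (- c))"
  have K: "K \<ge> 0" using assms(1) by (simp add: K_def)
  have row: "(\<Sum>k<n. e (real j - real k)) \<le> K" if "j < n" for j
    unfolding e_def K_def by (rule sum_exp_neg_square_diff_le[OF assms(1) that])
  have row0: "0 \<le> (\<Sum>k<n. e (real j - real k))" for j by (intro sum_nonneg) (simp add: e_def)
  have "fejer_sum n (\<lambda>s t. exp (- c * (s\<^sup>2 + t\<^sup>2)) + 1 / (real n)\<^sup>2)
      = (\<Sum>j\<in>{..<n} \<times> {..<n}. \<Sum>k\<in>{..<n} \<times> {..<n}.
          e (real (fst j) - real (fst k)) * e (real (snd j) - real (snd k)) + 1 / (real n)\<^sup>2)"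
    unfolding fejer_sum_def sum.cartesian_product
    by (simp add: e_def distrib_left exp_diff exp_minus divide_inverse case_prod_unfold)
  also have "\<dots> = (\<Sum>j\<in>{..<n} \<times> {..<n}. (\<Sum>k<n. e (real (fst j) - real k)) * (\<Sum>k<n. e (real (snd j) - real k)) + 1)"
  proof (intro sum.cong refl)
    fix j :: "nat \<times> nat"
    have "(\<Sum>k<n. e (real (fst j) - real k)) * (\<Sum>k<n. e (real (snd j) - real k))
      = (\<Sum>k\<in>{..<n} \<times> {..<n}. e (real (fst j) - real (fst k)) * e (real (snd j) - real (snd k)))"
      unfolding sum_product sum.cartesian_product by (simp add: case_prod_unfold)
    moreover have "(\<Sum>k\<in>{..<n} \<times> {..<n}. 1 / (real n)\<^sup>2) = 1"
      using assms(2) by (simp add: power2_eq_square)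
    ultimately show "(\<Sum>k\<in>{..<n} \<times> {..<n}.
          e (real (fst j) - real (fst k)) * e (real (snd j) - real (snd k)) + 1 / (real n)\<^sup>2)
        = (\<Sum>k<n. e (real (fst j) - real k)) * (\<Sum>k<n. e (real (snd j) - real k)) + 1"
      by (simp only: sum.distrib)
  qed
  also have "\<dots> \<le> (\<Sum>j\<in>{..<n} \<times> {..<n}. K * K + 1)"
    using row row0 K by (intro sum_mono add_mono mult_mono) auto
  also have "\<dots> = (4 / (1 - exp (- c))\<^sup>2 + 1) * (real n)\<^sup>2"
    by (simp add: K_def power2_eq_square)
  finally show ?thesis .
qed

text \<open>Cauchy-Schwarz over \<open>S\<close>, frequency by frequency, separates the tilt from
  the cosines, whatever their dependence. The exponent 0 with \<open>E = 1\<close> gives the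
  untilted estimate.\<close>

lemma sum_exp_mult_cos_prod_mean_le:
  fixes X :: "'a \<Rightarrow> 'p \<Rightarrow> real \<times> real" and g :: "'a \<Rightarrow> real"
  assumes "c > 0" "n \<ge> 1" "N \<ge> 0"
    and bound: "\<And>s t. \<bar>s\<bar> \<le> real n \<Longrightarrow> \<bar>t\<bar> \<le> real n \<Longrightarrow>
       (\<Sum>\<pi>\<in>S. \<Prod>p\<leftarrow>ps. (cos ((s, t) \<bullet> X \<pi> p))\<^sup>2) \<le> N * (exp (- c * (s\<^sup>2 + t\<^sup>2)) + 1 / (real n)\<^sup>2)\<^sup>2"
    and g: "(\<Sum>\<pi>\<in>S. exp (2 * g \<pi>)) \<le> N * E\<^sup>2" "E \<ge> 0"
  shows "(\<Sum>\<pi>\<in>S. exp (g \<pi>) * cos_prod_mean n (map (X \<pi>) ps))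
    \<le> N * E * (4 * (4 / (1 - exp (- c))\<^sup>2 + 1)) / (real n)\<^sup>2"
proof -
  define P where "P = (\<lambda>\<pi> s t. \<Prod>p\<leftarrow>ps. \<bar>cos ((s, t) \<bullet> X \<pi> p)\<bar>)"
  define r where "r = (\<lambda>s t. exp (- c * (s\<^sup>2 + t\<^sup>2)) + 1 / (real n)\<^sup>2)"
  have CS: "(\<Sum>\<pi>\<in>S. exp (g \<pi>) * P \<pi> s t) \<le> N * E * r s t" if "\<bar>s\<bar> \<le> real n" "\<bar>t\<bar> \<le> real n" for s t
  proof (rule power2_le_imp_le)
    have sq: "(P \<pi> s t)\<^sup>2 = (\<Prod>p\<leftarrow>ps. (cos ((s, t) \<bullet> X \<pi> p))\<^sup>2)" for \<pi>
      unfolding P_def by (induction ps) (auto simp: power_mult_distrib)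
    have "(\<Sum>\<pi>\<in>S. exp (g \<pi>) * P \<pi> s t)\<^sup>2 \<le> (\<Sum>\<pi>\<in>S. (exp (g \<pi>))\<^sup>2) * (\<Sum>\<pi>\<in>S. (P \<pi> s t)\<^sup>2)"
      by (rule Cauchy_Schwarz_ineq_sum)
    also have "(\<Sum>\<pi>\<in>S. (exp (g \<pi>))\<^sup>2) = (\<Sum>\<pi>\<in>S. exp (2 * g \<pi>))" by (simp add: exp_double)
    also have "(\<Sum>\<pi>\<in>S. (P \<pi> s t)\<^sup>2) = (\<Sum>\<pi>\<in>S. \<Prod>p\<leftarrow>ps. (cos ((s, t) \<bullet> X \<pi> p))\<^sup>2)" by (simp add: sq)
    also have "(\<Sum>\<pi>\<in>S. exp (2 * g \<pi>)) * (\<Sum>\<pi>\<in>S. \<Prod>p\<leftarrow>ps. (cos ((s, t) \<bullet> X \<pi> p))\<^sup>2)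
        \<le> (N * E\<^sup>2) * (N * (r s t)\<^sup>2)"
      unfolding r_def using bound[OF that] g assms(3)
      by (intro mult_mono sum_nonneg prod_list_nonneg) auto
    also have "\<dots> = (N * E * r s t)\<^sup>2" by (simp add: power_mult_distrib power2_eq_square)
    finally show "(\<Sum>\<pi>\<in>S. exp (g \<pi>) * P \<pi> s t)\<^sup>2 \<le> (N * E * r s t)\<^sup>2" .
    show "0 \<le> N * E * r s t" using assms(3) g(2) by (simp add: r_def)
  qed
  have "(\<Sum>\<pi>\<in>S. exp (g \<pi>) * cos_prod_mean n (map (X \<pi>) ps))
      = 4 / real n ^ 4 * (\<Sum>\<pi>\<in>S. exp (g \<pi>) * fejer_sum n (P \<pi>))"
    by (simp add: cos_prod_mean_def P_def sum_distrib_left o_def mult_ac)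
  also have "(\<Sum>\<pi>\<in>S. exp (g \<pi>) * fejer_sum n (P \<pi>)) = fejer_sum n (\<lambda>s t. \<Sum>\<pi>\<in>S. exp (g \<pi>) * P \<pi> s t)"
    unfolding fejer_sum_def sum_distrib_left case_prod_unfold by (rule sum.swap)
  also have "\<dots> \<le> fejer_sum n (\<lambda>s t. N * E * r s t)"
    unfolding fejer_sum_def by (intro sum_mono) (auto intro!: CS)
  also have "\<dots> = N * E * fejer_sum n r"
    unfolding fejer_sum_def sum_distrib_left case_prod_unfold ..
  also have "\<dots> \<le> N * E * ((4 / (1 - exp (- c))\<^sup>2 + 1) * (real n)\<^sup>2)"
    unfolding r_def using assms g(2) by (intro mult_left_mono fejer_sum_gaussian_le) auto
  finally have "(\<Sum>\<pi>\<in>S. exp (g \<pi>) * cos_prod_mean n (map (X \<pi>) ps))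
      \<le> 4 / real n ^ 4 * (N * E * ((4 / (1 - exp (- c))\<^sup>2 + 1) * (real n)\<^sup>2))"
    by (simp add: mult_left_mono divide_right_mono)
  also have "\<dots> = N * E * (4 * (4 / (1 - exp (- c))\<^sup>2 + 1)) / (real n)\<^sup>2"
    using assms(2) by (simp add: power4_eq_xxxx power2_eq_square)
  finally show ?thesis .
qed

section \<open>From sums over permutations to probabilities\<close>

lemma joint_small_ball_prob_eq:
  "joint_small_ball_prob n w v v' L1 L2
    = (\<Sum>\<pi> | \<pi> permutes {1..n}.
        square_indicator n (weighted_sum n w (\<lambda>a. (v a, v' a)) \<pi> - (L1, L2))) / fact n"
proof -
  define S where "S = {\<pi>. \<pi> permutes {1..n}}"
  define T where "T = {\<pi>. \<bar>(\<Sum>i\<in>{1..n}. w i * v (\<pi> i)) - L1\<bar> \<le> 1 / real n \<and>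
            \<bar>(\<Sum>i\<in>{1..n}. w i * v' (\<pi> i)) - L2\<bar> \<le> 1 / real n}"
  have S: "finite S" "S \<noteq> {}" "card S = fact n"
    using permutes_id[of "{1..n}"] card_permutations[of "{1..n}" n] 
    by (auto simp: S_def finite_permutations intro: exI[of _ id])
  have comp: "weighted_sum n w (\<lambda>a. (v a, v' a)) \<pi> = (\<Sum>i\<in>{1..n}. w i * v (\<pi> i), \<Sum>i\<in>{1..n}. w i * v' (\<pi> i))" for \<pi>
    unfolding weighted_sum_def by (simp add: sum_prod)
  have "joint_small_ball_prob n w v v' L1 L2 = real (card (S \<inter> T)) / fact n"
    unfolding joint_small_ball_prob_def uniform_perm_def S_def[symmetric] T_def[symmetric]
    using S by (simp add: measure_pmf_of_set)
  also have "real (card (S \<inter> T)) = (\<Sum>\<pi>\<in>S. of_bool (\<pi> \<in> T))"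
    using S(1) by (simp add: sum.If_cases of_bool_def)
  also have "\<dots> = (\<Sum>\<pi>\<in>S. square_indicator n (weighted_sum n w (\<lambda>a. (v a, v' a)) \<pi> - (L1, L2)))"
    unfolding comp square_indicator_def T_def by simp
  finally show ?thesis unfolding S_def .
qed

lemma sum_list_square_diff_le:
  fixes w :: "nat \<Rightarrow> real"
  assumes "disjoint_pairs ps" "set (map fst ps @ map snd ps) \<subseteq> X" "finite X"
  shows "(\<Sum>p\<leftarrow>ps. (w (fst p) - w (snd p))\<^sup>2) \<le> 2 * (\<Sum>i\<in>X. (w i)\<^sup>2)"
proof -
  have "(\<Sum>p\<leftarrow>ps. (w (fst p) - w (snd p))\<^sup>2) \<le> (\<Sum>p\<leftarrow>ps. 2 * ((w (fst p))\<^sup>2 + (w (snd p))\<^sup>2))"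
  proof (rule sum_list_mono)
    fix p
    show "(w (fst p) - w (snd p))\<^sup>2 \<le> 2 * ((w (fst p))\<^sup>2 + (w (snd p))\<^sup>2)"
      using zero_le_power2[of "w (fst p) + w (snd p)"] by (simp add: power2_eq_square algebra_simps)
  qed
  also have "\<dots> = 2 * (\<Sum>i\<leftarrow>map fst ps @ map snd ps. (w i)\<^sup>2)"
    by (induction ps) (auto simp: algebra_simps)
  also have "(\<Sum>i\<leftarrow>map fst ps @ map snd ps. (w i)\<^sup>2) = (\<Sum>i\<in>set (map fst ps @ map snd ps). (w i)\<^sup>2)"
    using assms(1) unfolding disjoint_pairs_def by (rule sum_list_distinct_conv_sum_set)
  also have "\<dots> \<le> (\<Sum>i\<in>X. (w i)\<^sup>2)" using assms(2,3) by (intro sum_mono2) auto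
  finally show ?thesis by simp
qed

lemma sum_permutes_square_indicator_le:
  assumes "n \<ge> 1" "disjoint_pairs ps" "set (map fst ps @ map snd ps) \<subseteq> {1..n}"
  shows "(\<Sum>\<pi> | \<pi> permutes {1..n}. square_indicator n (weighted_sum n w u \<pi> - L))
    \<le> (\<Sum>\<pi> | \<pi> permutes {1..n}. cos_prod_mean n (map (swap_step w u \<pi>) ps))"
proof -
  have "(\<Sum>\<pi> | \<pi> permutes {1..n}. square_indicator n (weighted_sum n w u \<pi> - L))
    = (\<Sum>\<pi> | \<pi> permutes {1..n}. rademacher_mean (map (swap_step w u \<pi>) ps) (\<lambda>y. square_indicator n (y - L))
        (weighted_sum n w u \<pi> - (\<Sum>p\<leftarrow>ps. swap_step w u \<pi> p)))"
    using sum_permutes_eq_rademacher_mean[of ps n "\<lambda>_. ()" "\<lambda>_ y. square_indicator n (y - L)" w u] assms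
    by (simp add: disjoint_pairs_def)
  also have "\<dots> \<le> (\<Sum>\<pi> | \<pi> permutes {1..n}. cos_prod_mean n (map (swap_step w u \<pi>) ps))"
    using rademacher_mean_square_indicator_le[OF assms(1), of _ "- L"] by (intro sum_mono) simp
  finally show ?thesis .
qed

lemma sum_permutes_exp_inner_le:
  fixes u :: "nat \<Rightarrow> real \<times> real"
  assumes "(\<Sum>i\<in>{1..n}. w i) = 0" "(\<Sum>i\<in>{1..n}. (w i)\<^sup>2) = 1" "n \<ge> 1"
    and "\<And>a. a \<in> {1..n} \<Longrightarrow> \<bar>\<theta> \<bullet> u a\<bar> \<le> F"
  shows "(\<Sum>\<pi> | \<pi> permutes {1..n}. exp (\<theta> \<bullet> weighted_sum n w u \<pi>)) \<le> fact n * exp (8 * F\<^sup>2)"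
proof -
  have "\<theta> \<bullet> weighted_sum n w u \<pi> = (\<Sum>i\<in>{1..n}. w i * (\<theta> \<bullet> u (\<pi> i)))" for \<pi>
    by (simp add: weighted_sum_def inner_sum_right)
  then show ?thesis
    using sum_bij_ext_exp_le[of "{1..n}" "{1..n}" "\<lambda>a. \<theta> \<bullet> u a" F w id] assms
    unfolding permutes_eq_bij_ext by simp
qed

lemma prod_list_cosh_ge_1: "1 \<le> (\<Prod>x\<leftarrow>xs. cosh (f x))" for f :: "'a \<Rightarrow> real"
proof (induction xs)
  case (Cons x xs)
  then show ?case
    using mult_mono[of 1 "cosh (f x)" 1 "\<Prod>x\<leftarrow>xs. cosh (f x)"] by (simp add: cosh_real_ge_1)
qed simp

text \<open>On the small square the tilt \<open>l \<bullet> y\<close> is nearly \<open>l \<bullet> L\<close>, so either the part \<open>m\<close> fixed by the swaps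
  in \<open>qs\<close> or the part \<open>y - m\<close> created by them carries at least half of it. In the first case the swaps
  in \<open>qs\<close> provide the anti-concentration, in the second case those in \<open>ps\<close>; the exponential moment is
  taken over randomness independent of the one used.\<close>

lemma sum_permutes_square_indicator_tilted_le:
  fixes u :: "nat \<Rightarrow> real \<times> real" and l L :: "real \<times> real"
  assumes n: "n \<ge> 1" and dp: "disjoint_pairs (ps @ qs)"
    and sub: "set (map fst (ps @ qs) @ map snd (ps @ qs)) \<subseteq> {1..n}"
    and w: "(\<Sum>i\<in>{1..n}. w i) = 0" "(\<Sum>i\<in>{1..n}. (w i)\<^sup>2) = 1"
    and c: "c > 0"
    and bound: "\<And>rs s t. rs \<in> {ps, qs} \<Longrightarrow> \<bar>s\<bar> \<le> real n \<Longrightarrow> \<bar>t\<bar> \<le> real n \<Longrightarrow>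
       (\<Sum>\<pi> | \<pi> permutes {1..n}. \<Prod>p\<leftarrow>rs. (cos ((s, t) \<bullet> swap_step w u \<pi> p))\<^sup>2)
         \<le> fact n * (exp (- c * (s\<^sup>2 + t\<^sup>2)) + 1 / (real n)\<^sup>2)\<^sup>2"
    and F: "\<And>a. a \<in> {1..n} \<Longrightarrow> \<bar>l \<bullet> u a\<bar> \<le> F"
  defines "K \<equiv> 4 * (4 / (1 - exp (- c))\<^sup>2 + 1)"
  shows "(\<Sum>\<pi> | \<pi> permutes {1..n}. square_indicator n (weighted_sum n w u \<pi> - L))
    \<le> fact n * (2 * K * exp (- (l \<bullet> L) + \<bar>fst l\<bar> + \<bar>snd l\<bar> + 64 * F\<^sup>2)) / (real n)\<^sup>2"
proof -
  let ?S = "{\<pi>. \<pi> permutes {1..n}}"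
  define V where "V = weighted_sum n w u"
  define X where "X = (\<lambda>\<pi>. map (swap_step w u \<pi>) qs)"
  define m where "m = (\<lambda>\<pi>. V \<pi> - sum_list (X \<pi>))"
  define T where "T = exp (- (l \<bullet> L) + \<bar>fst l\<bar> + \<bar>snd l\<bar>)"
  define h where "h = (\<lambda>y. square_indicator n (y - L))"
  have h0: "0 \<le> h y" for y by (simp add: h_def square_indicator_def)
  have K0: "K \<ge> 0" by (simp add: K_def)
  have dq: "disjoint_pairs ps" "disjoint_pairs qs" "set (map fst ps @ map snd ps) \<subseteq> {1..n}"
    "set (map fst qs @ map snd qs) \<subseteq> {1..n}"
    using dp sub by (auto simp: disjoint_pairs_def)
  have sym_q: "(\<Sum>\<pi>\<in>?S. H (V \<pi>)) = (\<Sum>\<pi>\<in>?S. rademacher_mean (X \<pi>) H (m \<pi>))" for H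
    using sum_permutes_eq_rademacher_mean[of qs n "\<lambda>_. ()" "\<lambda>_. H" w u] dq(2,4)
    by (simp add: disjoint_pairs_def V_def X_def m_def)
  have tilt: "h y \<le> T * (exp (2 * (l \<bullet> m')) * h y + exp (2 * (l \<bullet> (y - m'))) * h y)" for y m'
  proof (cases "h y = 0")
    case False
    then have "\<bar>fst (y - L)\<bar> \<le> 1 / real n" "\<bar>snd (y - L)\<bar> \<le> 1 / real n" "h y = 1"
      by (auto simp: h_def square_indicator_def split: if_splits)
    moreover have "1 / real n \<le> 1" using n by simp
    ultimately have a: "\<bar>fst (y - L)\<bar> \<le> 1" "\<bar>snd (y - L)\<bar> \<le> 1" and h1: "h y = 1" by linarith+
    have "\<bar>fst l * fst (y - L)\<bar> \<le> \<bar>fst l\<bar> * 1"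
      unfolding abs_mult using a(1) by (intro mult_left_mono) auto
    moreover have "\<bar>snd l * snd (y - L)\<bar> \<le> \<bar>snd l\<bar> * 1"
      unfolding abs_mult using a(2) by (intro mult_left_mono) auto
    ultimately have "l \<bullet> (y - L) \<ge> - (\<bar>fst l\<bar> + \<bar>snd l\<bar>)" by (simp add: inner_prod_def)
    then have "0 \<le> (- (l \<bullet> L) + \<bar>fst l\<bar> + \<bar>snd l\<bar>) + l \<bullet> y" by (simp add: inner_diff_right)
    moreover have "l \<bullet> y = l \<bullet> m' + l \<bullet> (y - m')" by (simp add: inner_diff_right)
    ultimately consider "0 \<le> (- (l \<bullet> L) + \<bar>fst l\<bar> + \<bar>snd l\<bar>) + 2 * (l \<bullet> m')"
      | "0 \<le> (- (l \<bullet> L) + \<bar>fst l\<bar> + \<bar>snd l\<bar>) + 2 * (l \<bullet> (y - m'))" by linarith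
    then have "1 \<le> T * exp (2 * (l \<bullet> m')) \<or> 1 \<le> T * exp (2 * (l \<bullet> (y - m')))"
      by cases (auto simp: T_def simp flip: exp_add)
    moreover have "0 \<le> T * exp (2 * (l \<bullet> m'))" "0 \<le> T * exp (2 * (l \<bullet> (y - m')))" by (auto simp: T_def)
    ultimately show ?thesis using h1 by (auto simp: distrib_left)
  qed simp
  have fixed: "(\<Sum>\<pi>\<in>?S. exp (2 * (l \<bullet> m \<pi>)) * rademacher_mean (X \<pi>) h (m \<pi>))
      \<le> fact n * exp (64 * F\<^sup>2) * K / (real n)\<^sup>2"
  proof -
    have "(\<Sum>\<pi>\<in>?S. exp (2 * (l \<bullet> m \<pi>)) * rademacher_mean (X \<pi>) h (m \<pi>))
        \<le> (\<Sum>\<pi>\<in>?S. exp (2 * (l \<bullet> m \<pi>)) * cos_prod_mean n (map (swap_step w u \<pi>) qs))"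
      unfolding h_def X_def
      using rademacher_mean_square_indicator_le[OF n, of _ "- L"]
      by (intro sum_mono mult_left_mono) auto
    also have "\<dots> \<le> fact n * exp (64 * F\<^sup>2) * K / (real n)\<^sup>2"
      unfolding K_def
    proof (rule sum_exp_mult_cos_prod_mean_le[OF c n _ bound])
      \<comment> \<open>The centre \<open>m \<pi>\<close> is a mean of the full sum over the swaps,
        so its exponential moment is at most that of the full sum; this instance of Jensen's
        inequality is cosh \<ge> 1. The factor 4 combines the doubling in the tilt with that of
        Cauchy-Schwarz.\<close>
      have "exp (2 * (2 * (l \<bullet> m \<pi>))) \<le> rademacher_mean (X \<pi>) (\<lambda>y. exp ((4 *\<^sub>R l) \<bullet> y)) (m \<pi>)" for \<pi>
      proof -
        have "1 \<le> (\<Prod>x\<leftarrow>X \<pi>. cosh ((4 *\<^sub>R l) \<bullet> x))"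
          by (rule prod_list_cosh_ge_1)
        then show ?thesis
          unfolding rademacher_mean_exp by simp
      qed
      then have "(\<Sum>\<pi>\<in>?S. exp (2 * (2 * (l \<bullet> m \<pi>)))) \<le> (\<Sum>\<pi>\<in>?S. exp ((4 *\<^sub>R l) \<bullet> V \<pi>))"
        unfolding sym_q[of "\<lambda>y. exp ((4 *\<^sub>R l) \<bullet> y)"] by (intro sum_mono)
      also have "\<dots> \<le> fact n * exp (8 * (4 * F)\<^sup>2)"
        unfolding V_def using F by (intro sum_permutes_exp_inner_le w n) (auto simp: abs_mult)
      also have "exp (8 * (4 * F)\<^sup>2) = (exp (64 * F\<^sup>2))\<^sup>2"
        by (simp add: power_mult_distrib flip: exp_double)
      finally show "(\<Sum>\<pi>\<in>?S. exp (2 * (2 * (l \<bullet> m \<pi>)))) \<le> fact n * (exp (64 * F\<^sup>2))\<^sup>2" .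
    qed auto
    finally show ?thesis .
  qed
  have swapped: "(\<Sum>\<pi>\<in>?S. rademacher_mean (X \<pi>) (\<lambda>y. exp (2 * (l \<bullet> (y - m \<pi>))) * h y) (m \<pi>))
      \<le> fact n * exp (64 * F\<^sup>2) * K / (real n)\<^sup>2"
  proof -
    \<comment> \<open>The swapped part is recentred at 0 and the fixed part written as the full sum
      minus \<open>sum_list xs\<close>. Since the steps of \<open>qs\<close> are invariant under the
      swaps in \<open>ps\<close>, the latter can then randomise the full sum alone.\<close>
    define H where "H = (\<lambda>xs y. rademacher_mean xs
        (\<lambda>x. exp ((2 *\<^sub>R l) \<bullet> x) * square_indicator n (y + x + (- sum_list xs - L))) 0)"
    have "(\<Sum>\<pi>\<in>?S. rademacher_mean (X \<pi>) (\<lambda>y. exp (2 * (l \<bullet> (y - m \<pi>))) * h y) (m \<pi>))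
        = (\<Sum>\<pi>\<in>?S. H (X \<pi>) (V \<pi>))"
    proof (intro sum.cong refl)
      fix \<pi>
      show "rademacher_mean (X \<pi>) (\<lambda>y. exp (2 * (l \<bullet> (y - m \<pi>))) * h y) (m \<pi>) = H (X \<pi>) (V \<pi>)"
        using rademacher_mean_shift[of "X \<pi>"
          "\<lambda>x. exp ((2 *\<^sub>R l) \<bullet> x) * square_indicator n (V \<pi> + x + (- sum_list (X \<pi>) - L))" "- m \<pi>" "m \<pi>"]
        by (simp add: H_def h_def m_def algebra_simps)
    qed
    also have "\<dots> = (\<Sum>\<pi>\<in>?S. rademacher_mean (map (swap_step w u \<pi>) ps) (H (X \<pi>))
        (V \<pi> - (\<Sum>p\<leftarrow>ps. swap_step w u \<pi> p)))"
      unfolding V_def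
    proof (rule sum_permutes_eq_rademacher_mean)
      fix i j \<pi> assume ij: "(i, j) \<in> set ps"
      show "X (\<pi> \<circ> Transposition.transpose i j) = X \<pi>"
        unfolding X_def
      proof (rule map_cong[OF refl])
        fix q assume "q \<in> set qs"
        then have "fst q \<notin> {i, j}" "snd q \<notin> {i, j}"
          using dp ij by (auto simp: disjoint_pairs_def disjoint_iff rev_image_eqI)
        then show "swap_step w u (\<pi> \<circ> Transposition.transpose i j) q = swap_step w u \<pi> q"
          by (auto simp: swap_step_def Transposition.transpose_def)
      qed
    qed (use dq in \<open>auto simp: disjoint_pairs_def\<close>)
    also have "\<dots> \<le> (\<Sum>\<pi>\<in>?S. cos_prod_mean n (map (swap_step w u \<pi>) ps) * exp (64 * F\<^sup>2))"
    proof (rule sum_mono)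
      fix \<pi> assume \<pi>: "\<pi> \<in> ?S"
      define q where "q = cos_prod_mean n (map (swap_step w u \<pi>) ps)"
      have q0: "0 \<le> q"
        unfolding q_def cos_prod_mean_def fejer_sum_def
        by (intro mult_nonneg_nonneg sum_nonneg) (auto intro!: prod_list_nonneg)
      have "rademacher_mean (map (swap_step w u \<pi>) ps) (H (X \<pi>))
          (V \<pi> - (\<Sum>p\<leftarrow>ps. swap_step w u \<pi> p))
        \<le> q * exp ((2 *\<^sub>R l) \<bullet> 0) * (\<Prod>x\<leftarrow>X \<pi>. cosh ((2 *\<^sub>R l) \<bullet> x))"
        unfolding H_def
      proof (rule rademacher_mean_exp_mult_le)
        fix z m'
        show "rademacher_mean (map (swap_step w u \<pi>) ps)
            (\<lambda>y. square_indicator n (y + z + (- sum_list (X \<pi>) - L))) m' \<le> q"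
          using rademacher_mean_square_indicator_le[OF n, of "map (swap_step w u \<pi>) ps"
            "z + (- sum_list (X \<pi>) - L)" m']
          by (simp add: q_def add.assoc)
      qed
      also have "\<dots> \<le> q * exp (64 * F\<^sup>2)"
      proof -
        \<comment> \<open>The values enter only through \<open>F\<close> and the squared gaps sum to
          at most 2, so this bound is uniform in \<pi> and can be taken out before the cosines are
          averaged.\<close>
        have "(\<Prod>x\<leftarrow>X \<pi>. cosh ((2 *\<^sub>R l) \<bullet> x)) \<le> exp (\<Sum>x\<leftarrow>X \<pi>. ((2 *\<^sub>R l) \<bullet> x)\<^sup>2)"
          by (intro prod_list_le_exp_sum_list conjI cosh_le_exp_square cosh_real_nonneg)
        also have "(\<Sum>x\<leftarrow>X \<pi>. ((2 *\<^sub>R l) \<bullet> x)\<^sup>2) \<le> (\<Sum>p\<leftarrow>qs. (w (fst p) - w (snd p))\<^sup>2 * (4 * F\<^sup>2))"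
          unfolding X_def map_map
        proof (rule sum_list_mono)
          fix p assume p: "p \<in> set qs"
          then have "fst p \<in> {1..n}" "snd p \<in> {1..n}" using dq(4) by (auto simp: image_subset_iff)
          then have "\<pi> (fst p) \<in> {1..n}" "\<pi> (snd p) \<in> {1..n}" 
            using \<pi> permutes_in_image[of \<pi> "{1..n}"] by auto
          then have "\<bar>l \<bullet> u (\<pi> (fst p)) - l \<bullet> u (\<pi> (snd p))\<bar> \<le> 2 * F"
            using F[of "\<pi> (fst p)"] F[of "\<pi> (snd p)"] by linarith
          then have "\<bar>l \<bullet> u (\<pi> (fst p)) - l \<bullet> u (\<pi> (snd p))\<bar>\<^sup>2 \<le> (2 * F)\<^sup>2" by (intro power_mono) auto
          then have "(w (fst p) - w (snd p))\<^sup>2 * (l \<bullet> u (\<pi> (fst p)) - l \<bullet> u (\<pi> (snd p)))\<^sup>2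
              \<le> (w (fst p) - w (snd p))\<^sup>2 * (4 * F\<^sup>2)"
            by (intro mult_left_mono) (auto simp: power_mult_distrib)
          moreover have "(2 *\<^sub>R l) \<bullet> swap_step w u \<pi> p
              = (w (fst p) - w (snd p)) * (l \<bullet> u (\<pi> (fst p)) - l \<bullet> u (\<pi> (snd p)))"
            by (simp add: swap_step_def inner_diff_right)
          ultimately show "((\<lambda>x. ((2 *\<^sub>R l) \<bullet> x)\<^sup>2) \<circ> swap_step w u \<pi>) p
              \<le> (w (fst p) - w (snd p))\<^sup>2 * (4 * F\<^sup>2)"
            by (simp only: o_def power_mult_distrib)
        qed
        also have "\<dots> = (\<Sum>p\<leftarrow>qs. (w (fst p) - w (snd p))\<^sup>2) * (4 * F\<^sup>2)"
          by (rule sum_list_mult_const)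
        also have "\<dots> \<le> 2 * (4 * F\<^sup>2)"
          using sum_list_square_diff_le[OF dq(2,4), of w] w(2) by (intro mult_right_mono) auto
        also have "\<dots> \<le> 64 * F\<^sup>2" by simp
        finally show ?thesis using q0 by (simp add: mult_left_mono)
      qed
      finally show "rademacher_mean (map (swap_step w u \<pi>) ps) (H (X \<pi>))
          (V \<pi> - (\<Sum>p\<leftarrow>ps. swap_step w u \<pi> p)) \<le> q * exp (64 * F\<^sup>2)" .
    qed
    also have "\<dots> = exp (64 * F\<^sup>2) * (\<Sum>\<pi>\<in>?S. exp 0 * cos_prod_mean n (map (swap_step w u \<pi>) ps))"
      by (simp add: sum_distrib_left mult.commute)
    also have "\<dots> \<le> exp (64 * F\<^sup>2) * (fact n * 1 * K / (real n)\<^sup>2)"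
      unfolding K_def
    proof (intro mult_left_mono sum_exp_mult_cos_prod_mean_le[OF c n _ bound])
      show "(\<Sum>\<pi>\<in>?S. exp (2 * 0)) \<le> fact n * (1 :: real)\<^sup>2"
        by (simp add: card_permutations)
    qed auto
    finally show ?thesis by (simp add: mult_ac)
  qed
  have "(\<Sum>\<pi>\<in>?S. square_indicator n (weighted_sum n w u \<pi> - L)) = (\<Sum>\<pi>\<in>?S. rademacher_mean (X \<pi>) h (m \<pi>))"
    using sym_q[of h] by (simp add: h_def V_def)
  also have "\<dots> \<le> (\<Sum>\<pi>\<in>?S. rademacher_mean (X \<pi>)
      (\<lambda>y. T * (exp (2 * (l \<bullet> m \<pi>)) * h y + exp (2 * (l \<bullet> (y - m \<pi>))) * h y)) (m \<pi>))"
    by (intro sum_mono rademacher_mean_mono tilt)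
  also have "\<dots> = T * ((\<Sum>\<pi>\<in>?S. exp (2 * (l \<bullet> m \<pi>)) * rademacher_mean (X \<pi>) h (m \<pi>))
      + (\<Sum>\<pi>\<in>?S. rademacher_mean (X \<pi>) (\<lambda>y. exp (2 * (l \<bullet> (y - m \<pi>))) * h y) (m \<pi>)))"
    unfolding rademacher_mean_cmult rademacher_mean_add
    by (simp add: sum.distrib flip: sum_distrib_left)
  also have "\<dots> \<le> T * (fact n * exp (64 * F\<^sup>2) * K / (real n)\<^sup>2 + fact n * exp (64 * F\<^sup>2) * K / (real n)\<^sup>2)"
    by (intro mult_left_mono add_mono fixed swapped) (simp add: T_def)
  also have "\<dots> = fact n * (2 * K * exp (- (l \<bullet> L) + \<bar>fst l\<bar> + \<bar>snd l\<bar> + 64 * F\<^sup>2)) / (real n)\<^sup>2"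
    unfolding exp_add[of _ "64 * F\<^sup>2"] T_def by simp
  finally show ?thesis .
qed

text \<open>A larger \<open>A\<close> is a stronger hypothesis, so the constants found for
  \<open>A0\<close> serve every \<open>A\<close> above it.\<close>

lemma spread_weights_antimono:
  assumes "spread_weights A n w" "0 < A0" "A0 \<le> A" "n \<ge> 2"
  shows "spread_weights A0 n w"
proof -
  have "0 < ln (real n)" using assms(4) by simp
  then have "1 / (A * sqrt (ln (real n))) \<le> 1 / (A0 * sqrt (ln (real n)))"
    using assms(2,3) by (intro divide_left_mono mult_right_mono mult_pos_pos) auto
  then show ?thesis using assms(1) unfolding spread_weights_def by (meson order.trans)
qed

section \<open>Choice of the tilt and of the final constants\<close>

theorem theorem2p10:
  fixes d :: nat and \<delta> b c B :: real
  assumes "d \<ge> 2" and "\<delta> > 0" and "b \<noteq> 0" and "c \<noteq> 0" and "B > 0"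
  shows "\<exists>A0 > 0. \<forall>A \<ge> A0.
    (\<exists>K. \<forall>n \<ge> 2. \<forall>w I v v'. admissible d \<delta> b c B A n w I v v' \<longrightarrow>
       (\<forall>L1 L2. joint_small_ball_prob n w v v' L1 L2 \<le> K / (real n)\<^sup>2)) \<and>
    (\<forall>Bt > 0. \<exists>K' > 0. \<exists>\<kappa> > 0. \<forall>n \<ge> 2. \<forall>w I v v'.
       admissible d \<delta> b c B A n w I v v' \<and> (\<forall>i\<in>{1..n}. \<bar>v i\<bar> \<le> Bt \<and> \<bar>v' i\<bar> \<le> Bt) \<longrightarrow>
       (\<forall>L1 L2. joint_small_ball_prob n w v v' L1 L2
          \<le> K' / (real n)\<^sup>2 * exp (- \<kappa> * (L1\<^sup>2 + L2\<^sup>2))))"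
proof (cases "\<delta> \<le> 1")
  case False
  \<comment> \<open>For \<open>\<delta> > 1\<close> the index set would need more than n elements,
    so both claims hold vacuously; the other case supplies the bound \<open>\<delta> \<le> 1\<close>
    used by the estimates above.\<close>
  have no: "\<not> admissible d \<delta> b c B A n w I v v'" if n: "n \<ge> 2" for A n w I v v'
  proof
    assume a: "admissible d \<delta> b c B A n w I v v'"
    then have "card I \<le> n" using card_mono[of "{1..n}" I] by (auto simp: admissible_def)
    then have "real (card I) \<le> 1 * real n" by simp
    also have "\<dots> < \<delta> * real n" using False n by (intro mult_strict_right_mono) auto
    finally have "real (card I) < \<delta> * real n" .
    then show False using a by (simp add: admissible_def)
  qed
  show ?thesis
    by (rule exI[of _ 1]) (use no in \<open>auto intro: exI[of _ "1 :: real"]\<close>)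
next
  case True
  obtain A0 c2 where A0: "0 < A0" and c2: "0 < c2" and pairs:
    "\<And>n w I v v'. n \<ge> 2 \<Longrightarrow> admissible d \<delta> b c B A0 n w I v v' \<Longrightarrow>
      \<exists>ps qs. disjoint_pairs (ps @ qs) \<and> set (map fst (ps @ qs) @ map snd (ps @ qs)) \<subseteq> {1..n} \<and>
        (\<forall>rs\<in>{ps, qs}. \<forall>s t. \<bar>s\<bar> \<le> real n \<longrightarrow> \<bar>t\<bar> \<le> real n \<longrightarrow>
          (\<Sum>\<pi> | \<pi> permutes {1..n}. \<Prod>p\<leftarrow>rs. (cos ((s, t) \<bullet> swap_step w (\<lambda>a. (v a, v' a)) \<pi> p))\<^sup>2)
            \<le> fact n * (exp (- c2 * (s\<^sup>2 + t\<^sup>2)) + 1 / (real n)\<^sup>2)\<^sup>2)"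
    using exists_decoupling_pairs[OF assms(1,2) True assms(3-5)] by blast
  define K where "K = 4 * (4 / (1 - exp (- c2))\<^sup>2 + 1)"
  have K0: "K > 0" by (simp add: K_def add_nonneg_pos)
  show ?thesis
  proof (rule exI[of _ A0], rule conjI[OF A0], intro allI impI conjI)
    fix A assume A: "A0 \<le> A"
    show "\<exists>K. \<forall>n \<ge> 2. \<forall>w I v v'. admissible d \<delta> b c B A n w I v v' \<longrightarrow>
       (\<forall>L1 L2. joint_small_ball_prob n w v v' L1 L2 \<le> K / (real n)\<^sup>2)"
    proof (intro exI[of _ K] allI impI)
      fix n w I v v' and L1 L2 :: real
      assume n: "2 \<le> n" and adm: "admissible d \<delta> b c B A n w I v v'"
      then have adm0: "admissible d \<delta> b c B A0 n w I v v'"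
        using spread_weights_antimono[OF _ A0 A n] by (auto simp: admissible_def)
      obtain ps qs where pq: "disjoint_pairs (ps @ qs)"
        "set (map fst (ps @ qs) @ map snd (ps @ qs)) \<subseteq> {1..n}"
        "\<forall>rs\<in>{ps, qs}. \<forall>s t. \<bar>s\<bar> \<le> real n \<longrightarrow> \<bar>t\<bar> \<le> real n \<longrightarrow>
          (\<Sum>\<pi> | \<pi> permutes {1..n}. \<Prod>p\<leftarrow>rs. (cos ((s, t) \<bullet> swap_step w (\<lambda>a. (v a, v' a)) \<pi> p))\<^sup>2)
            \<le> fact n * (exp (- c2 * (s\<^sup>2 + t\<^sup>2)) + 1 / (real n)\<^sup>2)\<^sup>2"
        using pairs[OF n adm0] by (elim exE conjE) (rule that)
      let ?u = "\<lambda>a. (v a, v' a)"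
      have "disjoint_pairs ps" using pq(1) by (auto simp: disjoint_pairs_def)
      then have "(\<Sum>\<pi> | \<pi> permutes {1..n}. square_indicator n (weighted_sum n w ?u \<pi> - (L1, L2)))
          \<le> (\<Sum>\<pi> | \<pi> permutes {1..n}. exp 0 * cos_prod_mean n (map (swap_step w ?u \<pi>) ps))"
        using sum_permutes_square_indicator_le[of n ps w ?u "(L1, L2)"] n pq(2) by simp
      also have "\<dots> \<le> fact n * 1 * K / (real n)\<^sup>2"
        unfolding K_def
      proof (rule sum_exp_mult_cos_prod_mean_le[OF c2 _ _ pq(3)[rule_format]])
        show "(\<Sum>\<pi> | \<pi> permutes {1..n}. exp (2 * 0)) \<le> fact n * (1 :: real)\<^sup>2"
          by (simp add: card_permutations)
      qed (use n in auto)
      finally show "joint_small_ball_prob n w v v' L1 L2 \<le> K / (real n)\<^sup>2"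
        unfolding joint_small_ball_prob_eq by (simp add: field_simps)
    qed
  next
    fix A Bt :: real assume A: "A0 \<le> A" and Bt: "0 < Bt"
    \<comment> \<open>The tilt is \<open>k\<close> times (L1, L2). It gains k S with S = L1^2 +
      L2^2, while the moment cost 64 F^2 is at most 128 k^2 Bt^2 S; this \<open>k\<close> makes the
      cost a quarter of the gain.\<close>
    define k where "k = 1 / (512 * Bt\<^sup>2)"
    have k: "k > 0" "128 * k * Bt\<^sup>2 = 1 / 4" using Bt by (auto simp: k_def)
    have pos: "0 < 2 * K * exp (2 * k)" "0 < k / 2" using K0 k by auto
    show "\<exists>K' > 0. \<exists>\<kappa> > 0. \<forall>n \<ge> 2. \<forall>w I v v'.
       admissible d \<delta> b c B A n w I v v' \<and> (\<forall>i\<in>{1..n}. \<bar>v i\<bar> \<le> Bt \<and> \<bar>v' i\<bar> \<le> Bt) \<longrightarrow>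
       (\<forall>L1 L2. joint_small_ball_prob n w v v' L1 L2
          \<le> K' / (real n)\<^sup>2 * exp (- \<kappa> * (L1\<^sup>2 + L2\<^sup>2)))"
    proof (rule exI[of _ "2 * K * exp (2 * k)"], rule conjI[OF pos(1)], rule exI[of _ "k / 2"],
        rule conjI[OF pos(2)], intro allI impI, elim conjE)
      fix n w I v v' and L1 L2 :: real
      assume n: "2 \<le> n" and adm: "admissible d \<delta> b c B A n w I v v'"
        and v: "\<forall>i\<in>{1..n}. \<bar>v i\<bar> \<le> Bt \<and> \<bar>v' i\<bar> \<le> Bt"
      have adm0: "admissible d \<delta> b c B A0 n w I v v'"
        using spread_weights_antimono[OF _ A0 A n] adm by (auto simp: admissible_def)
      obtain ps qs where pq: "disjoint_pairs (ps @ qs)"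
        "set (map fst (ps @ qs) @ map snd (ps @ qs)) \<subseteq> {1..n}"
        "\<forall>rs\<in>{ps, qs}. \<forall>s t. \<bar>s\<bar> \<le> real n \<longrightarrow> \<bar>t\<bar> \<le> real n \<longrightarrow>
          (\<Sum>\<pi> | \<pi> permutes {1..n}. \<Prod>p\<leftarrow>rs. (cos ((s, t) \<bullet> swap_step w (\<lambda>a. (v a, v' a)) \<pi> p))\<^sup>2)
            \<le> fact n * (exp (- c2 * (s\<^sup>2 + t\<^sup>2)) + 1 / (real n)\<^sup>2)\<^sup>2"
        using pairs[OF n adm0] by (elim exE conjE) (rule that)
      have w: "(\<Sum>i\<in>{1..n}. w i) = 0" "(\<Sum>i\<in>{1..n}. (w i)\<^sup>2) = 1"
        using adm by (auto simp: admissible_def spread_weights_def)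
      define S where "S = L1\<^sup>2 + L2\<^sup>2"
      define l where "l = (k * L1, k * L2)"
      define F where "F = k * (\<bar>L1\<bar> + \<bar>L2\<bar>) * Bt"
      have F: "\<bar>l \<bullet> (v a, v' a)\<bar> \<le> F" if "a \<in> {1..n}" for a
      proof -
        have "\<bar>k * L1 * v a\<bar> \<le> k * \<bar>L1\<bar> * Bt" "\<bar>k * L2 * v' a\<bar> \<le> k * \<bar>L2\<bar> * Bt"
          unfolding abs_mult using v that k by (auto intro!: mult_mono)
        then show ?thesis by (simp add: l_def F_def algebra_simps)
      qed
      have "(\<Sum>\<pi> | \<pi> permutes {1..n}. square_indicator n (weighted_sum n w (\<lambda>a. (v a, v' a)) \<pi> - (L1, L2)))
        \<le> fact n * (2 * K * exp (- (l \<bullet> (L1, L2)) + \<bar>fst l\<bar> + \<bar>snd l\<bar> + 64 * F\<^sup>2)) / (real n)\<^sup>2"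
        unfolding K_def
        by (rule sum_permutes_square_indicator_tilted_le[OF _ pq(1,2) w c2 pq(3)[rule_format] F]) (use n in auto)
      also have "exp (- (l \<bullet> (L1, L2)) + \<bar>fst l\<bar> + \<bar>snd l\<bar> + 64 * F\<^sup>2) \<le> exp (2 * k - k / 2 * S)"
      proof -
        \<comment> \<open>The linear terms from the width of the square cost another quarter of the
          gain plus the constant \<open>2 * k\<close>, which leaves the decay rate
          \<open>k / 2\<close>.\<close>
        have "\<bar>L1\<bar> \<le> L1\<^sup>2 / 4 + 1" "\<bar>L2\<bar> \<le> L2\<^sup>2 / 4 + 1"
          using zero_le_power2[of "\<bar>L1\<bar> / 2 - 1"] zero_le_power2[of "\<bar>L2\<bar> / 2 - 1"]
          by (auto simp: power2_diff power_divide)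
        then have "\<bar>L1\<bar> + \<bar>L2\<bar> \<le> (L1\<^sup>2 / 4 + 1) + (L2\<^sup>2 / 4 + 1)" by (rule add_mono)
        also have "\<dots> = S / 4 + 2" by (simp add: S_def add_divide_distrib)
        finally have "\<bar>L1\<bar> + \<bar>L2\<bar> \<le> S / 4 + 2" .
        then have "k * (\<bar>L1\<bar> + \<bar>L2\<bar>) \<le> k * (S / 4 + 2)" using k by (intro mult_left_mono) auto
        moreover have "\<bar>fst l\<bar> + \<bar>snd l\<bar> = k * (\<bar>L1\<bar> + \<bar>L2\<bar>)" using k by (simp add: l_def abs_mult algebra_simps)
        moreover have "l \<bullet> (L1, L2) = k * S" by (simp add: l_def S_def power2_eq_square algebra_simps)
        moreover have "64 * F\<^sup>2 \<le> k * (S / 4)"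
        proof -
          have "(\<bar>L1\<bar> + \<bar>L2\<bar>)\<^sup>2 \<le> 2 * S"
            using zero_le_power2[of "\<bar>L1\<bar> - \<bar>L2\<bar>"] by (simp add: S_def power2_sum power2_diff)
          then have "64 * k\<^sup>2 * Bt\<^sup>2 * (\<bar>L1\<bar> + \<bar>L2\<bar>)\<^sup>2 \<le> 64 * k\<^sup>2 * Bt\<^sup>2 * (2 * S)" by (intro mult_left_mono) auto
          also have "\<dots> = k * S * (128 * k * Bt\<^sup>2)" by (simp add: power2_eq_square)
          finally show ?thesis unfolding k(2) by (simp add: F_def power_mult_distrib mult_ac)
        qed
        ultimately have "- (l \<bullet> (L1, L2)) + \<bar>fst l\<bar> + \<bar>snd l\<bar> + 64 * F\<^sup>2 \<le> 2 * k - k / 2 * S"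
          by (simp add: algebra_simps)
        then show ?thesis by simp
      qed
      finally have "(\<Sum>\<pi> | \<pi> permutes {1..n}. square_indicator n (weighted_sum n w (\<lambda>a. (v a, v' a)) \<pi> - (L1, L2)))
        \<le> fact n * (2 * K * exp (2 * k - k / 2 * S)) / (real n)\<^sup>2"
        using K0 by (simp add: mult_left_mono divide_right_mono)
      then have "joint_small_ball_prob n w v v' L1 L2
          \<le> fact n * (2 * K * exp (2 * k - k / 2 * S)) / (real n)\<^sup>2 / fact n"
        unfolding joint_small_ball_prob_eq by (rule divide_right_mono) simp
      also have "\<dots> = 2 * K * exp (2 * k - k / 2 * S) / (real n)\<^sup>2" by simp
      also have "\<dots> = 2 * K * exp (2 * k) / (real n)\<^sup>2 * exp (- (k / 2) * (L1\<^sup>2 + L2\<^sup>2))"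
      proof -
        have "exp (2 * k - k / 2 * S) = exp (2 * k) * exp (- (k / 2) * S)" by (simp flip: exp_add)
        then show ?thesis by (simp only: S_def mult.assoc times_divide_eq_left times_divide_eq_right)
      qed
      finally show "joint_small_ball_prob n w v v' L1 L2
          \<le> 2 * K * exp (2 * k) / (real n)\<^sup>2 * exp (- (k / 2) * (L1\<^sup>2 + L2\<^sup>2))" .
    qed
  qed
qed

end
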